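(* Let $\mathbf I$ be a well-ordered set, let $\mathsf E$ be the category of left $R$-modules or of right $R$-modules over a ring $R$, or the category of groups, and let $f:\mathbf I\to\mathsf E$ be a functor with saecular CDI homomorphism $\Omega$. Let $\lambda$ be a linearization of $\mathbb I(\mathbf I)$ and let $\Sigma=\Omega|_{\mathbb A(\lambda)}$ be the subsaecular series of $f$ subordinate to $\lambda$. Then for every $J\in\mathbb I(\mathbf I)$ the $J$-th subsaecular factor $$\frac{\Sigma(\downarrow_\lambda J)}{\Sigma(\mathring\downarrow_\lambda J)}$$ is canonically isomorphic to $\Omega(\downarrow J)/\Omega(\mathring\downarrow J)$. In particular, the isomorphism type of the $J$-th subsaecular factor is independent of $\lambda$.
   Context: For a poset $P$, $\mathbb A(P)$ is the lattice of down-closed subsets of $P$, ordered by inclusion. $\mathbb I(\mathbf I)$ is the set of nonempty intervals (order-convex subsets) of $\mathbf I$; each has the form $J=T\setminus S$ for a unique pair of down-closed $S\subsetneq T\subseteq\mathbf I$, written $J\sim(S,T)$; partially order $\mathbb I(\mathbf I)$ by $J\le J'$ iff $S\subseteq S'$ and $T\subseteq T'$, where $J\sim(S,T)$ and $J'\sim(S',T')$. Put $\downarrow J=\{L:L\le J\}$, $\mathring\downarrow J=\{L:L<J\}$. A linearization $\lambda$ of $\mathbb I(\mathbf I)$ is a total order on the same set extending the partial order; $\downarrow_\lambda J$, $\mathring\downarrow_\lambda J$ are the corresponding down-sets in $\lambda$, and $\mathbb A(\lambda)\subseteq\mathbb A(\mathbb I(\mathbf I))$. $\mathrm{Sub}(f)$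 is the complete lattice of subdiagrams of $f$. A fraction $M/N$ of subdiagrams $N\subseteq M$ means the quotient in $[\mathbf I,\mathsf E]$ when $\mathsf E$ is a module category; for groups it means the diagram of pointed sets of left cosets of $N_a$ in $M_a$ (distinguished point $N_a$), and isomorphisms are then taken in $[\mathbf I,\mathsf{Set}_*]$, where $\mathsf{Set}_*$ is the category of pointed sets. The saecular CDI homomorphism is the unique lattice homomorphism $\Omega:\mathbb A(\mathbb I(\mathbf I))\to\mathrm{Sub}(f)$ preserving arbitrary joins and meets such that, for all $J\in\mathbb I(\mathbf I)$, $\Omega(\downarrow J)/\Omega(\mathring\downarrow J)$ is an interval diagram of support type $J$, i.e. it is a zero object at each $a\notin J$ and its structure maps between elements of $J$ are isomorphisms (existence and uniqueness are known). Canonically isomorphic: for pairs $N\le M$ and $N'\le M'$ of subdiagrams, the canonical isomorphism $M/N\cong M'/N'$ is the one, when the maps below are isomorphisms, making the diagram of maps induced by inclusions $$\frac{M\wedge M'}{N\wedge N'}\to\frac MN\to\frac{M\vee M'}{N\vee N'},\qquad \frac{M\wedge M'}{N\wedge N'}\to\frac{M'}{N'}\to\frac{M\vee M'}{N\vee N'}$$ commute (all of these maps being isomorphisms).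
   Formalization: For groups the listed conditions need not determine Ω uniquely (e.g. A→A*B→A), and the claim fails for some such Ω; here Ω must be either the unique such homomorphism or the one whose value on {J : J⊆T} is, for every down-closed T, the subdiagram of elements that become trivial outside T. *)

theory Defs
  imports "HOL-Algebra.Module" "HOL-Algebra.AbelCoset" "HOL-Algebra.Complete_Lattice"
begin

section \<open>Lattices of down-sets, linearizations\<close>

definition downset :: "('p, 'z) gorder_scheme \<Rightarrow> 'p set \<Rightarrow> bool" where
  "downset P D \<longleftrightarrow> D \<subseteq> carrier P \<and> (\<forall>x\<in>D. \<forall>y\<in>carrier P. y \<sqsubseteq>\<^bsub>P\<^esub> x \<longrightarrow> y \<in> D)"

definition downset_lattice :: "('p, 'z) gorder_scheme \<Rightarrow> 'p set gorder" where
  "downset_lattice P = \<lparr>carrier = {D. downset P D}, eq = (=), le = (\<subseteq>)\<rparr>"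

definition down :: "('p, 'z) gorder_scheme \<Rightarrow> 'p \<Rightarrow> 'p set" where
  "down P J = {L \<in> carrier P. L \<sqsubseteq>\<^bsub>P\<^esub> J}"

definition sdown :: "('p, 'z) gorder_scheme \<Rightarrow> 'p \<Rightarrow> 'p set" where
  "sdown P J = {L \<in> carrier P. L \<sqsubset>\<^bsub>P\<^esub> J}"

definition linearization :: "('p, 'z) gorder_scheme \<Rightarrow> 'p gorder \<Rightarrow> bool" where
  "linearization P lam \<longleftrightarrow> total_order lam \<and> carrier lam = carrier P \<and>
     (\<forall>x\<in>carrier P. \<forall>y\<in>carrier P. x \<sqsubseteq>\<^bsub>P\<^esub> y \<longrightarrow> x \<sqsubseteq>\<^bsub>lam\<^esub> y)"


section \<open>The poset of intervals\<close>

definition index_poset :: "'i::linorder gorder" where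
  "index_poset = \<lparr>carrier = UNIV, eq = (=), le = (\<le>)\<rparr>"

text \<open>\<open>represents J S T\<close> is the relation \<open>J \<sim> (S, T)\<close>.\<close>

definition represents :: "'i::linorder set \<Rightarrow> 'i set \<Rightarrow> 'i set \<Rightarrow> bool" where
  "represents J S T \<longleftrightarrow> downset index_poset S \<and> downset index_poset T \<and> S \<subset> T \<and> J = T - S"

definition intervals :: "'i::linorder set gorder" where
  "intervals = \<lparr>carrier = {J. J \<noteq> {} \<and> (\<forall>x\<in>J. \<forall>z\<in>J. \<forall>y. x \<le> y \<and> y \<le> z \<longrightarrow> y \<in> J)},
     eq = (=),
     le = (\<lambda>J J'. \<exists>S T S' T'. represents J S T \<and> represents J' S' T' \<and> S \<subseteq> S' \<and> T \<subseteq> T')\<rparr>"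


section \<open>Diagrams in a category of structured sets\<close>

text \<open>A diagram consists of its objects and its structure maps. The category in which it lives
  enters through predicates for its objects (\<open>Ob\<close>, \<open>Zero\<close>) and morphisms (\<open>Hom\<close>, \<open>Iso\<close>); maps are
  only relevant on carriers.\<close>

type_synonym ('i, 'o, 'x) diagram = "('i \<Rightarrow> 'o) \<times> ('i \<Rightarrow> 'i \<Rightarrow> 'x \<Rightarrow> 'x)"

definition is_diagram ::
  "(('x, 'm) partial_object_scheme \<Rightarrow> bool)
   \<Rightarrow> (('x, 'm) partial_object_scheme \<Rightarrow> ('x, 'm) partial_object_scheme \<Rightarrow> ('x \<Rightarrow> 'x) \<Rightarrow> bool)
   \<Rightarrow> ('i::linorder, ('x, 'm) partial_object_scheme, 'x) diagram \<Rightarrow> bool" where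
  "is_diagram Ob Hom f \<longleftrightarrow>
     (\<forall>a. Ob (fst f a)) \<and>
     (\<forall>a b. a \<le> b \<longrightarrow> Hom (fst f a) (fst f b) (snd f a b)) \<and>
     (\<forall>a. \<forall>x\<in>carrier (fst f a). snd f a a x = x) \<and>
     (\<forall>a b c. a \<le> b \<and> b \<le> c \<longrightarrow>
        (\<forall>x\<in>carrier (fst f a). snd f b c (snd f a b x) = snd f a c x))"

definition diagram_iso ::
  "(('x, 'm) partial_object_scheme \<Rightarrow> ('x, 'm) partial_object_scheme \<Rightarrow> ('x \<Rightarrow> 'x) \<Rightarrow> bool)
   \<Rightarrow> ('i::linorder, ('x, 'm) partial_object_scheme, 'x) diagram
   \<Rightarrow> ('i, ('x, 'm) partial_object_scheme, 'x) diagram \<Rightarrow> ('i \<Rightarrow> 'x \<Rightarrow> 'x) \<Rightarrow> bool" where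
  "diagram_iso Iso D E \<eta> \<longleftrightarrow>
     (\<forall>a. Iso (fst D a) (fst E a) (\<eta> a)) \<and>
     (\<forall>a b. a \<le> b \<longrightarrow> (\<forall>x\<in>carrier (fst D a). \<eta> b (snd D a b x) = snd E a b (\<eta> a x)))"

definition interval_diagram ::
  "('o \<Rightarrow> bool) \<Rightarrow> ('o \<Rightarrow> 'o \<Rightarrow> ('x \<Rightarrow> 'x) \<Rightarrow> bool) \<Rightarrow> 'i::linorder set
   \<Rightarrow> ('i, 'o, 'x) diagram \<Rightarrow> bool" where
  "interval_diagram Zero Iso J D \<longleftrightarrow>
     (\<forall>a. a \<notin> J \<longrightarrow> Zero (fst D a)) \<and>
     (\<forall>a\<in>J. \<forall>b\<in>J. a \<le> b \<longrightarrow> Iso (fst D a) (fst D b) (snd D a b))"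

text \<open>\<open>Sub a\<close> is the set of (carriers of) subobjects of the object at \<open>a\<close>.\<close>

definition subdiagrams ::
  "('i::linorder \<Rightarrow> 'x set set) \<Rightarrow> ('i \<Rightarrow> 'i \<Rightarrow> 'x \<Rightarrow> 'x) \<Rightarrow> ('i \<Rightarrow> 'x set) gorder" where
  "subdiagrams Sub \<phi> =
     \<lparr>carrier = {N. (\<forall>a. N a \<in> Sub a) \<and> (\<forall>a b. a \<le> b \<longrightarrow> \<phi> a b ` N a \<subseteq> N b)},
      eq = (=), le = (\<le>)\<rparr>"

text \<open>\<open>L\<close> is the lattice of subdiagrams and \<open>Frac N M\<close> is the fraction \<open>M / N\<close>.\<close>

definition cdi_hom ::
  "('n, 'z) gorder_scheme \<Rightarrow> ('n \<Rightarrow> 'n \<Rightarrow> ('i::linorder, 'o, 'x) diagram)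
   \<Rightarrow> ('o \<Rightarrow> bool) \<Rightarrow> ('o \<Rightarrow> 'o \<Rightarrow> ('x \<Rightarrow> 'x) \<Rightarrow> bool) \<Rightarrow> ('i set set \<Rightarrow> 'n) \<Rightarrow> bool" where
  "cdi_hom L Frac Zero Iso \<Omega> \<longleftrightarrow>
     \<Omega> \<in> carrier (downset_lattice intervals) \<rightarrow> carrier L \<and>
     sup_pres (downset_lattice intervals) L \<Omega> \<and> inf_pres (downset_lattice intervals) L \<Omega> \<and>
     (\<forall>J\<in>carrier intervals.
        interval_diagram Zero Iso J (Frac (\<Omega> (sdown intervals J)) (\<Omega> (down intervals J))))"

definition subsaecular_series :: "('i::linorder set set \<Rightarrow> 'n) \<Rightarrow> 'i set gorder \<Rightarrow> 'i set set \<Rightarrow> 'n" where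
  "subsaecular_series \<Omega> lam = restrict \<Omega> (carrier (downset_lattice lam))"

text \<open>\<open>Inc N'\<close> is, for all \<open>N \<subseteq> N'\<close> and \<open>M \<subseteq> M'\<close>, the map \<open>M / N \<rightarrow> M' / N'\<close> induced by inclusions.
  \<open>canonical_iso \<dots> N M N' M' \<eta>\<close> states that \<open>\<eta>\<close> is the canonical isomorphism from \<open>M / N\<close> to
  \<open>M' / N'\<close>.\<close>

definition canonical_iso ::
  "('n, 'z) gorder_scheme
   \<Rightarrow> ('n \<Rightarrow> 'n \<Rightarrow> ('i::linorder, ('x, 'm) partial_object_scheme, 'x) diagram)
   \<Rightarrow> (('x, 'm) partial_object_scheme \<Rightarrow> ('x, 'm) partial_object_scheme \<Rightarrow> ('x \<Rightarrow> 'x) \<Rightarrow> bool)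
   \<Rightarrow> ('n \<Rightarrow> 'i \<Rightarrow> 'x \<Rightarrow> 'x) \<Rightarrow> 'n \<Rightarrow> 'n \<Rightarrow> 'n \<Rightarrow> 'n \<Rightarrow> ('i \<Rightarrow> 'x \<Rightarrow> 'x) \<Rightarrow> bool" where
  "canonical_iso L Frac Iso Inc N M N' M' \<eta> \<longleftrightarrow>
     (let lower = Frac (N \<sqinter>\<^bsub>L\<^esub> N') (M \<sqinter>\<^bsub>L\<^esub> M'); upper = Frac (N \<squnion>\<^bsub>L\<^esub> N') (M \<squnion>\<^bsub>L\<^esub> M') in
        diagram_iso Iso lower (Frac N M) (Inc N) \<and>
        diagram_iso Iso lower (Frac N' M') (Inc N') \<and>
        diagram_iso Iso (Frac N M) upper (Inc (N \<squnion>\<^bsub>L\<^esub> N')) \<and>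
        diagram_iso Iso (Frac N' M') upper (Inc (N \<squnion>\<^bsub>L\<^esub> N')) \<and>
        diagram_iso Iso (Frac N M) (Frac N' M') \<eta> \<and>
        (\<forall>a. \<forall>C\<in>carrier (fst lower a). \<eta> a (Inc N a C) = Inc N' a C) \<and>
        (\<forall>a. \<forall>C\<in>carrier (fst (Frac N M) a).
           Inc (N \<squnion>\<^bsub>L\<^esub> N') a (\<eta> a C) = Inc (N \<squnion>\<^bsub>L\<^esub> N') a C))"


section \<open>Modules\<close>

text \<open>The library's \<open>module\<close> requires a commutative ring. For a right module, \<open>r \<odot> x\<close> stands for the
  product of \<open>x\<close> with \<open>r\<close> on the right.\<close>

locale unital_action = R?: ring R + M?: abelian_group M
  for R :: "('r, 's) ring_scheme" (structure) and M :: "('r, 'g, 'm) module_scheme" (structure) +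
  assumes smult_closed: "\<lbrakk>r \<in> carrier R; x \<in> carrier M\<rbrakk> \<Longrightarrow> r \<odot>\<^bsub>M\<^esub> x \<in> carrier M"
    and smult_l_distr: "\<lbrakk>r \<in> carrier R; s \<in> carrier R; x \<in> carrier M\<rbrakk> \<Longrightarrow>
      (r \<oplus>\<^bsub>R\<^esub> s) \<odot>\<^bsub>M\<^esub> x = r \<odot>\<^bsub>M\<^esub> x \<oplus>\<^bsub>M\<^esub> s \<odot>\<^bsub>M\<^esub> x"
    and smult_r_distr: "\<lbrakk>r \<in> carrier R; x \<in> carrier M; y \<in> carrier M\<rbrakk> \<Longrightarrow>
      r \<odot>\<^bsub>M\<^esub> (x \<oplus>\<^bsub>M\<^esub> y) = r \<odot>\<^bsub>M\<^esub> x \<oplus>\<^bsub>M\<^esub> r \<odot>\<^bsub>M\<^esub> y"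
    and smult_one: "x \<in> carrier M \<Longrightarrow> \<one>\<^bsub>R\<^esub> \<odot>\<^bsub>M\<^esub> x = x"

locale left_module = unital_action +
  assumes smult_assoc: "\<lbrakk>r \<in> carrier R; s \<in> carrier R; x \<in> carrier M\<rbrakk> \<Longrightarrow>
      (r \<otimes>\<^bsub>R\<^esub> s) \<odot>\<^bsub>M\<^esub> x = r \<odot>\<^bsub>M\<^esub> (s \<odot>\<^bsub>M\<^esub> x)"

locale right_module = unital_action +
  assumes smult_assoc: "\<lbrakk>r \<in> carrier R; s \<in> carrier R; x \<in> carrier M\<rbrakk> \<Longrightarrow>
      (r \<otimes>\<^bsub>R\<^esub> s) \<odot>\<^bsub>M\<^esub> x = s \<odot>\<^bsub>M\<^esub> (r \<odot>\<^bsub>M\<^esub> x)"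

definition module_hom ::
  "('r, 's) ring_scheme \<Rightarrow> ('r, 'g) module \<Rightarrow> ('r, 'h) module \<Rightarrow> ('g \<Rightarrow> 'h) \<Rightarrow> bool" where
  "module_hom R M N h \<longleftrightarrow> h \<in> hom (add_monoid M) (add_monoid N) \<and>
     (\<forall>r\<in>carrier R. \<forall>x\<in>carrier M. h (r \<odot>\<^bsub>M\<^esub> x) = r \<odot>\<^bsub>N\<^esub> h x)"

definition module_iso ::
  "('r, 's) ring_scheme \<Rightarrow> ('r, 'g) module \<Rightarrow> ('r, 'h) module \<Rightarrow> ('g \<Rightarrow> 'h) \<Rightarrow> bool" where
  "module_iso R M N h \<longleftrightarrow> module_hom R M N h \<and> bij_betw h (carrier M) (carrier N)"

definition module_zero :: "('r, 'g) module \<Rightarrow> bool" where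
  "module_zero M \<longleftrightarrow> carrier M = {\<zero>\<^bsub>M\<^esub>}"

definition module_sub ::
  "('r, 's) ring_scheme \<Rightarrow> ('i::linorder, ('r, 'g) module, 'g) diagram \<Rightarrow> ('i \<Rightarrow> 'g set) gorder" where
  "module_sub R f = subdiagrams (\<lambda>a. {N. submodule N R (fst f a)}) (snd f)"

text \<open>The quotient \<open>H / N\<close> for submodules \<open>N \<subseteq> H\<close> of \<open>M\<close>. The fields \<open>mult\<close> and \<open>one\<close> of a module
  record are irrelevant.\<close>

definition module_quot :: "('r, 'g) module \<Rightarrow> 'g set \<Rightarrow> 'g set \<Rightarrow> ('r, 'g set) module" where
  "module_quot M N H =
     \<lparr>carrier = (\<lambda>x. x <+\<^bsub>M\<^esub> N) ` H,
      mult = (\<lambda>_ _. undefined), one = undefined,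
      zero = N, add = (\<lambda>C D. C <+>\<^bsub>M\<^esub> D),
      smult = (\<lambda>r C. ((\<lambda>x. r \<odot>\<^bsub>M\<^esub> x) ` C) <+>\<^bsub>M\<^esub> N)\<rparr>"

definition module_inc ::
  "('i, ('r, 'g) module, 'g) diagram \<Rightarrow> ('i \<Rightarrow> 'g set) \<Rightarrow> 'i \<Rightarrow> 'g set \<Rightarrow> 'g set" where
  "module_inc f N a C = C <+>\<^bsub>fst f a\<^esub> N a"

definition module_frac ::
  "('i, ('r, 'g) module, 'g) diagram \<Rightarrow> ('i \<Rightarrow> 'g set) \<Rightarrow> ('i \<Rightarrow> 'g set)
   \<Rightarrow> ('i, ('r, 'g set) module, 'g set) diagram" where
  "module_frac f N M =
     (\<lambda>a. module_quot (fst f a) (N a) (M a), \<lambda>a b C. (snd f a b ` C) <+>\<^bsub>fst f b\<^esub> N b)"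

definition module_saecular_cdi ::
  "('r, 's) ring_scheme \<Rightarrow> ('i::linorder, ('r, 'g) module, 'g) diagram
   \<Rightarrow> ('i set set \<Rightarrow> 'i \<Rightarrow> 'g set) \<Rightarrow> bool" where
  "module_saecular_cdi R f \<Omega> \<longleftrightarrow>
     cdi_hom (module_sub R f) (module_frac f) module_zero (module_iso R) \<Omega>"


section \<open>Groups\<close>

record 'x pointed_set = "'x partial_object" +
  point :: 'x

definition pointed_iso :: "'x pointed_set \<Rightarrow> 'y pointed_set \<Rightarrow> ('x \<Rightarrow> 'y) \<Rightarrow> bool" where
  "pointed_iso P Q h \<longleftrightarrow> bij_betw h (carrier P) (carrier Q) \<and> h (point P) = point Q"

definition pointed_zero :: "'x pointed_set \<Rightarrow> bool" where
  "pointed_zero P \<longleftrightarrow> carrier P = {point P}"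

definition group_sub :: "('i::linorder, 'g monoid, 'g) diagram \<Rightarrow> ('i \<Rightarrow> 'g set) gorder" where
  "group_sub f = subdiagrams (\<lambda>a. {N. subgroup N (fst f a)}) (snd f)"

definition group_inc ::
  "('i, 'g monoid, 'g) diagram \<Rightarrow> ('i \<Rightarrow> 'g set) \<Rightarrow> 'i \<Rightarrow> 'g set \<Rightarrow> 'g set" where
  "group_inc f N a C = C <#>\<^bsub>fst f a\<^esub> N a"

definition group_frac ::
  "('i, 'g monoid, 'g) diagram \<Rightarrow> ('i \<Rightarrow> 'g set) \<Rightarrow> ('i \<Rightarrow> 'g set)
   \<Rightarrow> ('i, 'g set pointed_set, 'g set) diagram" where
  "group_frac f N M =
     (\<lambda>a. \<lparr>carrier = (\<lambda>x. x <#\<^bsub>fst f a\<^esub> N a) ` M a, point = N a\<rparr>,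
      \<lambda>a b C. (snd f a b ` C) <#>\<^bsub>fst f b\<^esub> N b)"

definition group_cdi_hom ::
  "('i::linorder, 'g monoid, 'g) diagram \<Rightarrow> ('i set set \<Rightarrow> 'i \<Rightarrow> 'g set) \<Rightarrow> bool" where
  "group_cdi_hom f \<Omega> \<longleftrightarrow> cdi_hom (group_sub f) (group_frac f) pointed_zero pointed_iso \<Omega>"

text \<open>The elements that die on leaving \<open>T\<close>, for \<open>T\<close> a down-set of indices.\<close>

definition group_kernel :: "('i::linorder, 'g monoid, 'g) diagram \<Rightarrow> 'i set \<Rightarrow> 'i \<Rightarrow> 'g set" where
  "group_kernel f T a =
     {x \<in> carrier (fst f a). \<forall>b. a \<le> b \<and> b \<notin> T \<longrightarrow> snd f a b x = \<one>\<^bsub>fst f b\<^esub>}"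

text \<open>For modules \<open>cdi_hom\<close> has at most one solution on a well-ordered index set. For groups it can
  have several: on three indices, for the inclusion and the projection \<open>A \<rightarrow> A * B \<rightarrow> A\<close> of a free
  product, \<open>down intervals {1}\<close> may be sent at \<open>1\<close> to \<open>B\<close> or to the kernel of the projection. The
  saecular homomorphism is the second one: intervals inside \<open>T\<close> account for all elements that die on
  leaving \<open>T\<close>. Hence, for groups, \<open>\<Omega>\<close> is the saecular CDI homomorphism if it is the only solution or,
  whether or not there are others, if it is compatible with kernels.\<close>

definition group_saecular_cdi ::
  "('i::linorder, 'g monoid, 'g) diagram \<Rightarrow> ('i set set \<Rightarrow> 'i \<Rightarrow> 'g set) \<Rightarrow> bool" where
  "group_saecular_cdi f \<Omega> \<longleftrightarrow> group_cdi_hom f \<Omega> \<and>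
     ((\<forall>\<Omega>'. group_cdi_hom f \<Omega>' \<longrightarrow> (\<forall>D\<in>carrier (downset_lattice intervals). \<Omega>' D = \<Omega> D)) \<or>
      (\<forall>T. downset index_poset T \<longrightarrow> \<Omega> {J \<in> carrier intervals. J \<subseteq> T} = group_kernel f T))"

end

theory Submission
  imports Defs "HOL-Algebra.Generated_Groups"
begin

text \<open>For down-sets \<open>E\<close> and \<open>E - {J}\<close> of intervals everything reduces to
  \<open>\<Omega> E = \<Omega> (down J) \<cdot> \<Omega> (E - {J})\<close>, since \<open>\<Omega> (down J \<inter> (E - {J})) = \<Omega> (sdown J)\<close>.
  For modules this is preservation of binary joins. For groups the join is only the generated
  subgroup. At an index \<open>a\<close>, \<open>\<Omega> (down K)\<close> is the intersection of a member of an increasing chain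
  \<open>A\<close> of subgroups, indexed by where \<open>K\<close> starts, with a member of an increasing chain \<open>B\<close> of kernels,
  indexed by where \<open>K\<close> ends. As kernels are normal, elements of a row (fixed end) normalize the group
  generated by the rows below it, so that elements of \<open>\<Omega> E\<close> can be sorted row by row, by well-founded
  induction on the end.

  The same sorting shows that the subgroups generated by intersections of images with kernels
  define a homomorphism that preserves meets. It is compatible with kernels, so this also
  covers the case in which \<open>\<Omega>\<close> is only known to be the unique solution.\<close>

subsection \<open>Down-sets and intervals of a well-order\<close>

text \<open>In each of the two pairs of down-sets the members differ by the interval
  \<open>J\<close> alone, so the two fractions are opposite sides of a diamond. The pair from
  \<open>lam\<close> contains the other one, so the meets and joins in \<open>canonical_iso\<close>
  collapse and the canonical isomorphism is the inverse of the map induced by inclusion. What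
  remains is bijectivity of that map on cosets: injectivity is preservation of meets, and the
  product formula is surjectivity. For groups the obstacle is that a join may contain alternating
  products of any length. Sorting them must terminate, and this is where the well-order enters: ends
  are down-sets of the index set, hence well-ordered by inclusion. An end without an immediate
  predecessor does no harm, since a product has finitely many factors and stays below some smaller
  end. Meets of arbitrary families use the well-order a second time, now for starts: among the
  intervals carrying the leading factors one has the least start, and it belongs to every member of
  the family.\<close>

lemma downset_index_iff: "downset index_poset T \<longleftrightarrow> (\<forall>x\<in>T. \<forall>y\<le>x. y \<in> T)"
  by (auto simp: downset_def index_poset_def)

lemma downset_UNIV: "downset index_poset UNIV"
  by (simp add: downset_index_iff)

lemma downset_lessThan: "downset index_poset {..<x}"
  by (auto simp: downset_index_iff)

lemma downset_linear:
  assumes S: "downset index_poset S" and T: "downset index_poset T"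
  shows "S \<subseteq> T \<or> T \<subseteq> S"
proof (rule ccontr)
  assume "\<not> (S \<subseteq> T \<or> T \<subseteq> S)"
  then obtain x y where "x \<in> S" "x \<notin> T" "y \<in> T" "y \<notin> S" by blast
  with S T show False using linear[of x y] unfolding downset_index_iff by blast
qed

lemma downset_cases:
  fixes T :: "'i::wellorder set"
  assumes "downset index_poset T"
  shows "T = UNIV \<or> (\<exists>e. T = {..<e})"
proof (cases "T = UNIV")
  case False
  then have ex: "\<exists>x. x \<notin> T" by blast
  define e where "e = (LEAST x. x \<notin> T)"
  have "e \<notin> T" unfolding e_def using ex by (rule LeastI_ex)
  moreover have "x \<in> T" if "x < e" for x using not_less_Least that unfolding e_def by blast
  ultimately have "x \<in> T \<longleftrightarrow> x < e" for x
    using assms not_le[of e x] unfolding downset_index_iff by blast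
  then have "T = {..<e}" by blast
  then show ?thesis by blast
qed simp

text \<open>Inclusion well-orders the down-sets of a well-order: the proper ones are the
  \<open>{..<e}\<close>, where this is induction on \<open>e\<close>, and \<open>UNIV\<close> comes
  on top of them.\<close>

lemma downset_induct [consumes 1, case_names less]:
  fixes T :: "'i::wellorder set"
  assumes T: "downset index_poset T"
    and step: "\<And>T. downset index_poset T \<Longrightarrow>
      (\<And>T'. downset index_poset T' \<Longrightarrow> T' \<subset> T \<Longrightarrow> P T') \<Longrightarrow> P T"
  shows "P T"
proof -
  have below: "P {..<e}" for e
  proof (induction e rule: less_induct)
    case (less e)
    show ?case
    proof (rule step[OF downset_lessThan])
      fix T' :: "'i set" assume T': "downset index_poset T'" "T' \<subset> {..<e}"
      then obtain e' where e': "T' = {..<e'}" using downset_cases by blast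
      with T'(2) have "e' < e" by (simp only: lessThan_strict_subset_iff)
      then show "P T'" using less.IH e' by simp
    qed
  qed
  have "P UNIV"
  proof (rule step[OF downset_UNIV])
    show "P T'" if "downset index_poset T'" "T' \<subset> UNIV" for T'
      using downset_cases[OF that(1)] that(2) below by auto
  qed
  with below show ?thesis using downset_cases[OF T] by auto
qed

text \<open>Serves to pick the least start in a family of intervals, with \<open>F\<close> the set
  of their starts. A member with no smaller member is the least one because down-sets are
  comparable.\<close>

lemma downset_family_least:
  fixes F :: "'i::wellorder set set"
  assumes "X \<in> F" and F: "\<And>X. X \<in> F \<Longrightarrow> downset index_poset X"
  obtains m where "m \<in> F" "\<And>X. X \<in> F \<Longrightarrow> m \<subseteq> X"
proof -
  have "X \<in> F \<longrightarrow> (\<exists>m\<in>F. \<forall>X\<in>F. m \<subseteq> X)"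
    using F[OF assms(1)]
  proof (induction rule: downset_induct)
    case (less T)
    show ?case
    proof
      assume T: "T \<in> F"
      show "\<exists>m\<in>F. \<forall>X\<in>F. m \<subseteq> X"
      proof (cases "\<exists>X\<in>F. X \<subset> T")
        case True
        then show ?thesis using less.IH F by blast
      next
        case False
        then have "T \<subseteq> X" if "X \<in> F" for X using downset_linear[OF F F] T that by blast
        then show ?thesis using T by blast
      qed
    qed
  qed
  then show ?thesis using assms(1) that by blast
qed

section \<open>Intervals as pairs of cuts\<close>

definition start :: "'i::linorder set \<Rightarrow> 'i set" where
  "start K = {x. \<forall>k\<in>K. x < k}"

definition finish :: "'i::linorder set \<Rightarrow> 'i set" where
  "finish K = {x. \<exists>k\<in>K. x \<le> k}"

lemma downset_start: "downset index_poset (start K)"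
  unfolding downset_index_iff start_def by (simp, meson le_less_trans)

lemma downset_finish: "downset index_poset (finish K)"
  unfolding downset_index_iff finish_def by (simp, meson order.trans)

lemma carrier_intervals:
  "carrier intervals = {J. J \<noteq> {} \<and> (\<forall>x\<in>J. \<forall>z\<in>J. \<forall>y. x \<le> y \<and> y \<le> z \<longrightarrow> y \<in> J)}"
  by (simp add: intervals_def)

text \<open>The pair \<open>(S, T)\<close> of an interval has a closed form: the strict lower bounds
  of \<open>K\<close> and the downward closure of \<open>K\<close>. From here on an interval is
  handled through this pair, and its order is a pair of inclusions.\<close>

lemma represents_iff:
  "represents K S T \<longleftrightarrow> K \<in> carrier intervals \<and> S = start K \<and> T = finish K"
proof
  assume r: "represents K S T"
  then have S: "\<And>x y. x \<in> S \<Longrightarrow> y \<le> x \<Longrightarrow> y \<in> S" and T: "\<And>x y. x \<in> T \<Longrightarrow> y \<le> x \<Longrightarrow> y \<in> T"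
    and K: "K = T - S" "S \<subset> T"
    unfolding represents_def downset_index_iff by auto
  obtain k where k: "k \<in> K" using K by blast
  have TS: "x \<in> K \<longleftrightarrow> x \<in> T \<and> x \<notin> S" for x using K by blast
  have S_start: "x \<in> S \<longleftrightarrow> x \<in> start K" for x
  proof
    assume x: "x \<in> S"
    have "x < k'" if "k' \<in> K" for k'
      using S[OF x, of k'] that TS[of k'] not_le[of k' x] by blast
    then show "x \<in> start K" unfolding start_def by blast
  next
    assume "x \<in> start K"
    then have "x < k" "x \<notin> K" using k unfolding start_def by auto
    then show "x \<in> S" using T[of k x] TS[of x] TS[of k] k by auto
  qed
  have T_finish: "x \<in> T \<longleftrightarrow> x \<in> finish K" for x
  proof
    assume x: "x \<in> T"
    show "x \<in> finish K"
    proof (cases "x \<le> k")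
      case False
      then have "k \<le> x" by simp
      then have "x \<in> K" using x S[of x k] TS[of x] TS[of k] k by blast
      then show ?thesis unfolding finish_def by blast
    next
      case True
      then show ?thesis using k unfolding finish_def by blast
    qed
  next
    assume "x \<in> finish K"
    then obtain k' where "k' \<in> K" "x \<le> k'" unfolding finish_def by blast
    then show "x \<in> T" using T[of k' x] TS[of k'] by blast
  qed
  have "y \<in> K" if "x \<in> K" "z \<in> K" "x \<le> y" "y \<le> z" for x y z
    using S[of y x] T[of z y] that TS[of x] TS[of y] TS[of z] by blast
  then have "K \<in> carrier intervals"
    using k unfolding carrier_intervals by blast
  moreover have "S = start K" "T = finish K" using S_start T_finish by blast+
  ultimately show "K \<in> carrier intervals \<and> S = start K \<and> T = finish K"
    by simp
next
  assume a: "K \<in> carrier intervals \<and> S = start K \<and> T = finish K"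
  then have "K \<noteq> {}" unfolding carrier_intervals by simp
  then obtain k where k: "k \<in> K" by blast
  have conv: "y \<in> K" if "x \<in> K" "z \<in> K" "x \<le> y" "y \<le> z" for x y z
    using a that unfolding carrier_intervals by blast
  have "k \<in> finish K" "k \<notin> start K" using k unfolding start_def finish_def by auto
  moreover have "start K \<subseteq> finish K"
    using k unfolding start_def finish_def by (auto intro: less_imp_le)
  moreover have "x \<in> K \<longleftrightarrow> x \<in> finish K \<and> x \<notin> start K" for x
  proof
    assume "x \<in> finish K \<and> x \<notin> start K"
    then obtain z y where "z \<in> K" "x \<le> z" "y \<in> K" "\<not> x < y"
      unfolding start_def finish_def by blast
    then show "x \<in> K" using conv[of y z x] by simp
  qed (auto simp: start_def finish_def)
  ultimately have "start K \<subset> finish K" "K = finish K - start K" by blast+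
  then show "represents K S T"
    using a downset_start[of K] downset_finish[of K] unfolding represents_def by blast
qed

lemma le_intervals_iff:
  assumes "K \<in> carrier intervals" "L \<in> carrier intervals"
  shows "K \<sqsubseteq>\<^bsub>intervals\<^esub> L \<longleftrightarrow> start K \<subseteq> start L \<and> finish K \<subseteq> finish L"
proof -
  have "K \<sqsubseteq>\<^bsub>intervals\<^esub> L \<longleftrightarrow>
     (\<exists>S T S' T'. represents K S T \<and> represents L S' T' \<and> S \<subseteq> S' \<and> T \<subseteq> T')"
    by (simp add: intervals_def)
  then show ?thesis using assms by (auto simp: represents_iff)
qed

lemma mem_interval_iff:
  assumes "K \<in> carrier intervals"
  shows "x \<in> K \<longleftrightarrow> x \<notin> start K \<and> x \<in> finish K"
  using assms represents_iff[of K "start K" "finish K"] by (auto simp: represents_def)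

lemma interval_eqI:
  assumes "K \<in> carrier intervals" "L \<in> carrier intervals" "start K = start L" "finish K = finish L"
  shows "K = L"
  using assms mem_interval_iff by blast

lemma eq_intervals [simp]: "(.=\<^bsub>intervals\<^esub>) = (=)"
  by (simp add: intervals_def)

lemma finish_subset_iff:
  "downset index_poset T \<Longrightarrow> finish K \<subseteq> T \<longleftrightarrow> K \<subseteq> T"
  unfolding downset_index_iff finish_def by blast

lemma downset_intervals_iff:
  "downset intervals D \<longleftrightarrow> D \<subseteq> carrier intervals \<and>
     (\<forall>K\<in>D. \<forall>L\<in>carrier intervals. start L \<subseteq> start K \<and> finish L \<subseteq> finish K \<longrightarrow> L \<in> D)"
  unfolding downset_def using le_intervals_iff by blast

lemma downset_intervalsD:
  "\<lbrakk>downset intervals D; K \<in> D; L \<in> carrier intervals; start L \<subseteq> start K; finish L \<subseteq> finish K\<rbrakk>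
    \<Longrightarrow> L \<in> D"
  unfolding downset_intervals_iff by blast

lemma downset_rect:
  "downset intervals {K \<in> carrier intervals. start K \<subseteq> S \<and> finish K \<subseteq> T}"
  unfolding downset_intervals_iff by blast

lemma down_intervals_eq:
  "J \<in> carrier intervals \<Longrightarrow>
    down intervals J = {K \<in> carrier intervals. start K \<subseteq> start J \<and> finish K \<subseteq> finish J}"
  unfolding down_def using le_intervals_iff by blast

lemma sdown_intervals_eq:
  "J \<in> carrier intervals \<Longrightarrow> sdown intervals J = down intervals J - {J}"
  by (auto simp: sdown_def down_def lless_def)

lemma downset_down: "J \<in> carrier intervals \<Longrightarrow> downset intervals (down intervals J)"
  by (simp add: down_intervals_eq downset_rect)

lemma downset_sdown:
  assumes J: "J \<in> carrier intervals"
  shows "downset intervals (sdown intervals J)"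
proof -
  have "L \<noteq> J" if "K \<in> sdown intervals J" "L \<in> carrier intervals"
    "start L \<subseteq> start K" "finish L \<subseteq> finish K" for K L
    using that J interval_eqI[of K J] by (auto simp: sdown_intervals_eq down_intervals_eq)
  then show ?thesis
    using downset_down[OF J] unfolding downset_intervals_iff sdown_intervals_eq[OF J] by blast
qed

subsection \<open>Groups filtered by intervals\<close>

lemma (in group) mult_inv_cancel_left:
  assumes "x \<in> carrier G" "y \<in> carrier G"
  shows "inv x \<otimes> (x \<otimes> y) = y" "x \<otimes> (inv x \<otimes> y) = y"
  using assms by (simp_all flip: m_assoc)

text \<open>Only the case \<open>T \<subseteq> S\<close> of \<open>fill\<close> has content: otherwise \<open>T - S\<close> is an interval that starts at
  \<open>S\<close> and ends at \<open>T\<close>.\<close>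

locale interval_filtration = group G for G (structure) +
  fixes A B :: "'i::wellorder set \<Rightarrow> 'a set"
  assumes A_subgroup: "downset index_poset S \<Longrightarrow> subgroup (A S) G"
    and B_normal: "downset index_poset T \<Longrightarrow> B T \<lhd> G"
    and A_mono: "\<lbrakk>downset index_poset S; downset index_poset S'; S \<subseteq> S'\<rbrakk> \<Longrightarrow> A S \<subseteq> A S'"
    and B_mono: "\<lbrakk>downset index_poset T; downset index_poset T'; T \<subseteq> T'\<rbrakk> \<Longrightarrow> B T \<subseteq> B T'"
    and fill: "\<lbrakk>downset index_poset S; downset index_poset T\<rbrakk> \<Longrightarrow> A S \<inter> B T \<subseteq>
      generate G (\<Union>K\<in>{K \<in> carrier intervals. start K \<subseteq> S \<and> finish K \<subseteq> T}.
        A (start K) \<inter> B (finish K))"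
begin

text \<open>In both uses of the locale, \<open>cell K\<close> is the value of a homomorphism at
  \<open>down intervals K\<close> for an interval \<open>K\<close>, and \<open>span D\<close> is its
  value at a down-set \<open>D\<close>.\<close>

definition cell :: "'i set \<Rightarrow> 'a set" where
  "cell K = A (start K) \<inter> B (finish K)"

definition span :: "'i set set \<Rightarrow> 'a set" where
  "span D = generate G (\<Union>K\<in>D. cell K)"

lemma B_subgroup: "downset index_poset T \<Longrightarrow> subgroup (B T) G"
  using B_normal normal_imp_subgroup by blast

lemma cell_subgroup: "subgroup (cell K) G"
  unfolding cell_def by (intro subgroups_Inter_pair A_subgroup B_subgroup downset_start downset_finish)

lemma cells_carrier: "(\<Union>K\<in>D. cell K) \<subseteq> carrier G"
  using cell_subgroup subgroup.subset by blast

lemma span_subgroup: "subgroup (span D) G"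
  unfolding span_def by (rule generate_is_subgroup[OF cells_carrier])

lemmas span_carrier = subgroup.subset[OF span_subgroup]
lemmas span_closed = subgroup.m_closed[OF span_subgroup] subgroup.m_inv_closed[OF span_subgroup]
  subgroup.one_closed[OF span_subgroup]

lemma span_mono: "D \<subseteq> D' \<Longrightarrow> span D \<subseteq> span D'"
  unfolding span_def by (rule mono_generate) auto

lemma cell_span: "K \<in> D \<Longrightarrow> cell K \<subseteq> span D"
  unfolding span_def by (auto intro: generate.incl)

lemma span_least: "(\<And>K. K \<in> D \<Longrightarrow> cell K \<subseteq> H) \<Longrightarrow> subgroup H G \<Longrightarrow> span D \<subseteq> H"
  unfolding span_def by (intro generate_subgroup_incl UN_least)

lemma fill_span:
  assumes "downset index_poset S" "downset index_poset T"
    and "\<And>K. K \<in> carrier intervals \<Longrightarrow> start K \<subseteq> S \<Longrightarrow> finish K \<subseteq> T \<Longrightarrow> K \<in> D"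
  shows "A S \<inter> B T \<subseteq> span D"
proof -
  have "A S \<inter> B T \<subseteq> span {K \<in> carrier intervals. start K \<subseteq> S \<and> finish K \<subseteq> T}"
    using fill[OF assms(1,2)] unfolding span_def cell_def .
  also have "\<dots> \<subseteq> span D" using assms(3) by (intro span_mono) auto
  finally show ?thesis .
qed

lemma span_rect:
  assumes "downset index_poset S" "downset index_poset T"
  shows "span {K \<in> carrier intervals. start K \<subseteq> S \<and> finish K \<subseteq> T} = A S \<inter> B T"
proof (rule antisym)
  show "A S \<inter> B T \<subseteq> span {K \<in> carrier intervals. start K \<subseteq> S \<and> finish K \<subseteq> T}"
    by (rule fill_span[OF assms]) simp
  show "span {K \<in> carrier intervals. start K \<subseteq> S \<and> finish K \<subseteq> T} \<subseteq> A S \<inter> B T"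
  proof (rule span_least)
    show "subgroup (A S \<inter> B T) G"
      by (intro subgroups_Inter_pair A_subgroup B_subgroup assms)
    fix K assume "K \<in> {K \<in> carrier intervals. start K \<subseteq> S \<and> finish K \<subseteq> T}"
    then have "A (start K) \<subseteq> A S" "B (finish K) \<subseteq> B T"
      using A_mono[OF downset_start assms(1)] B_mono[OF downset_finish assms(2)] by simp_all
    then show "cell K \<subseteq> A S \<inter> B T" unfolding cell_def by blast
  qed
qed

lemma span_finish_B:
  assumes "downset index_poset T"
  shows "span {K \<in> D. finish K \<subseteq> T} \<subseteq> B T"
proof (rule span_least[OF _ B_subgroup[OF assms]])
  fix K assume "K \<in> {K \<in> D. finish K \<subseteq> T}"
  then have "B (finish K) \<subseteq> B T" using B_mono[OF downset_finish assms] by simp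
  then show "cell K \<subseteq> B T" unfolding cell_def by blast
qed

section \<open>Sorting products by rows\<close>

lemma generate_conj_closed:
  assumes "X \<subseteq> carrier G" "z \<in> carrier G" "\<And>w. w \<in> X \<Longrightarrow> z \<otimes> w \<otimes> inv z \<in> generate G X"
    and "x \<in> generate G X"
  shows "z \<otimes> x \<otimes> inv z \<in> generate G X"
  using assms(4)
proof induction
  case one
  then show ?case using assms(2) generate.one by auto
next
  case (incl h)
  then show ?case using assms(3) by blast
next
  case (inv h)
  have "z \<otimes> inv h \<otimes> inv z = inv (z \<otimes> h \<otimes> inv z)"
    using assms(1,2) inv by (simp add: inv_mult_group m_assoc subset_iff)
  then show ?case using generate_m_inv_closed[OF assms(1) assms(3)[OF inv]] by simp
next
  case (eng h1 h2)
  have "h1 \<in> carrier G" "h2 \<in> carrier G" using eng generate_in_carrier[OF assms(1)] by auto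
  then have "z \<otimes> (h1 \<otimes> h2) \<otimes> inv z = (z \<otimes> h1 \<otimes> inv z) \<otimes> (z \<otimes> h2 \<otimes> inv z)"
    using assms(2) by (simp add: m_assoc mult_inv_cancel_left)
  then show ?case using eng generate.eng by metis
qed

text \<open>For a generator \<open>w\<close> of a lower cell \<open>L\<close>, the conjugate stays
  in \<open>B (finish L)\<close> by normality and in \<open>A S\<close> for the larger start
  \<open>S\<close>, because the \<open>A\<close> form a chain. By \<open>fill\<close> it is a
  product of cells with start within \<open>S\<close> and end within \<open>finish L\<close>. Their
  intervals lie below \<open>K\<close> if \<open>S = start K\<close> and below \<open>L\<close> if
  \<open>S = start L\<close>, hence in \<open>D\<close>.\<close>

lemma conj_lower:
  assumes D: "downset intervals D" and K: "K \<in> D" "finish K = T" and z: "z \<in> cell K"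
    and x: "x \<in> span {L \<in> D. finish L \<subset> T}"
  shows "z \<otimes> x \<otimes> inv z \<in> span {L \<in> D. finish L \<subset> T}"
  unfolding span_def
proof (rule generate_conj_closed[OF cells_carrier])
  show zc: "z \<in> carrier G" using z cell_subgroup subgroup.subset by blast
  show "x \<in> generate G (\<Union> (cell ` {L \<in> D. finish L \<subset> T}))" using x unfolding span_def .
  fix w assume "w \<in> \<Union> (cell ` {L \<in> D. finish L \<subset> T})"
  then obtain L where L: "L \<in> D" "finish L \<subset> T" and w: "w \<in> A (start L)" "w \<in> B (finish L)"
    unfolding cell_def by blast
  define S where "S = start K \<union> start L"
  have S: "S = start K \<or> S = start L"
    using downset_linear[OF downset_start downset_start] unfolding S_def by blast
  then have dS: "downset index_poset S" using downset_start by auto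
  have zw: "z \<in> A S" "w \<in> A S"
    using z w A_mono[OF downset_start dS] unfolding cell_def S_def by auto
  have "z \<otimes> w \<otimes> inv z \<in> A S"
    using zw A_subgroup[OF dS] by (simp add: subgroup.m_closed subgroup.m_inv_closed)
  moreover have "z \<otimes> w \<otimes> inv z \<in> B (finish L)"
    using normal.inv_op_closed2[OF B_normal[OF downset_finish] zc w(2)] .
  moreover have "A S \<inter> B (finish L) \<subseteq> span {L' \<in> D. finish L' \<subset> T}"
  proof (rule fill_span[OF dS downset_finish])
    fix L' assume "L' \<in> carrier intervals" "start L' \<subseteq> S" "finish L' \<subseteq> finish L"
    then show "L' \<in> {L' \<in> D. finish L' \<subset> T}"
      using S L K D unfolding downset_intervals_iff by blast
  qed
  ultimately show "z \<otimes> w \<otimes> inv z \<in> generate G (\<Union> (cell ` {L \<in> D. finish L \<subset> T}))"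
    unfolding span_def by blast
qed

text \<open>\<open>D\<close> may contain no interval that ends at \<open>T\<close>, hence the
  inserted unit. Otherwise the cells of one row form a chain ordered by their starts, which makes
  their union closed under products without generating anything.\<close>

definition row :: "'i set set \<Rightarrow> 'i set \<Rightarrow> 'a set" where
  "row D T = insert \<one> (\<Union>K\<in>{K\<in>D. finish K = T}. cell K)"

lemma row_carrier: "row D T \<subseteq> carrier G"
  unfolding row_def using cells_carrier by auto

lemma row_inv: "z \<in> row D T \<Longrightarrow> inv z \<in> row D T"
  unfolding row_def using subgroup.m_inv_closed[OF cell_subgroup] by auto

lemma row_mult:
  assumes "y \<in> row D T" "z \<in> row D T"
  shows "y \<otimes> z \<in> row D T"
proof (cases "y = \<one> \<or> z = \<one>")
  case True
  moreover have "y \<in> carrier G" "z \<in> carrier G" using assms row_carrier by blast+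
  ultimately show ?thesis using assms by auto
next
  case False
  then obtain K L where K: "K \<in> D" "finish K = T" "y \<in> cell K" and L: "L \<in> D" "finish L = T" "z \<in> cell L"
    using assms unfolding row_def by auto
  have "cell K \<subseteq> cell L \<or> cell L \<subseteq> cell K"
    unfolding cell_def K L
    using downset_linear[OF downset_start downset_start, of K L]
      A_mono[OF downset_start downset_start] by blast
  then show ?thesis
    using K L subgroup.m_closed[OF cell_subgroup] unfolding row_def by blast
qed

lemma conj_row:
  assumes "downset intervals D" "z \<in> row D T" "x \<in> span {L \<in> D. finish L \<subset> T}"
  shows "z \<otimes> x \<otimes> inv z \<in> span {L \<in> D. finish L \<subset> T}"
proof (cases "z = \<one>")
  case True
  moreover have "x \<in> carrier G" using assms(3) span_carrier by blast
  ultimately show ?thesis using assms(3) by simp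
next
  case False
  then show ?thesis using assms conj_lower unfolding row_def by blast
qed

text \<open>A row is closed under products and inverses and normalizes the span of the rows below
  it. Hence the products \<open>z \<otimes> k\<close> contain all generators and are closed under
  multiplication.\<close>

lemma span_split:
  assumes D: "downset intervals D" and x: "x \<in> span {K \<in> D. finish K \<subseteq> T}"
  obtains z k where "z \<in> row D T" "k \<in> span {K \<in> D. finish K \<subset> T}" "x = z \<otimes> k"
proof -
  let ?N = "span {K \<in> D. finish K \<subset> T}"
  have from_row: "\<exists>z\<in>row D T. \<exists>k\<in>?N. h = z \<otimes> k" if "h \<in> row D T" for h
  proof (intro bexI)
    have "h \<in> carrier G" using that row_carrier by blast
    then show "h = h \<otimes> \<one>" by simp
  qed (simp_all add: that span_closed)
  have from_lower: "\<exists>z\<in>row D T. \<exists>k\<in>?N. h = z \<otimes> k" if "h \<in> ?N" for h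
  proof (intro bexI)
    have "h \<in> carrier G" using that span_carrier by blast
    then show "h = \<one> \<otimes> h" by simp
  qed (simp_all add: that row_def)
  have from_cell: "\<exists>z\<in>row D T. \<exists>k\<in>?N. h = z \<otimes> k"
    if "K \<in> D" "finish K \<subseteq> T" "h \<in> cell K" for K h
  proof (cases "finish K = T")
    case True
    then have "h \<in> row D T" using that unfolding row_def by blast
    then show ?thesis by (rule from_row)
  next
    case False
    then have "K \<in> {K \<in> D. finish K \<subset> T}" using that by blast
    then have "h \<in> ?N" using that(3) by (rule subsetD[OF cell_span])
    then show ?thesis by (rule from_lower)
  qed
  have "\<exists>z\<in>row D T. \<exists>k\<in>?N. x = z \<otimes> k"
    using x unfolding span_def[of "{K \<in> D. finish K \<subseteq> T}"]
  proof induction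
    case one
    show ?case by (rule from_row) (simp add: row_def)
  next
    case (incl h)
    then obtain K where "K \<in> D" "finish K \<subseteq> T" "h \<in> cell K" by blast
    then show ?case by (rule from_cell)
  next
    case (inv h)
    then obtain K where K: "K \<in> D" "finish K \<subseteq> T" "h \<in> cell K" by blast
    show ?case by (rule from_cell[OF K(1,2) subgroup.m_inv_closed[OF cell_subgroup K(3)]])
  next
    case (eng h1 h2)
    from eng.IH obtain z1 k1 z2 k2 where z: "z1 \<in> row D T" "z2 \<in> row D T"
      and k: "k1 \<in> ?N" "k2 \<in> ?N" and h: "h1 = z1 \<otimes> k1" "h2 = z2 \<otimes> k2" by (elim bexE)
    then have c: "z1 \<in> carrier G" "k1 \<in> carrier G" "z2 \<in> carrier G" "k2 \<in> carrier G"
      using row_carrier span_carrier by blast+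
    show ?case
    proof (intro bexI)
      \<comment> \<open>Moving \<open>z2\<close> to the left past \<open>k1\<close> conjugates
        \<open>k1\<close> by \<open>inv z2\<close>; the double inverse gives the shape that
        \<open>conj_row\<close> expects.\<close>
      show "h1 \<otimes> h2 = (z1 \<otimes> z2) \<otimes> ((inv z2 \<otimes> k1 \<otimes> inv (inv z2)) \<otimes> k2)"
        using c by (simp add: h m_assoc mult_inv_cancel_left)
      show "(inv z2 \<otimes> k1 \<otimes> inv (inv z2)) \<otimes> k2 \<in> ?N"
        by (rule span_closed(1)[OF conj_row[OF D row_inv[OF z(2)] k(1)] k(2)])
      show "z1 \<otimes> z2 \<in> row D T"
        by (rule row_mult[OF z])
    qed
  qed
  then show ?thesis by (elim bexE) (rule that)
qed

text \<open>A product has finitely many factors, so the largest of their ends is still strictly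
  below \<open>T\<close>. This carries the inductions through those \<open>T\<close> that have no
  largest smaller end. The alternative \<open>x = \<one>\<close> covers the empty \<open>T\<close>,
  which has no smaller end at all.\<close>

lemma span_strict_directed:
  assumes "x \<in> span {K \<in> D. finish K \<subset> T}"
  shows "x = \<one> \<or> (\<exists>T'. downset index_poset T' \<and> T' \<subset> T \<and> x \<in> span {K \<in> D. finish K \<subseteq> T'})"
  using assms unfolding span_def[of "{K \<in> D. finish K \<subset> T}"]
proof induction
  case (incl h)
  then obtain K where K: "K \<in> D" "finish K \<subset> T" "h \<in> cell K" by blast
  then have "h \<in> span {L \<in> D. finish L \<subseteq> finish K}"
    by (intro subsetD[OF cell_span]) simp_all
  then show ?case using K(2) downset_finish[of K] by blast
next
  case (inv h)
  then obtain K where K: "K \<in> D" "finish K \<subset> T" "h \<in> cell K" by blast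
  then have "h \<in> span {L \<in> D. finish L \<subseteq> finish K}"
    by (intro subsetD[OF cell_span]) simp_all
  then have "inv h \<in> span {L \<in> D. finish L \<subseteq> finish K}" by (rule span_closed(2))
  then show ?case using K(2) downset_finish[of K] by blast
next
  case (eng h1 h2)
  have c: "h1 \<in> carrier G" "h2 \<in> carrier G" using eng.hyps generate_in_carrier[OF cells_carrier] by blast+
  show ?case
  proof (cases "h1 = \<one> \<or> h2 = \<one>")
    case True
    then show ?thesis using eng.IH c by auto
  next
    case False
    then obtain T1 T2 where T1: "downset index_poset T1" "T1 \<subset> T" "h1 \<in> span {K \<in> D. finish K \<subseteq> T1}"
      and T2: "downset index_poset T2" "T2 \<subset> T" "h2 \<in> span {K \<in> D. finish K \<subseteq> T2}"
      using eng.IH by blast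
    define U where "U = T1 \<union> T2"
    have U: "U = T1 \<or> U = T2" using downset_linear[OF T1(1) T2(1)] unfolding U_def by blast
    have "span {K \<in> D. finish K \<subseteq> T1} \<subseteq> span {K \<in> D. finish K \<subseteq> U}"
      "span {K \<in> D. finish K \<subseteq> T2} \<subseteq> span {K \<in> D. finish K \<subseteq> U}"
      unfolding U_def by (intro span_mono Collect_mono, blast)+
    then have "h1 \<otimes> h2 \<in> span {K \<in> D. finish K \<subseteq> U}"
      using T1(3) T2(3) by (intro span_closed(1)) blast+
    then show ?thesis using U T1(1,2) T2(1,2) by metis
  qed
qed simp

text \<open>Sort from the highest row downwards. As long as the leading factor \<open>z\<close>
  avoids \<open>cell J\<close>, it joins the part \<open>u\<close> on the left and the rest has a
  smaller end. Once \<open>z\<close> is in \<open>cell J\<close>, the rest lies in rows strictly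
  below the end of \<open>J\<close>, so it avoids \<open>J\<close> and can be conjugated past
  \<open>z\<close>.\<close>

lemma span_product:
  assumes E: "downset intervals E" and J: "J \<in> E" and E0: "downset intervals (E - {J})"
  shows "span E \<subseteq> cell J <#> span (E - {J})"
proof
  have main: "x \<in> span {K \<in> E. finish K \<subseteq> T} \<longrightarrow> (\<exists>u\<in>span (E - {J}). \<exists>d\<in>cell J. x = u \<otimes> d)"
    if "downset index_poset T" for T x
    using that
  proof (induction arbitrary: x rule: downset_induct)
    case (less T)
    show ?case
    proof
      assume "x \<in> span {K \<in> E. finish K \<subseteq> T}"
      then obtain z k where z: "z \<in> row E T" and k: "k \<in> span {K \<in> E. finish K \<subset> T}" and x: "x = z \<otimes> k"
        by (rule span_split[OF E])
      have c: "z \<in> carrier G" "k \<in> carrier G" using row_carrier span_carrier z k by blast+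
      consider "z = \<one>" | K where "K \<in> E" "finish K = T" "z \<in> cell K"
        using z unfolding row_def by blast
      then have "z \<in> span (E - {J}) \<or> (finish J = T \<and> z \<in> cell J)"
      proof cases
        case 1
        then show ?thesis using span_closed(3) by simp
      next
        case (2 K)
        then show ?thesis using subsetD[OF cell_span[of K "E - {J}"], of z] by (cases "K = J") auto
      qed
      then show "\<exists>u\<in>span (E - {J}). \<exists>d\<in>cell J. x = u \<otimes> d"
      proof (elim disjE conjE)
        assume zE: "z \<in> span (E - {J})"
        have "\<exists>u\<in>span (E - {J}). \<exists>d\<in>cell J. k = u \<otimes> d"
          using span_strict_directed[OF k]
        proof (elim disjE exE conjE)
          assume "k = \<one>"
          then show ?thesis
            by (intro bexI[of _ \<one>]) (simp_all add: span_closed subgroup.one_closed[OF cell_subgroup])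
        next
          fix T' assume "downset index_poset T'" "T' \<subset> T" "k \<in> span {K \<in> E. finish K \<subseteq> T'}"
          then show ?thesis by (intro less.IH[rule_format])
        qed
        then obtain u d where ud: "u \<in> span (E - {J})" "d \<in> cell J" "k = u \<otimes> d" by (elim bexE)
        then have "u \<in> carrier G" "d \<in> carrier G"
          using span_carrier subgroup.subset[OF cell_subgroup] by blast+
        then have "x = (z \<otimes> u) \<otimes> d" using c x ud(3) by (simp add: m_assoc)
        then show ?thesis using span_closed(1)[OF zE ud(1)] ud(2) by (intro bexI)
      next
        \<comment> \<open>\<open>J\<close> itself ends at \<open>T\<close>, so the rows of
          \<open>E\<close> strictly below \<open>T\<close> do not contain it.\<close>
        assume zJ: "finish J = T" "z \<in> cell J"
        have "z \<otimes> k \<otimes> inv z \<in> span {K \<in> E. finish K \<subset> T}"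
          by (rule conj_row[OF E z k])
        also have "\<dots> \<subseteq> span (E - {J})" using zJ by (intro span_mono) blast
        finally have "z \<otimes> k \<otimes> inv z \<in> span (E - {J})" .
        moreover have "x = (z \<otimes> k \<otimes> inv z) \<otimes> z" using c x by (simp add: m_assoc)
        ultimately show ?thesis using zJ(2) by (intro bexI)
      qed
    qed
  qed
  fix x assume x: "x \<in> span E"
  \<comment> \<open>\<open>main\<close> leaves the factor from \<open>cell J\<close> on the right,
    where it does not disturb the factors collected on the left. Applying it to the inverse reverses
    the order.\<close>
  then have "inv x \<in> span {K \<in> E. finish K \<subseteq> UNIV}" using span_closed(2) by simp
  from main[OF downset_UNIV, THEN mp, OF this]
  obtain u d where ud: "u \<in> span (E - {J})" "d \<in> cell J" "inv x = u \<otimes> d"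
    by (elim bexE)
  then have c: "u \<in> carrier G" "d \<in> carrier G" "x \<in> carrier G"
    using span_carrier subgroup.subset[OF cell_subgroup] x by blast+
  have "x = inv (inv x)" using c by simp
  also have "\<dots> = inv d \<otimes> inv u" using c by (simp add: ud(3) inv_mult_group)
  finally have "x = inv d \<otimes> inv u" .
  then show "x \<in> cell J <#> span (E - {J})"
    using span_closed(2)[OF ud(1)] subgroup.m_inv_closed[OF cell_subgroup ud(2)]
    unfolding set_mult_def by blast
qed

text \<open>Lower the bound \<open>T'\<close> on the ends until it is within \<open>T\<close>. If
  \<open>x = z \<otimes> k\<close> with \<open>z\<close> in the top row, then \<open>x\<close> and
  \<open>k\<close> both lie in \<open>B U\<close> for some smaller end \<open>U\<close> containing
  \<open>T\<close>, hence so does \<open>z\<close>. Now \<open>fill\<close> rewrites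
  \<open>z\<close> by cells that start no later than before but end within \<open>U\<close>, and
  these are still in \<open>D\<close>.\<close>

lemma span_Int_B:
  assumes D: "downset intervals D" and T: "downset index_poset T" and x: "x \<in> span D" "x \<in> B T"
  shows "x \<in> span {K \<in> D. finish K \<subseteq> T}"
proof -
  have "x \<in> span {K \<in> D. finish K \<subseteq> T'} \<longrightarrow> x \<in> span {K \<in> D. finish K \<subseteq> T}"
    if "downset index_poset T'" for T'
    using that
  proof (induction rule: downset_induct)
    case (less T')
    show ?case
    proof
      assume x': "x \<in> span {K \<in> D. finish K \<subseteq> T'}"
      show "x \<in> span {K \<in> D. finish K \<subseteq> T}"
      proof (cases "T' \<subseteq> T")
        case True
        then have "span {K \<in> D. finish K \<subseteq> T'} \<subseteq> span {K \<in> D. finish K \<subseteq> T}"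
          by (intro span_mono Collect_mono) blast
        then show ?thesis using x' by (rule subsetD)
      next
        case False
        then have TT: "T \<subset> T'" using downset_linear[OF T less.hyps] by blast
        obtain z k where z: "z \<in> row D T'" and k: "k \<in> span {K \<in> D. finish K \<subset> T'}" and xzk: "x = z \<otimes> k"
          using span_split[OF D x'] .
        have c: "z \<in> carrier G" "k \<in> carrier G" using row_carrier span_carrier z k by blast+
        have "\<exists>U. downset index_poset U \<and> U \<subset> T' \<and> k \<in> span {K \<in> D. finish K \<subseteq> U}"
          using span_strict_directed[OF k]
        proof
          assume "k = \<one>"
          then show ?thesis using T TT span_closed(3)[of "{K \<in> D. finish K \<subseteq> T}"] by blast
        qed
        then obtain U0 where U0: "downset index_poset U0" "U0 \<subset> T'" "k \<in> span {K \<in> D. finish K \<subseteq> U0}"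
          by (elim exE conjE)
        \<comment> \<open>The larger of the two ends: containing \<open>T\<close> puts
          \<open>x\<close> into \<open>B U\<close>, containing \<open>U0\<close> puts
          \<open>k\<close> there.\<close>
        define U where "U = T \<union> U0"
        have "U = T \<or> U = U0" using downset_linear[OF T U0(1)] unfolding U_def by blast
        then have U: "downset index_poset U" "T \<subseteq> U" "U \<subset> T'"
          using T U0 TT unfolding U_def by auto
        have "span {K \<in> D. finish K \<subseteq> U0} \<subseteq> span {K \<in> D. finish K \<subseteq> U}"
          unfolding U_def by (intro span_mono Collect_mono) blast
        then have kU: "k \<in> span {K \<in> D. finish K \<subseteq> U}" using U0(3) by (rule subsetD)
        have "k \<in> B U" by (rule subsetD[OF span_finish_B[OF U(1)] kU])
        moreover have "x \<in> B U" by (rule subsetD[OF B_mono[OF T U(1,2)] x(2)])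
        moreover have "z = x \<otimes> inv k" using c xzk by (simp add: m_assoc)
        ultimately have zB: "z \<in> B U"
          using B_subgroup[OF U(1)] by (simp add: subgroup.m_closed subgroup.m_inv_closed)
        have zU: "z \<in> span {K \<in> D. finish K \<subseteq> U}"
        proof (cases "z = \<one>")
          case True
          then show ?thesis using span_closed(3) by simp
        next
          case False
          then obtain K where K: "K \<in> D" "finish K = T'" "z \<in> cell K"
            using z unfolding row_def by blast
          then have zA: "z \<in> A (start K)" unfolding cell_def by simp
          have "A (start K) \<inter> B U \<subseteq> span {K \<in> D. finish K \<subseteq> U}"
          proof (rule fill_span[OF downset_start U(1)])
            fix L assume "L \<in> carrier intervals" "start L \<subseteq> start K" "finish L \<subseteq> U"
            then show "L \<in> {K \<in> D. finish K \<subseteq> U}"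
              using downset_intervalsD[OF D K(1), of L] K(2) U(3) by auto
          qed
          then show ?thesis by (rule subsetD) (use zA zB in simp)
        qed
        have "x \<in> span {K \<in> D. finish K \<subseteq> U}" unfolding xzk by (rule span_closed(1)[OF zU kU])
        then show ?thesis by (rule less.IH[OF U(1,3), THEN mp])
      qed
    qed
  qed
  from this[OF downset_UNIV] show ?thesis using x(1) by simp
qed

text \<open>Induction on an end \<open>T\<close> with \<open>x \<in> B T\<close>. By
  \<open>span_Int_B\<close> each \<open>D\<close> gives a splitting \<open>x = z \<otimes> k\<close>
  with \<open>z\<close> in its row at \<open>T\<close>, and these splittings need not agree. The
  interval of least start among those carrying the factors \<open>z\<close> has the common end
  \<open>T\<close>, so it lies in every \<open>D\<close>. Its factor can be stripped off inside the
  intersection, and what remains has a smaller end.\<close>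

lemma span_Inter:
  assumes ne: "\<D> \<noteq> {}" and D: "\<And>D. D \<in> \<D> \<Longrightarrow> downset intervals D"
  shows "span (\<Inter>\<D>) = (\<Inter>D\<in>\<D>. span D)"
proof (rule antisym)
  show "span (\<Inter>\<D>) \<subseteq> (\<Inter>D\<in>\<D>. span D)" by (intro INT_greatest span_mono) blast
  have main: "x \<in> B T \<longrightarrow> (\<forall>D\<in>\<D>. x \<in> span D) \<longrightarrow> x \<in> span (\<Inter>\<D>)"
    if "downset index_poset T" for T x
    using that
  proof (induction arbitrary: x rule: downset_induct)
    case (less T)
    \<comment> \<open>One \<open>D\<close> in which \<open>k\<close> sits strictly below
      \<open>T\<close> is enough: it bounds the end, thus places \<open>k\<close> in a smaller
      \<open>B T'\<close>, and the induction hypothesis needs nothing else about the other members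
      than membership in their spans.\<close>
    have lower: "k \<in> span (\<Inter>\<D>)"
      if k: "k \<in> span {K \<in> D. finish K \<subset> T}" and all: "\<forall>D\<in>\<D>. k \<in> span D" for k D
      using span_strict_directed[OF k]
    proof (elim disjE exE conjE)
      fix T' assume T': "downset index_poset T'" "T' \<subset> T" "k \<in> span {K \<in> D. finish K \<subseteq> T'}"
      show ?thesis
        by (rule less.IH[OF T'(1,2), rule_format])
          (use subsetD[OF span_finish_B[OF T'(1)] T'(3)] all in simp_all)
    qed (simp add: span_closed)
    show ?case
    proof (intro impI)
      assume x: "x \<in> B T" "\<forall>D\<in>\<D>. x \<in> span D"
      have "\<forall>D\<in>\<D>. \<exists>p. fst p \<in> row D T \<and> snd p \<in> span {K \<in> D. finish K \<subset> T} \<and>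
        x = fst p \<otimes> snd p"
      proof
        fix D assume DD: "D \<in> \<D>"
        have "x \<in> span {K \<in> D. finish K \<subseteq> T}"
          by (rule span_Int_B[OF D[OF DD] less.hyps]) (use x DD in simp_all)
        then obtain z k where "z \<in> row D T" "k \<in> span {K \<in> D. finish K \<subset> T}" "x = z \<otimes> k"
          by (rule span_split[OF D[OF DD]])
        then show "\<exists>p. fst p \<in> row D T \<and> snd p \<in> span {K \<in> D. finish K \<subset> T} \<and> x = fst p \<otimes> snd p"
          by (intro exI[of _ "(z, k)"]) simp
      qed
      from bchoice[OF this] obtain p where p: "\<forall>D\<in>\<D>. fst (p D) \<in> row D T \<and>
        snd (p D) \<in> span {K \<in> D. finish K \<subset> T} \<and> x = fst (p D) \<otimes> snd (p D)"
        by (elim exE)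
      define z k where "z = fst \<circ> p" and "k = snd \<circ> p"
      have zk: "z D \<in> row D T" "k D \<in> span {K \<in> D. finish K \<subset> T}" "x = z D \<otimes> k D"
        if "D \<in> \<D>" for D
        using p that by (simp_all add: z_def k_def)
      show "x \<in> span (\<Inter>\<D>)"
      proof (cases "\<exists>D\<in>\<D>. z D = \<one>")
        case True
        then obtain D where D': "D \<in> \<D>" "z D = \<one>" by blast
        have "k D \<in> carrier G" by (rule subsetD[OF span_carrier zk(2)[OF D'(1)]])
        then have "x = k D" using zk(3)[OF D'(1)] D'(2) by simp
        then show ?thesis using lower[OF zk(2)[OF D'(1)]] x(2) by simp
      next
        case False
        have "\<forall>D\<in>\<D>. \<exists>K. K \<in> D \<and> finish K = T \<and> z D \<in> cell K"
        proof
          fix D assume "D \<in> \<D>"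
          then have "z D \<in> row D T" "z D \<noteq> \<one>" using zk(1) False by simp_all
          then show "\<exists>K. K \<in> D \<and> finish K = T \<and> z D \<in> cell K" unfolding row_def by auto
        qed
        from bchoice[OF this] obtain K where
          "\<forall>D\<in>\<D>. K D \<in> D \<and> finish (K D) = T \<and> z D \<in> cell (K D)" by (elim exE)
        then have K: "K D \<in> D" "finish (K D) = T" "z D \<in> cell (K D)" if "D \<in> \<D>" for D
          using that by simp_all
        obtain D0 where "D0 \<in> \<D>" using ne by blast
        then have "start (K D0) \<in> (\<lambda>D. start (K D)) ` \<D>" by blast
        then obtain m where m: "m \<in> (\<lambda>D. start (K D)) ` \<D>" "\<And>X. X \<in> (\<lambda>D. start (K D)) ` \<D> \<Longrightarrow> m \<subseteq> X"
          by (rule downset_family_least) (use downset_start in auto)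
        then obtain D1 where D1: "D1 \<in> \<D>" "\<And>D. D \<in> \<D> \<Longrightarrow> start (K D1) \<subseteq> start (K D)" by blast
        \<comment> \<open>Equal ends and the least start put \<open>K D1\<close> below
          \<open>K D'\<close>, which is an element of the down-set \<open>D'\<close>.\<close>
        have "K D1 \<in> D'" if "D' \<in> \<D>" for D'
        proof (rule downset_intervalsD[OF D[OF that] K(1)[OF that]])
          show "K D1 \<in> carrier intervals"
            using D[OF D1(1)] K(1)[OF D1(1)] by (auto simp: downset_def)
        qed (use D1 that K(2) in simp_all)
        then have "K D1 \<in> \<Inter>\<D>" by blast
        then have z: "z D1 \<in> span (\<Inter>\<D>)" by (rule subsetD[OF cell_span K(3)[OF D1(1)]])
        have zD: "z D1 \<in> span D" if "D \<in> \<D>" for D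
          by (rule subsetD[OF span_mono z]) (use that in blast)
        have c: "z D1 \<in> carrier G" "k D1 \<in> carrier G"
          by (rule subsetD[OF row_carrier zk(1)[OF D1(1)]]) (rule subsetD[OF span_carrier zk(2)[OF D1(1)]])
        \<comment> \<open>The splitting places \<open>k D1\<close> only in the span of
          \<open>D1\<close>; as a quotient of two elements common to all spans it lies in each of
          them.\<close>
        have "k D1 = inv (z D1) \<otimes> x" using zk(3)[OF D1(1)] c by (simp add: mult_inv_cancel_left)
        then have "\<forall>D\<in>\<D>. k D1 \<in> span D" using x(2) zD span_closed by simp
        then have "k D1 \<in> span (\<Inter>\<D>)" by (rule lower[OF zk(2)[OF D1(1)]])
        then show ?thesis using z zk(3)[OF D1(1)] span_closed(1) by simp
      qed
    qed
  qed
  show "(\<Inter>D\<in>\<D>. span D) \<subseteq> span (\<Inter>\<D>)"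
  proof
    fix x assume x: "x \<in> (\<Inter>D\<in>\<D>. span D)"
    obtain D0 where "D0 \<in> \<D>" using ne by blast
    then have "x \<in> span {K \<in> D0. finish K \<subseteq> UNIV}" using x by simp
    then have "x \<in> B UNIV" by (rule subsetD[OF span_finish_B[OF downset_UNIV]])
    then show "x \<in> span (\<Inter>\<D>)" using main[OF downset_UNIV, of x] x by simp
  qed
qed

end

subsection \<open>Cosets and fractions\<close>

context group
begin

lemma l_coset_eq_iff:
  assumes "subgroup N G" "x \<in> carrier G" "y \<in> carrier G"
  shows "x <# N = y <# N \<longleftrightarrow> inv y \<otimes> x \<in> N"
proof
  interpret subgroup N G by fact
  assume "x <# N = y <# N"
  moreover have "x \<in> x <# N"
    using one_closed assms(2) unfolding l_coset_def by force
  ultimately obtain n where "n \<in> N" "x = y \<otimes> n" unfolding l_coset_def by auto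
  then show "inv y \<otimes> x \<in> N" using assms(3) subset by (simp add: mult_inv_cancel_left)
next
  assume a: "inv y \<otimes> x \<in> N"
  have "x \<in> y <# N"
  proof -
    have "x = y \<otimes> (inv y \<otimes> x)" using assms by (simp add: mult_inv_cancel_left)
    then show ?thesis using a unfolding l_coset_def by blast
  qed
  then show "x <# N = y <# N" using l_repr_independence[OF _ assms(3,1)] by simp
qed

lemma l_coset_absorb:
  assumes "subgroup N G" "x \<in> N"
  shows "x <# N = N"
proof -
  have "x \<in> carrier G" using assms subgroup.subset by blast
  then have "x <# N = \<one> <# N" using assms by (simp add: l_coset_eq_iff)
  then show ?thesis using subgroup.subset[OF assms(1)] by (simp add: lcos_mult_one)
qed

end

text \<open>The maps between fractions, both the structure maps and those induced by inclusions, have the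
  form below.\<close>

locale coset_map = G: group G + H: group H for G (structure) and H (structure) +
  fixes h N P
  assumes hom: "h \<in> hom G H" and N: "subgroup N G" and P: "subgroup P H" and hN: "h ` N \<subseteq> P"
begin

lemma coset_map_eq:
  assumes x: "x \<in> carrier G"
  shows "(h ` (x <#\<^bsub>G\<^esub> N)) <#>\<^bsub>H\<^esub> P = h x <#\<^bsub>H\<^esub> P"
proof
  have hx: "h x \<in> carrier H" using hom x by (auto simp: hom_def)
  have Nc: "N \<subseteq> carrier G" and Pc: "P \<subseteq> carrier H" using N P subgroup.subset by blast+
  show "(h ` (x <#\<^bsub>G\<^esub> N)) <#>\<^bsub>H\<^esub> P \<subseteq> h x <#\<^bsub>H\<^esub> P"
  proof
    fix y assume "y \<in> (h ` (x <#\<^bsub>G\<^esub> N)) <#>\<^bsub>H\<^esub> P"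
    then obtain n p where np: "n \<in> N" "p \<in> P" "y = h (x \<otimes>\<^bsub>G\<^esub> n) \<otimes>\<^bsub>H\<^esub> p"
      unfolding l_coset_def set_mult_def by auto
    then have c: "n \<in> carrier G" "h n \<in> P" "p \<in> carrier H" using Nc Pc hN by auto
    then have "y = h x \<otimes>\<^bsub>H\<^esub> (h n \<otimes>\<^bsub>H\<^esub> p)"
      using np x hx hom Pc by (auto simp: hom_def H.m_assoc)
    moreover have "h n \<otimes>\<^bsub>H\<^esub> p \<in> P" using P c(2) np(2) by (rule subgroup.m_closed)
    ultimately show "y \<in> h x <#\<^bsub>H\<^esub> P" unfolding l_coset_def by blast
  qed
  show "h x <#\<^bsub>H\<^esub> P \<subseteq> (h ` (x <#\<^bsub>G\<^esub> N)) <#>\<^bsub>H\<^esub> P"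
  proof
    fix y assume "y \<in> h x <#\<^bsub>H\<^esub> P"
    then obtain p where p: "p \<in> P" "y = h x \<otimes>\<^bsub>H\<^esub> p" unfolding l_coset_def by auto
    have "x \<otimes>\<^bsub>G\<^esub> \<one>\<^bsub>G\<^esub> \<in> x <#\<^bsub>G\<^esub> N"
      using subgroup.one_closed[OF N] unfolding l_coset_def by blast
    then have "h x \<in> h ` (x <#\<^bsub>G\<^esub> N)" using x by simp
    then show "y \<in> (h ` (x <#\<^bsub>G\<^esub> N)) <#>\<^bsub>H\<^esub> P" using p unfolding set_mult_def by blast
  qed
qed

text \<open>The second isomorphism theorem for sets of left cosets. For an inclusion
  \<open>h\<close>, \<open>inj\<close> says that \<open>M\<close> meets \<open>P\<close> within
  \<open>N\<close>, and \<open>surj\<close> that \<open>Q\<close> is covered by the products of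
  \<open>M\<close> with \<open>P\<close>. For a structure map, the same two conditions express that
  it is an isomorphism of factors.\<close>

lemma coset_map_bij:
  assumes M: "subgroup M G" and hM: "h ` M \<subseteq> Q"
    and inj: "\<And>x. \<lbrakk>x \<in> M; h x \<in> P\<rbrakk> \<Longrightarrow> x \<in> N"
    and surj: "\<And>y. y \<in> Q \<Longrightarrow> \<exists>x\<in>M. \<exists>p\<in>P. y = h x \<otimes>\<^bsub>H\<^esub> p"
  shows "bij_betw (\<lambda>C. (h ` C) <#>\<^bsub>H\<^esub> P) ((\<lambda>x. x <#\<^bsub>G\<^esub> N) ` M) ((\<lambda>x. x <#\<^bsub>H\<^esub> P) ` Q)"
proof -
  have map: "(h ` (x <#\<^bsub>G\<^esub> N)) <#>\<^bsub>H\<^esub> P = h x <#\<^bsub>H\<^esub> P" if "x \<in> M" for x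
    using coset_map_eq subgroup.mem_carrier[OF M that] by simp
  have hc: "h x \<in> carrier H" if "x \<in> carrier G" for x using hom that by (auto simp: hom_def)
  interpret gh: group_hom G H h by unfold_locales (rule hom)
  have "inj_on (\<lambda>C. (h ` C) <#>\<^bsub>H\<^esub> P) ((\<lambda>x. x <#\<^bsub>G\<^esub> N) ` M)"
  proof (rule inj_onI, elim imageE, hypsubst)
    fix x y assume xy: "x \<in> M" "y \<in> M"
      and eq: "(h ` (x <#\<^bsub>G\<^esub> N)) <#>\<^bsub>H\<^esub> P = (h ` (y <#\<^bsub>G\<^esub> N)) <#>\<^bsub>H\<^esub> P"
    have c: "x \<in> carrier G" "y \<in> carrier G" using xy subgroup.mem_carrier[OF M] by auto
    have "h x <#\<^bsub>H\<^esub> P = h y <#\<^bsub>H\<^esub> P" using eq map xy by simp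
    then have "inv\<^bsub>H\<^esub> (h y) \<otimes>\<^bsub>H\<^esub> h x \<in> P" using H.l_coset_eq_iff[OF P] hc c by simp
    then have "h (inv\<^bsub>G\<^esub> y \<otimes>\<^bsub>G\<^esub> x) \<in> P" using c by simp
    then have "inv\<^bsub>G\<^esub> y \<otimes>\<^bsub>G\<^esub> x \<in> N"
      using inj xy by (simp add: subgroup.m_closed[OF M] subgroup.m_inv_closed[OF M])
    then show "x <#\<^bsub>G\<^esub> N = y <#\<^bsub>G\<^esub> N" using G.l_coset_eq_iff[OF N c] by simp
  qed
  moreover have "(\<lambda>C. (h ` C) <#>\<^bsub>H\<^esub> P) ` ((\<lambda>x. x <#\<^bsub>G\<^esub> N) ` M) = (\<lambda>x. x <#\<^bsub>H\<^esub> P) ` Q"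
  proof (intro equalityI subsetI)
    fix C assume "C \<in> (\<lambda>C. (h ` C) <#>\<^bsub>H\<^esub> P) ` ((\<lambda>x. x <#\<^bsub>G\<^esub> N) ` M)"
    then obtain x where "x \<in> M" "C = h x <#\<^bsub>H\<^esub> P" using map by auto
    then show "C \<in> (\<lambda>x. x <#\<^bsub>H\<^esub> P) ` Q" using hM by blast
  next
    fix C assume "C \<in> (\<lambda>x. x <#\<^bsub>H\<^esub> P) ` Q"
    then obtain y where y: "y \<in> Q" "C = y <#\<^bsub>H\<^esub> P" by blast
    obtain x p where xp: "x \<in> M" "p \<in> P" "y = h x \<otimes>\<^bsub>H\<^esub> p" using surj[OF y(1)] by (elim bexE)
    have c: "h x \<in> carrier H" "p \<in> carrier H"
      using hc subgroup.mem_carrier[OF M xp(1)] subgroup.mem_carrier[OF P xp(2)] by auto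
    have "y <#\<^bsub>H\<^esub> P = h x <#\<^bsub>H\<^esub> P"
      using c xp(2) by (simp add: H.l_coset_eq_iff[OF P] xp(3) H.mult_inv_cancel_left)
    then have "C = (h ` (x <#\<^bsub>G\<^esub> N)) <#>\<^bsub>H\<^esub> P" using map[OF xp(1)] y(2) by simp
    then show "C \<in> (\<lambda>C. (h ` C) <#>\<^bsub>H\<^esub> P) ` ((\<lambda>x. x <#\<^bsub>G\<^esub> N) ` M)" using xp(1) by blast
  qed
  ultimately show ?thesis by (simp add: bij_betw_def)
qed

end

subsection \<open>Lattices\<close>

text \<open>\<open>Lattice.sup\<close> chooses some least upper bound, so computing it requires
  uniqueness; the second premise is antisymmetry at \<open>x\<close>.\<close>

lemma sup_eqI:
  assumes "least L x (Upper L A)"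
    and "\<And>y. \<lbrakk>y \<in> carrier L; x \<sqsubseteq>\<^bsub>L\<^esub> y; y \<sqsubseteq>\<^bsub>L\<^esub> x\<rbrakk> \<Longrightarrow> y = x"
  shows "\<Squnion>\<^bsub>L\<^esub> A = x"
  unfolding Lattice.sup_def
proof (rule some_equality, fact assms(1))
  fix y assume "least L y (Upper L A)"
  then show "y = x" using assms(1) by (intro assms(2)) (auto simp: least_def subset_iff)
qed

lemma inf_eqI:
  assumes "greatest L x (Lower L A)"
    and "\<And>y. \<lbrakk>y \<in> carrier L; x \<sqsubseteq>\<^bsub>L\<^esub> y; y \<sqsubseteq>\<^bsub>L\<^esub> x\<rbrakk> \<Longrightarrow> y = x"
  shows "\<Sqinter>\<^bsub>L\<^esub> A = x"
  unfolding Lattice.inf_def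
proof (rule some_equality, fact assms(1))
  fix y assume "greatest L y (Lower L A)"
  then show "y = x" using assms(1) by (intro assms(2)) (auto simp: greatest_def subset_iff)
qed

lemma carrier_downset_lattice [simp]: "D \<in> carrier (downset_lattice P) \<longleftrightarrow> downset P D"
  by (simp add: downset_lattice_def)

lemma downset_lattice_sup:
  assumes "\<And>D. D \<in> F \<Longrightarrow> downset P D"
  shows "\<Squnion>\<^bsub>downset_lattice P\<^esub> F = \<Union>F"
proof (rule sup_eqI)
  show "least (downset_lattice P) (\<Union>F) (Upper (downset_lattice P) F)"
  proof (rule least_UpperI)
    show "\<Union>F \<in> carrier (downset_lattice P)"
      using assms unfolding carrier_downset_lattice downset_def by blast
    fix D assume D: "D \<in> Upper (downset_lattice P) F"
    have "X \<subseteq> D" if "X \<in> F" for X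
      using D that assms[OF that] by (auto simp: Upper_def downset_lattice_def)
    then show "\<Union>F \<sqsubseteq>\<^bsub>downset_lattice P\<^esub> D" by (simp add: downset_lattice_def Sup_le_iff)
  qed (use assms in \<open>auto simp: downset_lattice_def\<close>)
qed (simp add: downset_lattice_def)

text \<open>\<open>carrier P\<close> supplies the meet of the empty family, which is the top
  down-set, whereas \<open>\<Inter>{}\<close> is the whole type.\<close>

lemma downset_lattice_inf:
  assumes "\<And>D. D \<in> F \<Longrightarrow> downset P D"
  shows "\<Sqinter>\<^bsub>downset_lattice P\<^esub> F = carrier P \<inter> \<Inter>F"
proof (rule inf_eqI)
  show "greatest (downset_lattice P) (carrier P \<inter> \<Inter>F) (Lower (downset_lattice P) F)"
  proof (rule greatest_LowerI)
    show "carrier P \<inter> \<Inter>F \<in> carrier (downset_lattice P)"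
      using assms unfolding carrier_downset_lattice downset_def by blast
    fix D assume D: "D \<in> Lower (downset_lattice P) F"
    then have "D \<subseteq> carrier P" by (auto simp: Lower_def downset_lattice_def downset_def)
    moreover have "D \<subseteq> X" if "X \<in> F" for X
      using D that assms[OF that] by (auto simp: Lower_def downset_lattice_def)
    ultimately show "D \<sqsubseteq>\<^bsub>downset_lattice P\<^esub> carrier P \<inter> \<Inter>F"
      by (simp add: downset_lattice_def le_Inf_iff)
  qed (use assms in \<open>auto simp: downset_lattice_def\<close>)
qed (auto simp: downset_lattice_def)

lemma
  assumes "N \<in> carrier (subdiagrams Sub \<phi>)" "N' \<in> carrier (subdiagrams Sub \<phi>)" "N' \<le> N"
  shows subdiagrams_join_absorb: "N \<squnion>\<^bsub>subdiagrams Sub \<phi>\<^esub> N' = N"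
    and subdiagrams_meet_absorb: "N \<sqinter>\<^bsub>subdiagrams Sub \<phi>\<^esub> N' = N'"
proof -
  let ?L = "subdiagrams Sub \<phi>"
  have le: "x \<sqsubseteq>\<^bsub>?L\<^esub> y \<longleftrightarrow> x \<le> y" for x y by (simp add: subdiagrams_def)
  show "N \<squnion>\<^bsub>?L\<^esub> N' = N"
    unfolding join_def
  proof (rule sup_eqI)
    show "least ?L N (Upper ?L {N, N'})"
      by (rule least_UpperI) (use assms in \<open>auto simp: le Upper_def\<close>)
  qed (simp add: le)
  show "N \<sqinter>\<^bsub>?L\<^esub> N' = N'"
    unfolding meet_def
  proof (rule inf_eqI)
    show "greatest ?L N' (Lower ?L {N, N'})"
      by (rule greatest_LowerI) (use assms in \<open>auto simp: le Lower_def\<close>)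
  qed (simp add: le)
qed

lemma cdi_hom_Union:
  assumes "cdi_hom L Frac Zero Iso \<Omega>" "\<And>D. D \<in> F \<Longrightarrow> downset intervals D"
  shows "\<Omega> (\<Union>F) = \<Squnion>\<^bsub>L\<^esub> (\<Omega> ` F)"
proof -
  have "F \<subseteq> carrier (downset_lattice intervals)" using assms(2) by auto
  then have "\<Omega> (\<Squnion>\<^bsub>downset_lattice intervals\<^esub> F) = \<Squnion>\<^bsub>L\<^esub> (\<Omega> ` F)"
    using assms(1) unfolding cdi_hom_def sup_pres_def by simp
  then show ?thesis using downset_lattice_sup[of F intervals] assms(2) by simp
qed

lemma cdi_hom_Inter:
  assumes "cdi_hom L Frac Zero Iso \<Omega>" "\<And>D. D \<in> F \<Longrightarrow> downset intervals D"
  shows "\<Omega> (carrier intervals \<inter> \<Inter>F) = \<Sqinter>\<^bsub>L\<^esub> (\<Omega> ` F)"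
proof -
  have "F \<subseteq> carrier (downset_lattice intervals)" using assms(2) by auto
  then have "\<Omega> (\<Sqinter>\<^bsub>downset_lattice intervals\<^esub> F) = \<Sqinter>\<^bsub>L\<^esub> (\<Omega> ` F)"
    using assms(1) unfolding cdi_hom_def inf_pres_def by simp
  then show ?thesis using downset_lattice_inf[of F intervals] assms(2) by simp
qed

lemma cdi_hom_closed:
  "\<lbrakk>cdi_hom L Frac Zero Iso \<Omega>; downset intervals D\<rbrakk> \<Longrightarrow> \<Omega> D \<in> carrier L"
  unfolding cdi_hom_def by (auto simp: Pi_iff)

subsection \<open>Linearizations\<close>

text \<open>As \<open>lam\<close> extends the order of intervals, its down-sets are down-sets of
  intervals. The last two identities are the diamond: join and meet of
  \<open>down intervals J\<close> and \<open>sdown lam J\<close> are the remaining two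
  corners.\<close>

lemma linearization_down:
  assumes lin: "linearization intervals lam" and J: "J \<in> carrier intervals"
  shows "downset intervals (down lam J)" "downset intervals (sdown lam J)"
    "downset lam (down lam J)" "downset lam (sdown lam J)"
    "sdown lam J = down lam J - {J}" "J \<in> down lam J"
    "down intervals J \<union> sdown lam J = down lam J"
    "down intervals J \<inter> sdown lam J = sdown intervals J"
proof -
  interpret total_order lam using lin unfolding linearization_def by blast
  have car: "carrier lam = carrier intervals"
    and ext: "\<And>x y. \<lbrakk>x \<in> carrier intervals; y \<in> carrier intervals; x \<sqsubseteq>\<^bsub>intervals\<^esub> y\<rbrakk> \<Longrightarrow> x \<sqsubseteq>\<^bsub>lam\<^esub> y"
    using lin unfolding linearization_def by blast+
  have Jl: "J \<in> carrier lam" using J car by simp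
  show sd: "sdown lam J = down lam J - {J}"
    using Jl by (auto simp: sdown_def down_def lless_def eq_is_equal)
  show Jd: "J \<in> down lam J" using Jl by (simp add: down_def)
  show l1: "downset lam (down lam J)"
    unfolding downset_def down_def using le_trans[OF _ _ _ _ Jl] by blast
  have anti: "x = J" if "x \<in> down lam J" "J \<sqsubseteq>\<^bsub>lam\<^esub> x" for x
    using that Jl le_antisym[of x J] by (simp add: down_def)
  show l2: "downset lam (sdown lam J)"
    unfolding downset_def sd
  proof (intro conjI ballI impI)
    fix x y assume x: "x \<in> down lam J - {J}" and y: "y \<in> carrier lam" "y \<sqsubseteq>\<^bsub>lam\<^esub> x"
    have "y \<in> down lam J" using l1 x y unfolding downset_def by blast
    moreover have "y \<noteq> J" using anti[of x] x y by blast
    ultimately show "y \<in> down lam J - {J}" by blast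
  qed (auto simp: down_def)
  have conv: "downset intervals D" if "downset lam D" for D
    unfolding downset_def
  proof (intro conjI ballI impI)
    fix x y assume x: "x \<in> D" and y: "y \<in> carrier intervals" "y \<sqsubseteq>\<^bsub>intervals\<^esub> x"
    have "x \<in> carrier intervals" using that x car unfolding downset_def by auto
    then have "y \<sqsubseteq>\<^bsub>lam\<^esub> x" using ext y by simp
    then show "y \<in> D" using that x y(1) car unfolding downset_def by simp
  qed (use that car in \<open>simp add: downset_def\<close>)
  show "downset intervals (down lam J)" "downset intervals (sdown lam J)"
    by (rule conv[OF l1]) (rule conv[OF l2])
  have sub: "down intervals J \<subseteq> down lam J"
    using ext J car by (auto simp: down_def)
  have JJ: "J \<in> down intervals J" using J by (simp add: down_intervals_eq)
  show "down intervals J \<union> sdown lam J = down lam J"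
    using sub Jd JJ sd by blast
  show "down intervals J \<inter> sdown lam J = sdown intervals J"
    using sub sd sdown_intervals_eq[OF J] by blast
qed

subsection \<open>Isomorphisms of diagrams\<close>

text \<open>Because \<open>N' \<le> N\<close> and \<open>M' \<le> M\<close>, the lower fraction of
  \<open>canonical_iso\<close> is \<open>M' / N'\<close> and the upper one is \<open>M / N\<close>.
  Of the four inclusion maps two become identities and the other two become the same map
  \<open>Inc N\<close>, so the canonical isomorphism is its inverse.\<close>

lemma canonical_isoI:
  fixes Frac :: "('i::linorder \<Rightarrow> 'y set) \<Rightarrow> ('i \<Rightarrow> 'y set) \<Rightarrow> ('i, ('x, 'm) partial_object_scheme, 'x) diagram"
  assumes N: "N \<in> carrier (subdiagrams Sub \<phi>)" "N' \<in> carrier (subdiagrams Sub \<phi>)" "N' \<le> N"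
    and M: "M \<in> carrier (subdiagrams Sub \<phi>)" "M' \<in> carrier (subdiagrams Sub \<phi>)" "M' \<le> M"
    and inc: "diagram_iso Iso (Frac N' M') (Frac N M) (Inc N)"
    and bij: "\<And>a. bij_betw (Inc N a) (carrier (fst (Frac N' M') a)) (carrier (fst (Frac N M) a))"
    and inv: "\<And>a. Iso (fst (Frac N M) a) (fst (Frac N' M') a)
      (inv_into (carrier (fst (Frac N' M') a)) (Inc N a))"
    and id: "diagram_iso Iso (Frac N' M') (Frac N' M') (Inc N')"
      "\<And>a C. C \<in> carrier (fst (Frac N' M') a) \<Longrightarrow> Inc N' a C = C"
      "diagram_iso Iso (Frac N M) (Frac N M) (Inc N)"
      "\<And>a C. C \<in> carrier (fst (Frac N M) a) \<Longrightarrow> Inc N a C = C"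
    and struct: "\<And>a b C. \<lbrakk>a \<le> b; C \<in> carrier (fst (Frac N' M') a)\<rbrakk> \<Longrightarrow>
      snd (Frac N' M') a b C \<in> carrier (fst (Frac N' M') b)"
  shows "canonical_iso (subdiagrams Sub \<phi>) Frac Iso Inc N M N' M'
    (\<lambda>a. inv_into (carrier (fst (Frac N' M') a)) (Inc N a))"
proof -
  let ?\<eta> = "\<lambda>a. inv_into (carrier (fst (Frac N' M') a)) (Inc N a)"
  have \<eta>: "Inc N a (?\<eta> a C) = C" "?\<eta> a C \<in> carrier (fst (Frac N' M') a)"
    if "C \<in> carrier (fst (Frac N M) a)" for a C
    using that bij[of a] by (simp_all add: bij_betw_inv_into_right bij_betw_def f_inv_into_f inv_into_into)
  have \<eta>_Inc: "?\<eta> a (Inc N a C) = C" if "C \<in> carrier (fst (Frac N' M') a)" for a C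
    using that bij[of a] by (simp add: bij_betw_inv_into_left)
  have "diagram_iso Iso (Frac N M) (Frac N' M') ?\<eta>"
    unfolding diagram_iso_def
  proof (intro conjI allI impI ballI inv)
    fix a b C assume ab: "a \<le> b" and C: "C \<in> carrier (fst (Frac N M) a)"
    have "snd (Frac N M) a b C = snd (Frac N M) a b (Inc N a (?\<eta> a C))"
      using \<eta>(1)[OF C] by simp
    also have "\<dots> = Inc N b (snd (Frac N' M') a b (?\<eta> a C))"
      using inc ab \<eta>(2)[OF C] unfolding diagram_iso_def by simp
    finally show "?\<eta> b (snd (Frac N M) a b C) = snd (Frac N' M') a b (?\<eta> a C)"
      using \<eta>_Inc[OF struct[OF ab \<eta>(2)[OF C]]] by simp
  qed
  then show ?thesis
    unfolding canonical_iso_def Let_def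
    using subdiagrams_join_absorb[OF N] subdiagrams_meet_absorb[OF N]
      subdiagrams_join_absorb[OF M] subdiagrams_meet_absorb[OF M] inc id \<eta> \<eta>_Inc
    by simp
qed

lemma canonical_iso_diagram_iso:
  "\<exists>\<eta>. canonical_iso L Frac Iso Inc N M N' M' \<eta> \<Longrightarrow> \<exists>\<eta>. diagram_iso Iso (Frac N M) (Frac N' M') \<eta>"
  unfolding canonical_iso_def Let_def by blast

lemma diagram_iso_comp:
  assumes \<eta>: "diagram_iso Iso D E \<eta>" and \<theta>: "diagram_iso Iso E F \<theta>"
    and maps: "\<And>X Y h x. \<lbrakk>Iso X Y h; x \<in> carrier X\<rbrakk> \<Longrightarrow> h x \<in> carrier Y"
    and comp: "\<And>X Y Z h k. \<lbrakk>Iso X Y h; Iso Y Z k\<rbrakk> \<Longrightarrow> Iso X Z (k \<circ> h)"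
  shows "diagram_iso Iso D F (\<lambda>a. \<theta> a \<circ> \<eta> a)"
proof -
  have iso: "Iso (fst D a) (fst E a) (\<eta> a)" "Iso (fst E a) (fst F a) (\<theta> a)" for a
    using \<eta> \<theta> unfolding diagram_iso_def by simp_all
  show ?thesis
    unfolding diagram_iso_def
  proof (intro conjI allI impI ballI)
    show "Iso (fst D a) (fst F a) (\<theta> a \<circ> \<eta> a)" for a
      by (rule comp[OF iso])
    fix a b x assume ab: "a \<le> b" and x: "x \<in> carrier (fst D a)"
    have "\<eta> a x \<in> carrier (fst E a)" by (rule maps[OF iso(1) x])
    then show "(\<theta> b \<circ> \<eta> b) (snd D a b x) = snd F a b ((\<theta> a \<circ> \<eta> a) x)"
      using \<eta> \<theta> ab x unfolding diagram_iso_def by simp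
  qed
qed

subsection \<open>Diagrams of groups\<close>

locale group_diagram =
  fixes g :: "('i::wellorder, 'g monoid, 'g) diagram"
  assumes is_diagram: "is_diagram group (\<lambda>G H h. h \<in> hom G H) g"
begin

lemma grp: "group (fst g a)"
  and map_hom: "a \<le> b \<Longrightarrow> snd g a b \<in> hom (fst g a) (fst g b)"
  and map_id: "x \<in> carrier (fst g a) \<Longrightarrow> snd g a a x = x"
  and map_map: "\<lbrakk>a \<le> b; b \<le> c; x \<in> carrier (fst g a)\<rbrakk> \<Longrightarrow> snd g b c (snd g a b x) = snd g a c x"
  using is_diagram by (simp_all add: is_diagram_def)

lemma map_group_hom: "a \<le> b \<Longrightarrow> group_hom (fst g a) (fst g b) (snd g a b)"
  by (simp add: group_hom_def group_hom_axioms_def grp map_hom)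

lemma map_closed: "\<lbrakk>a \<le> b; x \<in> carrier (fst g a)\<rbrakk> \<Longrightarrow> snd g a b x \<in> carrier (fst g b)"
  using map_hom by (auto simp: hom_def)

lemma carrier_group_sub:
  "N \<in> carrier (group_sub g) \<longleftrightarrow>
    (\<forall>a. subgroup (N a) (fst g a)) \<and> (\<forall>a b. a \<le> b \<longrightarrow> snd g a b ` N a \<subseteq> N b)"
  by (simp add: group_sub_def subdiagrams_def)

lemma group_sub_le: "N \<sqsubseteq>\<^bsub>group_sub g\<^esub> M \<longleftrightarrow> N \<le> M"
  by (simp add: group_sub_def subdiagrams_def)

lemma
  assumes "N \<in> carrier (group_sub g)"
  shows group_sub_subgroup: "subgroup (N a) (fst g a)"
    and group_sub_subset: "N a \<subseteq> carrier (fst g a)"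
    and group_sub_map: "a \<le> b \<Longrightarrow> snd g a b ` N a \<subseteq> N b"
proof -
  show *: "subgroup (N a) (fst g a)" using assms unfolding carrier_group_sub by simp
  show "N a \<subseteq> carrier (fst g a)" by (rule subgroup.subset[OF *])
  show "snd g a b ` N a \<subseteq> N b" if "a \<le> b" using assms that unfolding carrier_group_sub by simp
qed

lemma coset_map_structure:
  assumes "N \<in> carrier (group_sub g)" "a \<le> b"
  shows "coset_map (fst g a) (fst g b) (snd g a b) (N a) (N b)"
  by (intro coset_map.intro coset_map_axioms.intro grp map_hom assms group_sub_subgroup group_sub_map)

lemma coset_map_inclusion:
  assumes "N \<in> carrier (group_sub g)" "N' \<in> carrier (group_sub g)" "N' a \<subseteq> N a"
  shows "coset_map (fst g a) (fst g a) (\<lambda>x. x) (N' a) (N a)"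
  by (intro coset_map.intro coset_map_axioms.intro grp assms group_sub_subgroup)
    (use assms(3) in \<open>auto simp: hom_def\<close>)

lemma inc_coset:
  assumes "N \<in> carrier (group_sub g)" "N' \<in> carrier (group_sub g)" "N' a \<subseteq> N a" "x \<in> carrier (fst g a)"
  shows "group_inc g N a (x <#\<^bsub>fst g a\<^esub> N' a) = x <#\<^bsub>fst g a\<^esub> N a"
  using coset_map.coset_map_eq[OF coset_map_inclusion[OF assms(1-3)] assms(4)]
  by (simp add: group_inc_def)

lemma map_coset:
  assumes "N \<in> carrier (group_sub g)" "a \<le> b" "x \<in> carrier (fst g a)"
  shows "snd (group_frac g N M) a b (x <#\<^bsub>fst g a\<^esub> N a) = snd g a b x <#\<^bsub>fst g b\<^esub> N b"
  using coset_map.coset_map_eq[OF coset_map_structure[OF assms(1,2)] assms(3)]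
  by (simp add: group_frac_def)

lemma carrier_group_frac:
  "carrier (fst (group_frac g N M) a) = (\<lambda>x. x <#\<^bsub>fst g a\<^esub> N a) ` M a"
  by (simp add: group_frac_def)

lemma point_group_frac:
  assumes "N \<in> carrier (group_sub g)"
  shows "point (fst (group_frac g N M) a) = \<one>\<^bsub>fst g a\<^esub> <#\<^bsub>fst g a\<^esub> N a"
  using group.l_coset_absorb[OF grp group_sub_subgroup[OF assms, of a]
      subgroup.one_closed[OF group_sub_subgroup[OF assms, of a]]]
  by (simp add: group_frac_def)

lemma map_coset_closed:
  assumes N: "N \<in> carrier (group_sub g)" and M: "M \<in> carrier (group_sub g)"
    and "a \<le> b" and C: "C \<in> carrier (fst (group_frac g N M) a)"
  shows "snd (group_frac g N M) a b C \<in> carrier (fst (group_frac g N M) b)"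
proof -
  obtain x where x: "x \<in> M a" "C = x <#\<^bsub>fst g a\<^esub> N a" using C unfolding carrier_group_frac by blast
  then have "x \<in> carrier (fst g a)" using group_sub_subset[OF M] by blast
  moreover have "snd g a b x \<in> M b" using x(1) group_sub_map[OF M assms(3)] by blast
  ultimately show ?thesis using map_coset[OF N assms(3)] x(2) by (simp add: carrier_group_frac)
qed

text \<open>At each index this is \<open>coset_map_bij\<close> for the identity map,
  \<open>Int\<close> giving injectivity and \<open>prod\<close> surjectivity. It is natural because
  both composites send the coset of \<open>x\<close> to the coset of its image under the structure
  map.\<close>

lemma inc_diagram_iso:
  assumes N: "N \<in> carrier (group_sub g)" "N' \<in> carrier (group_sub g)" "N' \<le> N"
    and M: "M \<in> carrier (group_sub g)" "M' \<in> carrier (group_sub g)" "M' \<le> M"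
    and Int: "\<And>a. N a \<inter> M' a \<subseteq> N' a" and prod: "\<And>a. M a \<subseteq> M' a <#>\<^bsub>fst g a\<^esub> N a"
  shows "diagram_iso pointed_iso (group_frac g N' M') (group_frac g N M) (group_inc g N)"
  unfolding diagram_iso_def
proof (intro conjI allI impI ballI)
  have N'N: "N' a \<subseteq> N a" for a using N(3) by (simp add: le_fun_def)
  have M'M: "M' a \<subseteq> M a" for a using M(3) by (simp add: le_fun_def)
  show "pointed_iso (fst (group_frac g N' M') a) (fst (group_frac g N M) a) (group_inc g N a)" for a
    unfolding pointed_iso_def
  proof
    have one: "\<one>\<^bsub>fst g a\<^esub> \<in> carrier (fst g a)"
      using group.is_monoid[OF grp] by (rule monoid.one_closed)
    show "group_inc g N a (point (fst (group_frac g N' M') a)) = point (fst (group_frac g N M) a)"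
      using inc_coset[where a=a, OF N(1,2) N'N one] by (simp add: point_group_frac N)
    interpret coset_map "fst g a" "fst g a" "\<lambda>x. x" "N' a" "N a"
      by (rule coset_map_inclusion[OF N(1,2) N'N])
    have "bij_betw (\<lambda>C. ((\<lambda>x. x) ` C) <#>\<^bsub>fst g a\<^esub> N a)
        ((\<lambda>x. x <#\<^bsub>fst g a\<^esub> N' a) ` M' a) ((\<lambda>x. x <#\<^bsub>fst g a\<^esub> N a) ` M a)"
    proof (rule coset_map_bij[OF group_sub_subgroup[OF M(2)]])
      show "(\<lambda>x. x) ` M' a \<subseteq> M a" using M'M by simp
      show "x \<in> N' a" if "x \<in> M' a" "x \<in> N a" for x using that Int[of a] by blast
      show "\<exists>x\<in>M' a. \<exists>p\<in>N a. y = x \<otimes>\<^bsub>fst g a\<^esub> p" if "y \<in> M a" for y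
        using that prod[of a] unfolding set_mult_def by blast
    qed
    moreover have "(\<lambda>C. ((\<lambda>x. x) ` C) <#>\<^bsub>fst g a\<^esub> N a) = group_inc g N a"
      by (simp add: group_inc_def fun_eq_iff)
    ultimately show "bij_betw (group_inc g N a) (carrier (fst (group_frac g N' M') a))
        (carrier (fst (group_frac g N M) a))"
      unfolding carrier_group_frac by simp
  qed
  fix a b C assume ab: "(a::'i) \<le> b" and "C \<in> carrier (fst (group_frac g N' M') a)"
  then obtain x where x: "x \<in> M' a" "C = x <#\<^bsub>fst g a\<^esub> N' a" unfolding carrier_group_frac by blast
  have xc: "x \<in> carrier (fst g a)" using x(1) group_sub_subset[OF M(2)] by blast
  show "group_inc g N b (snd (group_frac g N' M') a b C) = snd (group_frac g N M) a b (group_inc g N a C)"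
    unfolding x(2)
    by (simp add: map_coset[OF N(2) ab xc] map_coset[OF N(1) ab xc] inc_coset[OF N(1,2) N'N]
        map_closed[OF ab xc] xc)
qed

lemma inc_self:
  assumes "N \<in> carrier (group_sub g)" "M \<in> carrier (group_sub g)"
    and "C \<in> carrier (fst (group_frac g N M) a)"
  shows "group_inc g N a C = C"
proof -
  obtain x where x: "x \<in> M a" "C = x <#\<^bsub>fst g a\<^esub> N a" using assms(3) unfolding carrier_group_frac by blast
  then have "x \<in> carrier (fst g a)" using group_sub_subset[OF assms(2)] by blast
  then show ?thesis using inc_coset[OF assms(1,1)] x(2) by simp
qed

lemma inc_self_diagram_iso:
  assumes N: "N \<in> carrier (group_sub g)" and M: "M \<in> carrier (group_sub g)"
  shows "diagram_iso pointed_iso (group_frac g N M) (group_frac g N M) (group_inc g N)"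
proof (rule inc_diagram_iso[OF N N _ M M])
  show "M a \<subseteq> M a <#>\<^bsub>fst g a\<^esub> N a" for a
  proof
    fix x assume x: "x \<in> M a"
    have "x \<in> carrier (fst g a)" using x group_sub_subset[OF M] by blast
    then have "x = x \<otimes>\<^bsub>fst g a\<^esub> \<one>\<^bsub>fst g a\<^esub>"
      using group.is_monoid[OF grp] by (simp add: monoid.r_one)
    then show "x \<in> M a <#>\<^bsub>fst g a\<^esub> N a"
      using x subgroup.one_closed[OF group_sub_subgroup[OF N]] unfolding set_mult_def by blast
  qed
qed auto

lemma group_canonical_iso:
  assumes N: "N \<in> carrier (group_sub g)" "N' \<in> carrier (group_sub g)" "N' \<le> N"
    and M: "M \<in> carrier (group_sub g)" "M' \<in> carrier (group_sub g)" "M' \<le> M"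
    and inc: "diagram_iso pointed_iso (group_frac g N' M') (group_frac g N M) (group_inc g N)"
  shows "\<exists>\<eta>. canonical_iso (group_sub g) (group_frac g) pointed_iso (group_inc g) N M N' M' \<eta>"
proof -
  have p: "pointed_iso (fst (group_frac g N' M') a) (fst (group_frac g N M) a) (group_inc g N a)" for a
    using inc unfolding diagram_iso_def by simp
  have bij: "bij_betw (group_inc g N a) (carrier (fst (group_frac g N' M') a))
      (carrier (fst (group_frac g N M) a))" for a
    using p unfolding pointed_iso_def by simp
  have point: "point (fst (group_frac g N' M') a) \<in> carrier (fst (group_frac g N' M') a)" for a
    unfolding point_group_frac[OF N(2)] carrier_group_frac
    using subgroup.one_closed[OF group_sub_subgroup[OF M(2)]] by blast
  have "pointed_iso (fst (group_frac g N M) a) (fst (group_frac g N' M') a)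
      (inv_into (carrier (fst (group_frac g N' M') a)) (group_inc g N a))" for a
    unfolding pointed_iso_def
  proof (rule conjI[OF bij_betw_inv_into[OF bij]])
    have "point (fst (group_frac g N M) a) = group_inc g N a (point (fst (group_frac g N' M') a))"
      using p[of a] by (simp add: pointed_iso_def)
    then show "inv_into (carrier (fst (group_frac g N' M') a)) (group_inc g N a)
        (point (fst (group_frac g N M) a)) = point (fst (group_frac g N' M') a)"
      using bij_betw_inv_into_left[OF bij point] by simp
  qed
  from canonical_isoI[where Frac = "group_frac g" and Inc = "group_inc g" and Iso = pointed_iso
      and N = N and N' = N' and M = M and M' = M', OF N[unfolded group_sub_def] M[unfolded group_sub_def]
      inc bij this inc_self_diagram_iso[OF N(2) M(2)] inc_self[OF N(2) M(2)]
      inc_self_diagram_iso[OF N(1) M(1)] inc_self[OF N(1) M(1)] map_coset_closed[OF N(2) M(2)]]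
  show ?thesis unfolding group_sub_def by blast
qed

section \<open>Joins and meets of subdiagrams of groups\<close>

lemma group_sub_sup:
  assumes F: "F \<subseteq> carrier (group_sub g)"
  shows "\<Squnion>\<^bsub>group_sub g\<^esub> F = (\<lambda>a. generate (fst g a) (\<Union>M\<in>F. M a))"
proof (rule sup_eqI)
  have FL: "M \<in> carrier (group_sub g)" if "M \<in> F" for M using that F by blast
  have sub: "(\<Union>M\<in>F. M a) \<subseteq> carrier (fst g a)" for a
    by (rule UN_least) (rule group_sub_subset[OF FL])
  let ?S = "\<lambda>a. generate (fst g a) (\<Union>M\<in>F. M a)"
  show "least (group_sub g) ?S (Upper (group_sub g) F)"
  proof (rule least_UpperI[OF _ _ F])
    show "M \<sqsubseteq>\<^bsub>group_sub g\<^esub> ?S" if "M \<in> F" for M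
      unfolding group_sub_le le_fun_def using that by (auto intro: generate.incl)
    show "?S \<sqsubseteq>\<^bsub>group_sub g\<^esub> M" if "M \<in> Upper (group_sub g) F" for M
      unfolding group_sub_le le_fun_def
    proof
      fix a
      have M: "M \<in> carrier (group_sub g)" and "\<And>N. N \<in> F \<Longrightarrow> N \<le> M"
        using that F by (auto simp: Upper_def group_sub_le)
      then have "(\<Union>N\<in>F. N a) \<subseteq> M a" by (simp add: UN_least le_fun_def)
      then show "?S a \<le> M a"
        by (rule group.generate_subgroup_incl[OF grp _ group_sub_subgroup[OF M]])
    qed
    show "?S \<in> carrier (group_sub g)"
      unfolding carrier_group_sub
    proof (intro conjI allI impI)
      show "subgroup (?S a) (fst g a)" for a
        by (rule group.generate_is_subgroup[OF grp sub])
      fix a b assume ab: "(a::'i) \<le> b"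
      have "snd g a b ` (\<Union>M\<in>F. M a) \<subseteq> (\<Union>M\<in>F. M b)"
        unfolding image_UN by (rule UN_mono[OF order_refl]) (rule group_sub_map[OF FL ab])
      then have "generate (fst g b) (snd g a b ` (\<Union>M\<in>F. M a)) \<subseteq> ?S b"
        by (rule group.mono_generate[OF grp])
      then show "snd g a b ` ?S a \<subseteq> ?S b"
        using group_hom.generate_img[OF map_group_hom[OF ab] sub] by simp
    qed
  qed
qed (simp add: group_sub_le)

lemma group_sub_inf:
  assumes F: "F \<subseteq> carrier (group_sub g)"
  shows "\<Sqinter>\<^bsub>group_sub g\<^esub> F = (\<lambda>a. carrier (fst g a) \<inter> (\<Inter>M\<in>F. M a))"
proof (rule inf_eqI)
  let ?S = "\<lambda>a. carrier (fst g a) \<inter> (\<Inter>M\<in>F. M a)"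
  show "greatest (group_sub g) ?S (Lower (group_sub g) F)"
  proof (rule greatest_LowerI[OF _ _ F])
    show "?S \<sqsubseteq>\<^bsub>group_sub g\<^esub> M" if "M \<in> F" for M
      unfolding group_sub_le le_fun_def using that by auto
    show "M \<sqsubseteq>\<^bsub>group_sub g\<^esub> ?S" if "M \<in> Lower (group_sub g) F" for M
    proof -
      have M: "M \<in> carrier (group_sub g)" and "\<And>N. N \<in> F \<Longrightarrow> M \<le> N"
        using that F by (auto simp: Lower_def group_sub_le)
      then show ?thesis
        unfolding group_sub_le using group_sub_subset[OF M] by (auto simp: le_fun_def)
    qed
    show "?S \<in> carrier (group_sub g)"
      unfolding carrier_group_sub
    proof (intro conjI allI impI)
      fix a
      have "subgroup (\<Inter> (insert (carrier (fst g a)) ((\<lambda>M. M a) ` F))) (fst g a)"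
      proof (rule group.subgroups_Inter[OF grp])
        fix H assume "H \<in> insert (carrier (fst g a)) ((\<lambda>M. M a) ` F)"
        then consider "H = carrier (fst g a)" | M where "M \<in> F" "H = M a" by blast
        then show "subgroup H (fst g a)"
        proof cases
          case 1
          then show ?thesis using group.subgroup_self[OF grp] by simp
        next
          case (2 M)
          then have "M \<in> carrier (group_sub g)" using F by blast
          then show ?thesis unfolding 2(2) by (rule group_sub_subgroup)
        qed
      qed simp
      then show "subgroup (?S a) (fst g a)" by simp
    next
      fix a b assume ab: "(a::'i) \<le> b"
      show "snd g a b ` ?S a \<subseteq> ?S b"
      proof
        fix y assume "y \<in> snd g a b ` ?S a"
        then obtain x where x: "x \<in> carrier (fst g a)" "\<And>M. M \<in> F \<Longrightarrow> x \<in> M a" "y = snd g a b x"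
          by blast
        have "y \<in> M b" if M: "M \<in> F" for M
        proof -
          have "M \<in> carrier (group_sub g)" using M F by blast
          then show ?thesis using group_sub_map[OF _ ab, of M] x(2)[OF M] x(3) by blast
        qed
        then show "y \<in> ?S b" using x map_closed[OF ab] by simp
      qed
    qed
  qed
qed (simp add: group_sub_le)

section \<open>Values of a CDI homomorphism of groups\<close>

lemma group_cdi_closed: "\<lbrakk>group_cdi_hom g \<Psi>; downset intervals D\<rbrakk> \<Longrightarrow> \<Psi> D \<in> carrier (group_sub g)"
  unfolding group_cdi_hom_def by (rule cdi_hom_closed)

lemma group_cdi_Union:
  assumes "group_cdi_hom g \<Psi>" "\<And>D. D \<in> F \<Longrightarrow> downset intervals D"
  shows "\<Psi> (\<Union>F) a = generate (fst g a) (\<Union>D\<in>F. \<Psi> D a)"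
proof -
  have "\<Psi> ` F \<subseteq> carrier (group_sub g)" by (rule image_subsetI) (rule group_cdi_closed[OF assms])
  then show ?thesis
    using cdi_hom_Union[OF assms(1)[unfolded group_cdi_hom_def] assms(2)] by (simp add: group_sub_sup)
qed

lemma group_cdi_Inter:
  assumes "group_cdi_hom g \<Psi>" "\<And>D. D \<in> F \<Longrightarrow> downset intervals D"
  shows "\<Psi> (carrier intervals \<inter> \<Inter>F) a = carrier (fst g a) \<inter> (\<Inter>D\<in>F. \<Psi> D a)"
proof -
  have "\<Psi> ` F \<subseteq> carrier (group_sub g)" by (rule image_subsetI) (rule group_cdi_closed[OF assms])
  then show ?thesis
    using cdi_hom_Inter[OF assms(1)[unfolded group_cdi_hom_def] assms(2)] by (simp add: group_sub_inf)
qed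

lemma group_cdi_Int:
  assumes "group_cdi_hom g \<Psi>" "downset intervals D" "downset intervals D'"
  shows "\<Psi> (D \<inter> D') a = \<Psi> D a \<inter> \<Psi> D' a"
proof -
  have "carrier intervals \<inter> \<Inter>{D, D'} = D \<inter> D'" using assms(2) by (auto simp: downset_def)
  then show ?thesis
    using group_cdi_Inter[OF assms(1), of "{D, D'}" a] assms(2,3)
      group_sub_subset[OF group_cdi_closed[OF assms(1,2)], of a] by auto
qed

lemma group_cdi_mono:
  assumes "group_cdi_hom g \<Psi>" "downset intervals D" "downset intervals D'" "D \<subseteq> D'"
  shows "\<Psi> D a \<subseteq> \<Psi> D' a"
  using group_cdi_Int[OF assms(1-3), of a] assms(4) by (auto simp: Int_absorb2)

text \<open>A down-set is the union of the principal down-sets of its members. Thus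
  \<open>\<Psi> D\<close> has the form of a \<open>span\<close>.\<close>

lemma group_cdi_down:
  assumes "group_cdi_hom g \<Psi>" "downset intervals D"
  shows "\<Psi> D a = generate (fst g a) (\<Union>K\<in>D. \<Psi> (down intervals K) a)"
proof -
  have D: "D \<subseteq> carrier intervals" using assms(2) by (simp add: downset_def)
  have "down intervals K \<subseteq> D" if "K \<in> D" for K
    using that D downset_intervalsD[OF assms(2) that] by (auto simp: down_intervals_eq)
  moreover have "K \<in> down intervals K" if "K \<in> D" for K
    using that D by (auto simp: down_intervals_eq)
  ultimately have "\<Union>(down intervals ` D) = D" by blast
  moreover have "\<Psi> (\<Union>(down intervals ` D)) a
      = generate (fst g a) (\<Union>X\<in>down intervals ` D. \<Psi> X a)"
    by (rule group_cdi_Union[OF assms(1)]) (use D downset_down in auto)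
  ultimately show ?thesis by (simp add: image_image)
qed

lemma group_kernel_normal: "group_kernel g T a \<lhd> fst g a"
proof -
  let ?Ker = "\<lambda>b. kernel (fst g a) (fst g b) (snd g a b)"
  let ?B = "{b. a \<le> b \<and> b \<notin> T}"
  have normal: "?Ker b \<lhd> fst g a" if "b \<in> ?B" for b
    using that group_hom.normal_kernel[OF map_group_hom] by simp
  \<comment> \<open>The inserted carrier is the value when no index at or after \<open>a\<close>
    lies outside \<open>T\<close>.\<close>
  have eq: "group_kernel g T a = \<Inter> (insert (carrier (fst g a)) (?Ker ` ?B))"
    unfolding group_kernel_def kernel_def by blast
  have "subgroup (\<Inter> (insert (carrier (fst g a)) (?Ker ` ?B))) (fst g a)"
  proof (rule group.subgroups_Inter[OF grp])
    fix H assume "H \<in> insert (carrier (fst g a)) (?Ker ` ?B)"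
    then consider "H = carrier (fst g a)" | b where "b \<in> ?B" "H = ?Ker b" by blast
    then show "subgroup H (fst g a)"
    proof cases
      case 1
      then show ?thesis using group.subgroup_self[OF grp] by simp
    next
      case (2 b)
      then show ?thesis using normal_imp_subgroup[OF normal] by simp
    qed
  qed simp
  then have sub: "subgroup (group_kernel g T a) (fst g a)" unfolding eq .
  show ?thesis
  proof (rule group.normal_invI[OF grp sub])
    fix x h assume x: "x \<in> carrier (fst g a)" and h: "h \<in> group_kernel g T a"
    let ?y = "x \<otimes>\<^bsub>fst g a\<^esub> h \<otimes>\<^bsub>fst g a\<^esub> inv\<^bsub>fst g a\<^esub> x"
    have "?y \<in> ?Ker b" if b: "b \<in> ?B" for b
    proof (rule normal.inv_op_closed2[OF normal[OF b] x])
      show "h \<in> ?Ker b" using h b unfolding eq by blast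
    qed
    moreover have "h \<in> carrier (fst g a)" using h unfolding eq by blast
    then have "?y \<in> carrier (fst g a)"
      using x group.inv_closed[OF grp x] by (simp add: monoid.m_closed[OF group.is_monoid[OF grp]])
    ultimately show "?y \<in> group_kernel g T a" unfolding eq by blast
  qed
qed

text \<open>The two chains are the values of \<open>\<Psi>\<close> at the down-sets that bound only
  the start or only the end. Preservation of meets makes their intersections the values at
  rectangles, and \<open>fill\<close> is then \<open>group_cdi_down\<close> at a rectangle.
  Compatibility with kernels enters for normality: bounding only the end gives a kernel.\<close>

lemma interval_filtration_cdi:
  assumes cdi: "group_cdi_hom g \<Psi>"
    and ker: "\<And>T. downset index_poset T \<Longrightarrow> \<Psi> {K \<in> carrier intervals. K \<subseteq> T} = group_kernel g T"
  shows "interval_filtration (fst g a) (\<lambda>S. \<Psi> {K \<in> carrier intervals. start K \<subseteq> S} a)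
    (\<lambda>T. \<Psi> {K \<in> carrier intervals. finish K \<subseteq> T} a)"
    and "K \<in> carrier intervals \<Longrightarrow> \<Psi> {L \<in> carrier intervals. start L \<subseteq> start K} a \<inter>
      \<Psi> {L \<in> carrier intervals. finish L \<subseteq> finish K} a = \<Psi> (down intervals K) a"
proof -
  let ?A = "\<lambda>S. {K \<in> carrier intervals. start K \<subseteq> S}"
  let ?B = "\<lambda>T. {K \<in> carrier intervals. finish K \<subseteq> T}"
  let ?R = "\<lambda>S T. {K \<in> carrier intervals. start K \<subseteq> S \<and> finish K \<subseteq> T}"
  have dA: "downset intervals (?A S)" and dB: "downset intervals (?B S)" for S :: "'i set"
    unfolding downset_intervals_iff by blast+
  have AB: "\<Psi> (?A S) a \<inter> \<Psi> (?B T) a = \<Psi> (?R S T) a" for S T :: "'i set"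
  proof -
    have "?A S \<inter> ?B T = ?R S T" by blast
    then show ?thesis using group_cdi_Int[OF cdi dA dB, of S T a] by simp
  qed
  show cell: "\<Psi> (?A (start K)) a \<inter> \<Psi> (?B (finish K)) a = \<Psi> (down intervals K) a"
    if "K \<in> carrier intervals" for K
    unfolding AB down_intervals_eq[OF that] ..
  show "interval_filtration (fst g a) (\<lambda>S. \<Psi> (?A S) a) (\<lambda>T. \<Psi> (?B T) a)"
  proof (intro interval_filtration.intro interval_filtration_axioms.intro grp)
    fix S T :: "'i set" assume S: "downset index_poset S"
    show "subgroup (\<Psi> (?A S) a) (fst g a)"
      by (rule group_sub_subgroup[OF group_cdi_closed[OF cdi dA]])
    have "?B S = {K \<in> carrier intervals. K \<subseteq> S}" using finish_subset_iff[OF S] by blast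
    then have "\<Psi> (?B S) = group_kernel g S" using ker[OF S] by simp
    then show "\<Psi> (?B S) a \<lhd> fst g a" using group_kernel_normal by simp
    show "\<Psi> (?A S) a \<inter> \<Psi> (?B T) a \<subseteq>
      generate (fst g a) (\<Union>K\<in>?R S T. \<Psi> (?A (start K)) a \<inter> \<Psi> (?B (finish K)) a)"
      unfolding AB using group_cdi_down[OF cdi downset_rect, of S T a]
      by (simp add: AB down_intervals_eq)
  next
    fix S T :: "'i set" assume "S \<subseteq> T"
    then show "\<Psi> (?A S) a \<subseteq> \<Psi> (?A T) a" "\<Psi> (?B S) a \<subseteq> \<Psi> (?B T) a"
      by (intro group_cdi_mono[OF cdi dA dA] group_cdi_mono[OF cdi dB dB]; blast)+
  qed
qed

text \<open>This is \<open>span_product\<close> once cells and spans are identified with values of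
  \<open>\<Psi>\<close>.\<close>

lemma group_cdi_product:
  assumes cdi: "group_cdi_hom g \<Psi>"
    and ker: "\<And>T. downset index_poset T \<Longrightarrow> \<Psi> {K \<in> carrier intervals. K \<subseteq> T} = group_kernel g T"
    and E: "downset intervals E" "J \<in> E" "downset intervals (E - {J})"
  shows "\<Psi> E a \<subseteq> \<Psi> (down intervals J) a <#>\<^bsub>fst g a\<^esub> \<Psi> (E - {J}) a"
proof -
  interpret interval_filtration "fst g a" "\<lambda>S. \<Psi> {K \<in> carrier intervals. start K \<subseteq> S} a"
    "\<lambda>T. \<Psi> {K \<in> carrier intervals. finish K \<subseteq> T} a"
    by (rule interval_filtration_cdi(1)[OF cdi ker])
  have cell: "cell K = \<Psi> (down intervals K) a" if "K \<in> carrier intervals" for K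
    unfolding cell_def by (rule interval_filtration_cdi(2)[OF cdi ker that])
  have span: "span D = \<Psi> D a" if "downset intervals D" for D
  proof -
    have "(\<Union>K\<in>D. cell K) = (\<Union>K\<in>D. \<Psi> (down intervals K) a)"
    proof (rule SUP_cong[OF refl])
      fix K assume "K \<in> D"
      then have "K \<in> carrier intervals" using that by (auto simp: downset_def)
      then show "cell K = \<Psi> (down intervals K) a" by (rule cell)
    qed
    then show ?thesis unfolding span_def group_cdi_down[OF cdi that] by simp
  qed
  have J: "J \<in> carrier intervals" using E(1,2) by (auto simp: downset_def)
  show ?thesis using span_product[OF E] unfolding span[OF E(1)] span[OF E(3)] cell[OF J] .
qed

end

subsection \<open>The CDI homomorphism generated by images and kernels\<close>

text \<open>The interval is \<open>T - {..<a}\<close>, the part of \<open>T\<close> from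
  \<open>a\<close> on. At \<open>a\<close>, belonging to an image from an index up to
  \<open>a\<close> is no restriction, so its cell there is the full kernel.\<close>

lemma downset_interval:
  assumes "downset index_poset T" "a \<in> T"
  obtains K where "K \<in> carrier intervals" "start K = {..<a}" "finish K = T"
proof -
  have "{..<a} \<subset> T" using assms by (auto simp: downset_index_iff)
  then have "represents (T - {..<a}) {..<a} T"
    using assms(1) by (simp add: represents_def downset_lessThan)
  then show ?thesis using that[of "T - {..<a}"] by (simp add: represents_iff)
qed

context group_diagram
begin

text \<open>Elements at \<open>a\<close> that come from an index no later than the first one outside
  \<open>S\<close>. The condition is \<open>{..<s} \<subseteq> S\<close> and not
  \<open>s \<in> S\<close>, because an interval with start \<open>S\<close> begins at that first
  outside index, which therefore has to be allowed.\<close>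

definition image_part :: "'i set \<Rightarrow> 'i \<Rightarrow> 'g set" where
  "image_part S a = (\<Union>s\<in>{s. s \<le> a \<and> {..<s} \<subseteq> S}. snd g s a ` carrier (fst g s))"

definition image_kernel :: "'i set set \<Rightarrow> 'i \<Rightarrow> 'g set" where
  "image_kernel D a =
    generate (fst g a) (\<Union>K\<in>D. image_part (start K) a \<inter> group_kernel g (finish K) a)"

section \<open>Images and kernels as a filtration\<close>

lemma image_part_carrier: "image_part S a \<subseteq> carrier (fst g a)"
  unfolding image_part_def using map_closed by auto

lemma image_part_mono: "S \<subseteq> S' \<Longrightarrow> image_part S a \<subseteq> image_part S' a"
  unfolding image_part_def by (intro UN_mono) auto

lemma image_part_self:
  assumes "{..<a} \<subseteq> S"
  shows "image_part S a = carrier (fst g a)"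
proof
  show "carrier (fst g a) \<subseteq> image_part S a"
  proof
    fix x assume "x \<in> carrier (fst g a)"
    then have "x \<in> snd g a a ` carrier (fst g a)" using map_id[of x a] by (metis imageI)
    then show "x \<in> image_part S a" using assms unfolding image_part_def by blast
  qed
qed (rule image_part_carrier)

lemma image_part_map:
  assumes "a \<le> b"
  shows "snd g a b ` image_part S a \<subseteq> image_part S b"
proof
  fix y assume "y \<in> snd g a b ` image_part S a"
  then obtain s w where s: "s \<le> a" "{..<s} \<subseteq> S" "w \<in> carrier (fst g s)" "y = snd g a b (snd g s a w)"
    unfolding image_part_def by blast
  then have "y = snd g s b w" using map_map[OF s(1) assms s(3)] by simp
  then show "y \<in> image_part S b"
    using s order.trans[OF s(1) assms] unfolding image_part_def by blast
qed

lemma image_part_subgroup: "subgroup (image_part S a) (fst g a)"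
proof (rule group.subgroupI[OF grp image_part_carrier])
  \<comment> \<open>The least index is admissible for every \<open>S\<close>, since
    \<open>{..<z}\<close> is empty; this keeps \<open>image_part\<close> nonempty even for empty
    \<open>S\<close>.\<close>
  define z :: 'i where "z = (LEAST x. True)"
  have z: "z \<le> x" for x unfolding z_def by (rule Least_le) simp
  have "\<one>\<^bsub>fst g z\<^esub> \<in> carrier (fst g z)" using group.is_monoid[OF grp] by (rule monoid.one_closed)
  moreover have "z \<le> a" "{..<z} \<subseteq> S" using z not_le by auto
  ultimately show "image_part S a \<noteq> {}" unfolding image_part_def by blast
next
  fix x assume "x \<in> image_part S a"
  then obtain s w where s: "s \<le> a" "{..<s} \<subseteq> S" "w \<in> carrier (fst g s)" "x = snd g s a w"
    unfolding image_part_def by blast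
  have "inv\<^bsub>fst g a\<^esub> x = snd g s a (inv\<^bsub>fst g s\<^esub> w)"
    using group_hom.hom_inv[OF map_group_hom[OF s(1)] s(3)] s(4) by simp
  then show "inv\<^bsub>fst g a\<^esub> x \<in> image_part S a"
    using s(1,2) group.inv_closed[OF grp s(3)] unfolding image_part_def by blast
next
  fix x y assume "x \<in> image_part S a" "y \<in> image_part S a"
  then obtain s w t v where s: "s \<le> a" "{..<s} \<subseteq> S" "w \<in> carrier (fst g s)" "x = snd g s a w"
    and t: "t \<le> a" "{..<t} \<subseteq> S" "v \<in> carrier (fst g t)" "y = snd g t a v"
    unfolding image_part_def by blast
  \<comment> \<open>The two elements may come from different indices; they are multiplied at the
    later one, which is admissible too.\<close>
  define m where "m = max s t"
  have m: "s \<le> m" "t \<le> m" "m \<le> a" "{..<m} \<subseteq> S"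
    using s(1,2) t(1,2) by (auto simp: m_def max_def)
  let ?u = "snd g s m w \<otimes>\<^bsub>fst g m\<^esub> snd g t m v"
  have c: "snd g s m w \<in> carrier (fst g m)" "snd g t m v \<in> carrier (fst g m)"
    using map_closed[OF m(1) s(3)] map_closed[OF m(2) t(3)] .
  have "snd g m a ?u = snd g m a (snd g s m w) \<otimes>\<^bsub>fst g a\<^esub> snd g m a (snd g t m v)"
    by (rule group_hom.hom_mult[OF map_group_hom[OF m(3)] c])
  then have "x \<otimes>\<^bsub>fst g a\<^esub> y = snd g m a ?u"
    using map_map[OF m(1,3) s(3)] map_map[OF m(2,3) t(3)] s(4) t(4) by simp
  moreover have "?u \<in> carrier (fst g m)"
    using group.is_monoid[OF grp] c by (rule monoid.m_closed)
  ultimately show "x \<otimes>\<^bsub>fst g a\<^esub> y \<in> image_part S a"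
    using m(3,4) unfolding image_part_def by blast
qed

lemma kernel_trivial: "a \<notin> T \<Longrightarrow> x \<in> group_kernel g T a \<Longrightarrow> x = \<one>\<^bsub>fst g a\<^esub>"
  using map_id unfolding group_kernel_def by auto

lemma kernel_mono: "T \<subseteq> T' \<Longrightarrow> group_kernel g T a \<subseteq> group_kernel g T' a"
  unfolding group_kernel_def by auto

lemma kernel_carrier: "group_kernel g T a \<subseteq> carrier (fst g a)"
  unfolding group_kernel_def by auto

lemma kernel_map:
  assumes "a \<le> b"
  shows "snd g a b ` group_kernel g T a \<subseteq> group_kernel g T b"
proof
  fix y assume "y \<in> snd g a b ` group_kernel g T a"
  then obtain x where x: "x \<in> carrier (fst g a)" "y = snd g a b x"
    and k: "\<And>c. a \<le> c \<Longrightarrow> c \<notin> T \<Longrightarrow> snd g a c x = \<one>\<^bsub>fst g c\<^esub>"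
    unfolding group_kernel_def by blast
  have "snd g b c y = \<one>\<^bsub>fst g c\<^esub>" if "b \<le> c" "c \<notin> T" for c
    using map_map[OF assms that(1) x(1)] k[OF order.trans[OF assms that(1)] that(2)] x(2) by simp
  then show "y \<in> group_kernel g T b"
    using map_closed[OF assms x(1)] x(2) unfolding group_kernel_def by simp
qed

text \<open>For \<open>fill\<close>, a single cell suffices at each index. Outside \<open>T\<close>
  the kernel is trivial. At \<open>a\<close> in both \<open>S\<close> and \<open>T\<close> the image
  condition is void, so the interval from \<open>a\<close> to the end of \<open>T\<close> works,
  even when \<open>S\<close> contains \<open>T\<close>. At \<open>a\<close> in \<open>T\<close> but
  not in \<open>S\<close> the set \<open>T - S\<close> is itself the required interval.\<close>

lemma image_kernel_filtration:
  "interval_filtration (fst g a) (\<lambda>S. image_part S a) (\<lambda>T. group_kernel g T a)"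
proof (intro interval_filtration.intro interval_filtration_axioms.intro grp image_part_subgroup
    group_kernel_normal image_part_mono kernel_mono)
  fix S T :: "'i set" assume S: "downset index_poset S" and T: "downset index_poset T"
  let ?X = "\<Union>K\<in>{K \<in> carrier intervals. start K \<subseteq> S \<and> finish K \<subseteq> T}.
    image_part (start K) a \<inter> group_kernel g (finish K) a"
  show "image_part S a \<inter> group_kernel g T a \<subseteq> generate (fst g a) ?X"
  proof
    fix x assume x: "x \<in> image_part S a \<inter> group_kernel g T a"
    have cell: "x \<in> generate (fst g a) ?X"
      if "K \<in> carrier intervals" "start K \<subseteq> S" "finish K = T" "x \<in> image_part (start K) a" for K
    proof (rule generate.incl)
      show "x \<in> ?X" by (rule UN_I[of K]) (use that x in simp_all)
    qed
    consider "a \<notin> T" | "a \<in> T" "a \<in> S" | "a \<in> T" "a \<notin> S" by blast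
    then show "x \<in> generate (fst g a) ?X"
    proof cases
      case 1
      then show ?thesis using kernel_trivial[OF 1, of x] x by (simp add: generate.one)
    next
      case 2
      obtain K where K: "K \<in> carrier intervals" "start K = {..<a}" "finish K = T"
        using downset_interval[OF T 2(1)] .
      have "{..<a} \<subseteq> S" using S 2(2) by (auto simp: downset_index_iff)
      moreover have "x \<in> carrier (fst g a)" using x image_part_carrier by blast
      ultimately show ?thesis using K by (intro cell[of K]) (simp_all add: image_part_self)
    next
      case 3
      then have "S \<subset> T" using downset_linear[OF S T] by blast
      then have "represents (T - S) S T" using S T by (simp add: represents_def)
      then have "T - S \<in> carrier intervals" "start (T - S) = S" "finish (T - S) = T"
        by (simp_all add: represents_iff)
      then show ?thesis using x by (intro cell[of "T - S"]) simp_all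
    qed
  qed
qed

sublocale image_kernel: interval_filtration "fst g a" "\<lambda>S. image_part S a" "\<lambda>T. group_kernel g T a"
  for a
  by (rule image_kernel_filtration)

lemma image_kernel_span: "image_kernel D a = image_kernel.span a D"
  unfolding image_kernel_def image_kernel.span_def image_kernel.cell_def ..

lemma image_kernel_rect:
  assumes "downset index_poset S" "downset index_poset T"
  shows "image_kernel {K \<in> carrier intervals. start K \<subseteq> S \<and> finish K \<subseteq> T} a
    = image_part S a \<inter> group_kernel g T a"
  unfolding image_kernel_span by (rule image_kernel.span_rect[OF assms])

text \<open>Compatibility with kernels: a bound on the ends alone imposes no image condition, as
  \<open>image_part UNIV\<close> is everything.\<close>

lemma image_kernel_within:
  assumes "downset index_poset T"
  shows "image_kernel {K \<in> carrier intervals. K \<subseteq> T} = group_kernel g T"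
proof
  fix a
  have "{K \<in> carrier intervals. K \<subseteq> T} = {K \<in> carrier intervals. start K \<subseteq> UNIV \<and> finish K \<subseteq> T}"
    by (simp add: finish_subset_iff[OF assms])
  then have "image_kernel {K \<in> carrier intervals. K \<subseteq> T} a = image_part UNIV a \<inter> group_kernel g T a"
    by (simp only: image_kernel_rect[OF downset_UNIV assms])
  also have "\<dots> = group_kernel g T a"
    using kernel_carrier[of T a] by (simp add: image_part_self Int_absorb1)
  finally show "image_kernel {K \<in> carrier intervals. K \<subseteq> T} a = group_kernel g T a" .
qed

section \<open>The generated homomorphism: joins, meets and interval factors\<close>

lemma image_kernel_closed: "image_kernel D \<in> carrier (group_sub g)"
  unfolding carrier_group_sub
proof (intro conjI allI impI)
  show "subgroup (image_kernel D a) (fst g a)" for a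
    unfolding image_kernel_span by (rule image_kernel.span_subgroup)
  fix a b assume ab: "(a::'i) \<le> b"
  let ?X = "\<lambda>a. \<Union>K\<in>D. image_kernel.cell a K"
  have "snd g a b ` image_kernel.cell a K \<subseteq> image_kernel.cell b K" for K
    using image_part_map[OF ab, of "start K"] kernel_map[OF ab, of "finish K"]
    unfolding image_kernel.cell_def by blast
  then have "snd g a b ` ?X a \<subseteq> ?X b" by (simp only: image_UN UN_mono[OF order_refl])
  then have "generate (fst g b) (snd g a b ` ?X a) \<subseteq> generate (fst g b) (?X b)"
    by (rule group.mono_generate[OF grp])
  then show "snd g a b ` image_kernel D a \<subseteq> image_kernel D b"
    unfolding image_kernel_span image_kernel.span_def
    using group_hom.generate_img[OF map_group_hom[OF ab] image_kernel.cells_carrier[of a D]] by simp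
qed

lemma image_kernel_Union: "image_kernel (\<Union>F) a = generate (fst g a) (\<Union>M\<in>image_kernel ` F. M a)"
proof
  show "image_kernel (\<Union>F) a \<subseteq> generate (fst g a) (\<Union>M\<in>image_kernel ` F. M a)"
    unfolding image_kernel_span[of "\<Union>F"]
  proof (rule image_kernel.span_least)
    show "subgroup (generate (fst g a) (\<Union>M\<in>image_kernel ` F. M a)) (fst g a)"
      by (rule group.generate_is_subgroup[OF grp])
        (use group_sub_subset[OF image_kernel_closed] in auto)
    fix K assume "K \<in> \<Union>F"
    then obtain D where D: "D \<in> F" "K \<in> D" by blast
    then have "image_kernel.cell a K \<subseteq> image_kernel D a"
      unfolding image_kernel_span by (intro image_kernel.cell_span)
    also have "\<dots> \<subseteq> generate (fst g a) (\<Union>M\<in>image_kernel ` F. M a)"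
      using D(1) by (auto intro: generate.incl)
    finally show "image_kernel.cell a K \<subseteq> generate (fst g a) (\<Union>M\<in>image_kernel ` F. M a)" .
  qed
  show "generate (fst g a) (\<Union>M\<in>image_kernel ` F. M a) \<subseteq> image_kernel (\<Union>F) a"
  proof (rule group.generate_subgroup_incl[OF grp _ group_sub_subgroup[OF image_kernel_closed]])
    have "image_kernel D a \<subseteq> image_kernel (\<Union>F) a" if "D \<in> F" for D
      unfolding image_kernel_span by (rule image_kernel.span_mono) (use that in blast)
    then show "(\<Union>M\<in>image_kernel ` F. M a) \<subseteq> image_kernel (\<Union>F) a" by auto
  qed
qed

lemma image_kernel_Inter:
  assumes "\<And>D. D \<in> F \<Longrightarrow> downset intervals D"
  shows "image_kernel (carrier intervals \<inter> \<Inter>F) a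
    = carrier (fst g a) \<inter> (\<Inter>M\<in>image_kernel ` F. M a)"
proof (cases "F = {}")
  \<comment> \<open>The empty meet is the full rectangle, where neither the image condition nor the
    kernel condition restricts anything.\<close>
  case True
  have "image_kernel {K \<in> carrier intervals. start K \<subseteq> UNIV \<and> finish K \<subseteq> UNIV} a
      = image_part UNIV a \<inter> group_kernel g UNIV a"
    by (rule image_kernel_rect[OF downset_UNIV downset_UNIV])
  moreover have "group_kernel g UNIV a = carrier (fst g a)" by (simp add: group_kernel_def)
  ultimately show ?thesis using True by (simp add: image_part_self)
next
  case False
  then obtain D where D: "D \<in> F" by blast
  have "carrier intervals \<inter> \<Inter>F = \<Inter>F" using assms[OF D] D by (auto simp: downset_def)
  then have "image_kernel (carrier intervals \<inter> \<Inter>F) a = (\<Inter>D\<in>F. image_kernel D a)"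
    unfolding image_kernel_span using image_kernel.span_Inter[OF False assms] by simp
  moreover have "(\<Inter>D\<in>F. image_kernel D a) \<subseteq> carrier (fst g a)"
    using D group_sub_subset[OF image_kernel_closed, of D a] by blast
  ultimately show ?thesis by auto
qed

text \<open>As \<open>a\<close> lies past the start of \<open>K\<close>, the index \<open>s\<close>
  from which \<open>y\<close> comes is at most \<open>a\<close>, so its source can be pushed to
  \<open>a\<close> first. An index from \<open>a\<close> on and outside \<open>finish K\<close> also
  comes after \<open>b\<close>, hence the lift dies wherever \<open>y\<close> does.\<close>

lemma image_kernel_cell_lift:
  assumes ab: "a \<le> b" and a: "a \<notin> start K" and b: "b \<in> finish K"
    and y: "y \<in> image_part (start K) b \<inter> group_kernel g (finish K) b"
  obtains x where "x \<in> image_part (start K) a \<inter> group_kernel g (finish K) a" "y = snd g a b x"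
proof -
  obtain s w where s: "s \<le> b" "{..<s} \<subseteq> start K" "w \<in> carrier (fst g s)" "y = snd g s b w"
    using y unfolding image_part_def by blast
  have sa: "s \<le> a" using s(2) a not_le by blast
  define x where "x = snd g s a w"
  have x: "x \<in> carrier (fst g a)" unfolding x_def by (rule map_closed[OF sa s(3)])
  have yx: "y = snd g a b x" unfolding x_def s(4) using map_map[OF sa ab s(3)] by simp
  have "x \<in> image_part (start K) a" using sa s(2,3) unfolding image_part_def x_def by blast
  moreover have "snd g a c x = \<one>\<^bsub>fst g c\<^esub>" if c: "a \<le> c" "c \<notin> finish K" for c
  proof -
    have "b \<le> c" using downset_finish[of K] b c(2) linear[of b c] unfolding downset_index_iff by blast
    then have "snd g a c x = snd g b c y" using map_map[OF ab _ x] yx by simp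
    then show ?thesis using y \<open>b \<le> c\<close> c(2) by (simp add: group_kernel_def)
  qed
  ultimately show ?thesis using that[of x] x yx by (simp add: group_kernel_def)
qed

text \<open>The image of a generated subgroup is generated by the images, so lifting the cells at
  \<open>b\<close> is enough. Cells of intervals that end before \<open>b\<close> are trivial there.
  The others lift by \<open>image_kernel_cell_lift\<close>, since
  \<open>start K \<subseteq> start J\<close> leaves \<open>a\<close> past their starts.\<close>

lemma image_kernel_sdown_lift:
  assumes ab: "a \<le> b" and J: "J \<in> carrier intervals" "a \<notin> start J"
  shows "image_kernel (sdown intervals J) b \<subseteq> snd g a b ` image_kernel (sdown intervals J) a"
proof -
  let ?D = "sdown intervals J"
  let ?X = "\<lambda>a. \<Union>K\<in>?D. image_kernel.cell a K"
  have img: "snd g a b ` image_kernel ?D a = generate (fst g b) (snd g a b ` ?X a)"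
    unfolding image_kernel_span image_kernel.span_def
    by (rule group_hom.generate_img[OF map_group_hom[OF ab] image_kernel.cells_carrier, symmetric])
  show ?thesis
    unfolding img unfolding image_kernel_span
  proof (rule image_kernel.span_least)
    show "subgroup (generate (fst g b) (snd g a b ` ?X a)) (fst g b)"
      unfolding img[symmetric]
      by (rule group_hom.subgroup_img_is_subgroup[OF map_group_hom[OF ab] group_sub_subgroup[OF image_kernel_closed]])
    fix K assume K: "K \<in> ?D"
    show "image_kernel.cell b K \<subseteq> generate (fst g b) (snd g a b ` ?X a)"
    proof
      fix y assume y: "y \<in> image_kernel.cell b K"
      show "y \<in> generate (fst g b) (snd g a b ` ?X a)"
      proof (cases "b \<in> finish K")
        case True
        have "a \<notin> start K" using K J by (auto simp: sdown_intervals_eq down_intervals_eq)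
        then obtain x where "x \<in> image_kernel.cell a K" "y = snd g a b x"
          using image_kernel_cell_lift[OF ab _ True] y unfolding image_kernel.cell_def by blast
        then show ?thesis using K by (intro generate.incl) blast
      next
        case False
        then have "y = \<one>\<^bsub>fst g b\<^esub>" using kernel_trivial[OF False, of y] y by (simp add: image_kernel.cell_def)
        then show ?thesis by (simp add: generate.one)
      qed
    qed
  qed
qed

lemma image_kernel_down:
  assumes "J \<in> carrier intervals"
  shows "image_kernel (down intervals J) a = image_part (start J) a \<inter> group_kernel g (finish J) a"
  unfolding down_intervals_eq[OF assms] by (rule image_kernel_rect[OF downset_start downset_finish])

lemma image_kernel_sdown_subset:
  assumes "J \<in> carrier intervals"
  shows "image_kernel (sdown intervals J) a \<subseteq> image_kernel (down intervals J) a"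
  unfolding image_kernel_span by (rule image_kernel.span_mono) (simp add: sdown_intervals_eq assms)

text \<open>After \<open>J\<close> the kernel is trivial. Before \<open>J\<close>, the interval from
  \<open>a\<close> to the end of \<open>J\<close> is strictly below \<open>J\<close>, as its start
  \<open>{..<a}\<close> misses \<open>a\<close>, and its cell at \<open>a\<close> is the whole
  kernel.\<close>

lemma image_kernel_vanish:
  assumes J: "J \<in> carrier intervals" and a: "a \<notin> J"
  shows "image_kernel (down intervals J) a \<subseteq> image_kernel (sdown intervals J) a"
proof
  fix x assume x: "x \<in> image_kernel (down intervals J) a"
  have one: "\<one>\<^bsub>fst g a\<^esub> \<in> image_kernel (sdown intervals J) a"
    by (simp add: image_kernel_def generate.one)
  show "x \<in> image_kernel (sdown intervals J) a"
  proof (cases "a \<in> finish J")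
    case False
    then show ?thesis using kernel_trivial[OF False, of x] x one by (simp add: image_kernel_down[OF J])
  next
    case True
    then have aS: "a \<in> start J" using a mem_interval_iff[OF J] by blast
    obtain K where K: "K \<in> carrier intervals" "start K = {..<a}" "finish K = finish J"
      using downset_interval[OF downset_finish True] .
    have "{..<a} \<subseteq> start J" using downset_start[of J] aS by (auto simp: downset_index_iff)
    moreover have "K \<noteq> J" using K(2) aS by auto
    ultimately have KJ: "K \<in> sdown intervals J"
      using K J by (simp add: sdown_intervals_eq down_intervals_eq)
    have "x \<in> image_part (start K) a" "x \<in> group_kernel g (finish K) a"
      using x K kernel_carrier[of "finish J" a] by (auto simp: image_kernel_down[OF J] image_part_self)
    then have "x \<in> image_kernel.cell a K" by (simp add: image_kernel.cell_def)
    then show ?thesis unfolding image_kernel_span by (rule subsetD[OF image_kernel.cell_span[OF KJ]])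
  qed
qed

text \<open>Injectivity of the structure maps on the factor. Lift the image of \<open>x\<close> to
  \<open>x'\<close> in the smaller subgroup at \<open>a\<close>. The quotient of \<open>x\<close> by
  \<open>x'\<close> dies at \<open>b\<close>, so it is generated by cells of intervals ending before
  \<open>b\<close>, and these intervals are strictly below \<open>J\<close> because \<open>b\<close>
  is in \<open>J\<close>.\<close>

lemma image_kernel_reflect:
  assumes J: "J \<in> carrier intervals" "a \<in> J" "b \<in> J" and ab: "a \<le> b"
    and x: "x \<in> image_kernel (down intervals J) a" "snd g a b x \<in> image_kernel (sdown intervals J) b"
  shows "x \<in> image_kernel (sdown intervals J) a"
proof -
  note sub = group_sub_subgroup[OF image_kernel_closed]
  have aJ: "a \<notin> start J" "b \<in> finish J" using J mem_interval_iff[OF J(1)] by blast+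
  obtain x' where x': "x' \<in> image_kernel (sdown intervals J) a" "snd g a b x = snd g a b x'"
    using subsetD[OF image_kernel_sdown_lift[OF ab J(1) aJ(1)] x(2)] by (elim imageE)
  define z where "z = inv\<^bsub>fst g a\<^esub> x' \<otimes>\<^bsub>fst g a\<^esub> x"
  have x'd: "x' \<in> image_kernel (down intervals J) a"
    by (rule subsetD[OF image_kernel_sdown_subset[OF J(1)] x'(1)])
  have c: "x \<in> carrier (fst g a)" "x' \<in> carrier (fst g a)"
    using x(1) x'd group_sub_subset[OF image_kernel_closed, of "down intervals J" a] by auto
  have "z \<in> image_kernel (down intervals J) a"
    unfolding z_def by (intro subgroup.m_closed[OF sub] subgroup.m_inv_closed[OF sub] x(1) x'd)
  then have zA: "z \<in> image_part (start J) a" "z \<in> carrier (fst g a)"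
    using kernel_carrier by (auto simp: image_kernel_down[OF J(1)])
  have zb: "snd g a b z = \<one>\<^bsub>fst g b\<^esub>"
  proof -
    interpret h: group_hom "fst g a" "fst g b" "snd g a b" by (rule map_group_hom[OF ab])
    show ?thesis using c x'(2) h.hom_closed[OF c(2)] by (simp add: z_def)
  qed
  \<comment> \<open>Dying at \<open>b\<close> already means dying at every later index, because the
    structure maps out of \<open>b\<close> preserve the unit.\<close>
  have "snd g a d z = \<one>\<^bsub>fst g d\<^esub>" if "a \<le> d" "d \<notin> {..<b}" for d
  proof -
    have bd: "b \<le> d" using that(2) by simp
    have "snd g a d z = snd g b d \<one>\<^bsub>fst g b\<^esub>" using map_map[OF ab bd zA(2)] zb by simp
    then show ?thesis using group_hom.hom_one[OF map_group_hom[OF bd]] by simp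
  qed
  then have "z \<in> group_kernel g {..<b} a" using zA(2) by (simp add: group_kernel_def)
  moreover have "image_part (start J) a \<inter> group_kernel g {..<b} a \<subseteq> image_kernel (sdown intervals J) a"
    unfolding image_kernel_span
  proof (rule image_kernel.fill_span[OF downset_start downset_lessThan])
    fix K assume K: "K \<in> carrier intervals" "start K \<subseteq> start J" "finish K \<subseteq> {..<b}"
    have "{..<b} \<subseteq> finish J" using downset_finish[of J] aJ(2) by (auto simp: downset_index_iff)
    moreover have "K \<noteq> J" using K(3) aJ(2) by auto
    ultimately show "K \<in> sdown intervals J" using K J by (auto simp: sdown_intervals_eq down_intervals_eq)
  qed
  ultimately have "z \<in> image_kernel (sdown intervals J) a" using zA(1) by blast
  then have "x' \<otimes>\<^bsub>fst g a\<^esub> z \<in> image_kernel (sdown intervals J) a"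
    by (rule subgroup.m_closed[OF sub x'(1)])
  moreover have "x' \<otimes>\<^bsub>fst g a\<^esub> z = x" using c by (simp add: z_def group.mult_inv_cancel_left[OF grp])
  ultimately show ?thesis by simp
qed

text \<open>The zero objects off \<open>J\<close> come from \<open>image_kernel_vanish\<close>. On
  \<open>J\<close>, injectivity is \<open>image_kernel_reflect\<close>, and surjectivity holds even
  before passing to cosets, by \<open>image_kernel_cell_lift\<close>.\<close>

lemma image_kernel_interval_diagram:
  assumes J: "J \<in> carrier intervals"
  shows "interval_diagram pointed_zero pointed_iso J
    (group_frac g (image_kernel (sdown intervals J)) (image_kernel (down intervals J)))"
  unfolding interval_diagram_def
proof (intro conjI allI ballI impI)
  let ?N = "image_kernel (sdown intervals J)" and ?M = "image_kernel (down intervals J)"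
  have NC: "?N \<in> carrier (group_sub g)" and MC: "?M \<in> carrier (group_sub g)"
    by (rule image_kernel_closed)+
  show "pointed_zero (fst (group_frac g ?N ?M) a)" if "a \<notin> J" for a
  proof -
    have "x <#\<^bsub>fst g a\<^esub> ?N a = ?N a" if "x \<in> ?M a" for x
      by (rule group.l_coset_absorb[OF grp group_sub_subgroup[OF NC]])
        (rule subsetD[OF image_kernel_vanish[OF J \<open>a \<notin> J\<close>] that])
    moreover have "?M a \<noteq> {}" using subgroup.one_closed[OF group_sub_subgroup[OF MC]] by blast
    ultimately have "(\<lambda>x. x <#\<^bsub>fst g a\<^esub> ?N a) ` ?M a = {?N a}" by auto
    then show ?thesis by (simp add: pointed_zero_def group_frac_def)
  qed
  fix a b assume a: "a \<in> J" and b: "b \<in> J" and ab: "a \<le> b"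
  interpret coset_map "fst g a" "fst g b" "snd g a b" "?N a" "?N b"
    by (rule coset_map_structure[OF NC ab])
  have aJ: "a \<notin> start J" "b \<in> finish J" using a b mem_interval_iff[OF J] by blast+
  have "bij_betw (\<lambda>C. (snd g a b ` C) <#>\<^bsub>fst g b\<^esub> ?N b)
      ((\<lambda>x. x <#\<^bsub>fst g a\<^esub> ?N a) ` ?M a) ((\<lambda>x. x <#\<^bsub>fst g b\<^esub> ?N b) ` ?M b)"
  proof (rule coset_map_bij[OF group_sub_subgroup[OF MC] group_sub_map[OF MC ab]])
    show "x \<in> ?N a" if "x \<in> ?M a" "snd g a b x \<in> ?N b" for x
      by (rule image_kernel_reflect[OF J a b ab that])
    fix y assume y: "y \<in> ?M b"
    then obtain x where x: "x \<in> ?M a" "y = snd g a b x"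
      using image_kernel_cell_lift[OF ab aJ] unfolding image_kernel_down[OF J] by metis
    have "y \<in> carrier (fst g b)" using y group_sub_subset[OF MC] by blast
    then have "y = snd g a b x \<otimes>\<^bsub>fst g b\<^esub> \<one>\<^bsub>fst g b\<^esub>" using x(2) by simp
    then show "\<exists>x\<in>?M a. \<exists>p\<in>?N b. y = snd g a b x \<otimes>\<^bsub>fst g b\<^esub> p"
      using x(1) subgroup.one_closed[OF group_sub_subgroup[OF NC]] by blast
  qed
  moreover have "snd (group_frac g ?N ?M) a b (point (fst (group_frac g ?N ?M) a))
      = point (fst (group_frac g ?N ?M) b)"
    using map_coset[OF NC ab, of "\<one>\<^bsub>fst g a\<^esub>" ?M] group_hom.hom_one[OF map_group_hom[OF ab]]
    by (simp add: point_group_frac[OF NC])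
  ultimately show "pointed_iso (fst (group_frac g ?N ?M) a) (fst (group_frac g ?N ?M) b)
      (snd (group_frac g ?N ?M) a b)"
    unfolding pointed_iso_def carrier_group_frac by (simp add: group_frac_def)
qed

text \<open>\<open>sup_pres\<close> and \<open>inf_pres\<close> include completeness of both
  lattices. It is a premise here because every given CDI homomorphism supplies it.\<close>

lemma image_kernel_cdi_hom:
  assumes lat: "complete_lattice (downset_lattice (intervals :: 'i set gorder))"
    and latg: "complete_lattice (group_sub g)"
  shows "group_cdi_hom g image_kernel"
  unfolding group_cdi_hom_def cdi_hom_def
proof (intro conjI ballI)
  have F: "\<And>D. D \<in> F \<Longrightarrow> downset intervals D"
    if "F \<subseteq> carrier (downset_lattice (intervals :: 'i set gorder))" for F :: "'i set set set"
    using that by auto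
  have img: "image_kernel ` F \<subseteq> carrier (group_sub g)" for F
    by (rule image_subsetI) (rule image_kernel_closed)
  show "image_kernel \<in> carrier (downset_lattice intervals) \<rightarrow> carrier (group_sub g)"
    by (rule funcsetI) (rule image_kernel_closed)
  show "sup_pres (downset_lattice intervals) (group_sub g) image_kernel"
    unfolding sup_pres_def
  proof (intro conjI allI impI lat latg)
    fix X assume "X \<subseteq> carrier (downset_lattice (intervals :: 'i set gorder))"
    then show "image_kernel (\<Squnion>\<^bsub>downset_lattice intervals\<^esub> X) = \<Squnion>\<^bsub>group_sub g\<^esub> (image_kernel ` X)"
      by (simp only: downset_lattice_sup[OF F] group_sub_sup[OF img] image_kernel_Union fun_eq_iff simp_thms)
  qed
  show "inf_pres (downset_lattice intervals) (group_sub g) image_kernel"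
    unfolding inf_pres_def
  proof (intro conjI allI impI lat latg)
    fix X assume "X \<subseteq> carrier (downset_lattice (intervals :: 'i set gorder))"
    then show "image_kernel (\<Sqinter>\<^bsub>downset_lattice intervals\<^esub> X) = \<Sqinter>\<^bsub>group_sub g\<^esub> (image_kernel ` X)"
      by (simp only: downset_lattice_inf[OF F] group_sub_inf[OF img] image_kernel_Inter[OF F] fun_eq_iff simp_thms)
  qed
  show "interval_diagram pointed_zero pointed_iso J
      (group_frac g (image_kernel (sdown intervals J)) (image_kernel (down intervals J)))"
    if "J \<in> carrier intervals" for J
    by (rule image_kernel_interval_diagram[OF that])
qed

text \<open>Under the uniqueness alternative, \<open>image_kernel\<close> is another solution, so it
  agrees with \<open>\<Psi>\<close> on down-sets and hands over its own compatibility with kernels.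
  The completeness needed to call it a solution is read off from \<open>\<Psi>\<close>.\<close>

lemma saecular_kernel:
  assumes "group_saecular_cdi g \<Psi>" and T: "downset index_poset T"
  shows "\<Psi> {K \<in> carrier intervals. K \<subseteq> T} = group_kernel g T"
proof -
  have cdi: "group_cdi_hom g \<Psi>" using assms(1) by (simp add: group_saecular_cdi_def)
  consider "\<forall>\<Omega>'. group_cdi_hom g \<Omega>' \<longrightarrow> (\<forall>D\<in>carrier (downset_lattice intervals). \<Omega>' D = \<Psi> D)"
    | "\<forall>T. downset index_poset T \<longrightarrow> \<Psi> {J \<in> carrier intervals. J \<subseteq> T} = group_kernel g T"
    using assms(1) unfolding group_saecular_cdi_def by blast
  then show ?thesis
  proof cases
    case 1
    have "complete_lattice (downset_lattice (intervals :: 'i set gorder))" "complete_lattice (group_sub g)"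
      using cdi unfolding group_cdi_hom_def cdi_hom_def sup_pres_def by simp_all
    then have "group_cdi_hom g image_kernel" by (rule image_kernel_cdi_hom)
    moreover have "downset intervals {K \<in> carrier intervals. K \<subseteq> T}"
      using downset_rect[of UNIV T] by (simp add: finish_subset_iff[OF T])
    ultimately have "image_kernel {K \<in> carrier intervals. K \<subseteq> T} = \<Psi> {K \<in> carrier intervals. K \<subseteq> T}"
      using 1 by simp
    then show ?thesis using image_kernel_within[OF T] by simp
  next
    case 2
    then show ?thesis using T by simp
  qed
qed

end

section \<open>Comparison of the factors for groups\<close>

lemma subsaecular_series_eq:
  assumes "linearization intervals lam" "J \<in> carrier intervals"
  shows "subsaecular_series \<Omega> lam (down lam J) = \<Omega> (down lam J)"
    and "subsaecular_series \<Omega> lam (sdown lam J) = \<Omega> (sdown lam J)"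
  using linearization_down(3,4)[OF assms] by (simp_all add: subsaecular_series_def)

context group_diagram
begin

text \<open>Both conditions of \<open>inc_diagram_iso\<close> come from the diamond: the
  intersection from preservation of meets, the product from \<open>group_cdi_product\<close> with
  \<open>E = down lam J\<close>.\<close>

lemma factor_inc_iso:
  assumes \<Psi>: "group_saecular_cdi g \<Psi>" and lin: "linearization intervals lam" and J: "J \<in> carrier intervals"
  shows "diagram_iso pointed_iso
    (group_frac g (\<Psi> (sdown intervals J)) (\<Psi> (down intervals J)))
    (group_frac g (\<Psi> (sdown lam J)) (\<Psi> (down lam J))) (group_inc g (\<Psi> (sdown lam J)))"
    (is ?inc)
    and "\<exists>\<eta>. canonical_iso (group_sub g) (group_frac g) pointed_iso (group_inc g)
      (\<Psi> (sdown lam J)) (\<Psi> (down lam J)) (\<Psi> (sdown intervals J)) (\<Psi> (down intervals J)) \<eta>"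
proof -
  have cdi: "group_cdi_hom g \<Psi>" using \<Psi> by (simp add: group_saecular_cdi_def)
  note L = linearization_down[OF lin J]
  note dD = downset_down[OF J] and dS = downset_sdown[OF J]
  note closed = group_cdi_closed[OF cdi L(2)] group_cdi_closed[OF cdi dS]
    group_cdi_closed[OF cdi L(1)] group_cdi_closed[OF cdi dD]
  have N: "\<Psi> (sdown intervals J) \<le> \<Psi> (sdown lam J)"
    by (rule le_funI) (rule group_cdi_mono[OF cdi dS L(2)], use L(8) in blast)
  have M: "\<Psi> (down intervals J) \<le> \<Psi> (down lam J)"
    by (rule le_funI) (rule group_cdi_mono[OF cdi dD L(1)], use L(7) in blast)
  show inc: ?inc
  proof (rule inc_diagram_iso[OF closed(1,2) N closed(3,4) M])
    fix a
    show "\<Psi> (sdown lam J) a \<inter> \<Psi> (down intervals J) a \<subseteq> \<Psi> (sdown intervals J) a"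
      using group_cdi_Int[OF cdi dD L(2), of a] unfolding L(8) by (simp add: Int_commute)
    show "\<Psi> (down lam J) a \<subseteq> \<Psi> (down intervals J) a <#>\<^bsub>fst g a\<^esub> \<Psi> (sdown lam J) a"
      using group_cdi_product[OF cdi saecular_kernel[OF \<Psi>] L(1,6) L(2)[unfolded L(5)]]
      unfolding L(5) .
  qed
  show "\<exists>\<eta>. canonical_iso (group_sub g) (group_frac g) pointed_iso (group_inc g)
      (\<Psi> (sdown lam J)) (\<Psi> (down lam J)) (\<Psi> (sdown intervals J)) (\<Psi> (down intervals J)) \<eta>"
    by (rule group_canonical_iso[OF closed(1,2) N closed(3,4) M inc])
qed

end

lemma pointed_iso_closed: "\<lbrakk>pointed_iso P Q h; x \<in> carrier P\<rbrakk> \<Longrightarrow> h x \<in> carrier Q"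
  unfolding pointed_iso_def using bij_betwE by fast

lemma pointed_iso_comp: "\<lbrakk>pointed_iso P Q h; pointed_iso Q S k\<rbrakk> \<Longrightarrow> pointed_iso P S (k \<circ> h)"
  unfolding pointed_iso_def using bij_betw_trans by auto

subsection \<open>Diagrams of modules\<close>

lemma module_iso_closed: "\<lbrakk>module_iso R P Q h; x \<in> carrier P\<rbrakk> \<Longrightarrow> h x \<in> carrier Q"
  unfolding module_iso_def using bij_betwE by fast

lemma module_iso_comp:
  assumes h: "module_iso R P Q h" and k: "module_iso R Q S k"
  shows "module_iso R P S (k \<circ> h)"
  using bij_betw_trans[of h "carrier P" "carrier Q" k "carrier S"] h k module_iso_closed[OF h]
  unfolding module_iso_def module_hom_def by (auto simp: hom_def)

text \<open>\<open>P\<close> is a mere record here, so closure under its operations is assumed; for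
  quotients \<open>module_frac_closed\<close> provides it.\<close>

lemma module_iso_inv:
  assumes h: "module_iso R P Q h"
    and add: "\<And>x y. \<lbrakk>x \<in> carrier P; y \<in> carrier P\<rbrakk> \<Longrightarrow> x \<oplus>\<^bsub>P\<^esub> y \<in> carrier P"
    and smult: "\<And>r x. \<lbrakk>r \<in> carrier R; x \<in> carrier P\<rbrakk> \<Longrightarrow> r \<odot>\<^bsub>P\<^esub> x \<in> carrier P"
  shows "module_iso R Q P (inv_into (carrier P) h)"
proof -
  let ?k = "inv_into (carrier P) h"
  have bij: "bij_betw h (carrier P) (carrier Q)" using h by (simp add: module_iso_def)
  have h_add: "h (x \<oplus>\<^bsub>P\<^esub> y) = h x \<oplus>\<^bsub>Q\<^esub> h y" if "x \<in> carrier P" "y \<in> carrier P" for x y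
    using h that by (simp add: module_iso_def module_hom_def hom_def)
  have h_smult: "h (r \<odot>\<^bsub>P\<^esub> x) = r \<odot>\<^bsub>Q\<^esub> h x" if "r \<in> carrier R" "x \<in> carrier P" for r x
    using h that by (simp add: module_iso_def module_hom_def)
  have k: "?k y \<in> carrier P" "h (?k y) = y" if "y \<in> carrier Q" for y
    using that bij by (simp_all add: bij_betw_def inv_into_into f_inv_into_f)
  have kh: "?k (h x) = x" if "x \<in> carrier P" for x using bij_betw_inv_into_left[OF bij that] .
  have "?k (y \<oplus>\<^bsub>Q\<^esub> z) = ?k y \<oplus>\<^bsub>P\<^esub> ?k z" if "y \<in> carrier Q" "z \<in> carrier Q" for y z
    using kh[OF add[OF k(1) k(1)], OF that] h_add[OF k(1) k(1), OF that] k(2) that by simp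
  moreover have "?k (r \<odot>\<^bsub>Q\<^esub> y) = r \<odot>\<^bsub>P\<^esub> ?k y" if "r \<in> carrier R" "y \<in> carrier Q" for r y
    using kh[OF smult[OF that(1) k(1)], OF that(2)] h_smult[OF that(1) k(1), OF that(2)] k(2) that
    by simp
  ultimately show ?thesis
    using bij_betw_inv_into[OF bij] k(1) by (simp add: module_iso_def module_hom_def hom_def)
qed

text \<open>The group of \<open>add_monoid M\<close>, repackaged at type \<open>'g monoid\<close>,
  over which diagrams of groups are formed.\<close>

definition additive_group :: "('r, 'g) module \<Rightarrow> 'g monoid" where
  "additive_group M = \<lparr>carrier = carrier M, mult = (\<oplus>\<^bsub>M\<^esub>), one = \<zero>\<^bsub>M\<^esub>\<rparr>"

lemma additive_group_simps [simp]:
  "carrier (additive_group M) = carrier M" "x \<otimes>\<^bsub>additive_group M\<^esub> y = x \<oplus>\<^bsub>M\<^esub> y"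
  "\<one>\<^bsub>additive_group M\<^esub> = \<zero>\<^bsub>M\<^esub>" "inv\<^bsub>additive_group M\<^esub> x = inv\<^bsub>add_monoid M\<^esub> x"
  by (simp_all add: additive_group_def m_inv_def)

lemma additive_group_comm: "abelian_group M \<Longrightarrow> comm_group (additive_group M)"
proof -
  assume "abelian_group M"
  then have c: "comm_group (add_monoid M)" by (rule abelian_group.a_comm_group)
  show ?thesis
    using comm_group.axioms[OF c] unfolding comm_group_def comm_monoid_def comm_monoid_axioms_def
      group_def group_axioms_def monoid_def Units_def by simp
qed

lemma subgroup_additive_group: "subgroup H (additive_group M) \<longleftrightarrow> subgroup H (add_monoid M)"
  by (simp add: subgroup_def)

lemma l_coset_additive_group: "l_coset (additive_group M) = a_l_coset M"
  by (simp add: fun_eq_iff a_l_coset_def l_coset_def)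

lemma set_mult_additive_group: "set_mult (additive_group M) = set_add M"
  by (simp add: fun_eq_iff set_add_def set_mult_def)

text \<open>\<open>unital_action\<close> is the common part of \<open>left_module\<close> and
  \<open>right_module\<close>, so one argument serves both sides.\<close>

locale module_diagram =
  fixes R :: "('r, 's) ring_scheme" and f :: "('i::wellorder, ('r, 'g) module, 'g) diagram"
  assumes is_module_diagram: "is_diagram (unital_action R) (module_hom R) f"
begin

abbreviation additive :: "('i, 'g monoid, 'g) diagram" where
  "additive \<equiv> (\<lambda>a. additive_group (fst f a), snd f)"

lemma action: "unital_action R (fst f a)"
  and map_module_hom: "a \<le> b \<Longrightarrow> module_hom R (fst f a) (fst f b) (snd f a b)"
  using is_module_diagram by (simp_all add: is_diagram_def)

lemma abelian: "abelian_group (fst f a)"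
  by (rule unital_action.axioms(2)[OF action])

lemma comm: "comm_group (additive_group (fst f a))"
  by (rule additive_group_comm[OF abelian])

sublocale additive: group_diagram additive
proof
  show "is_diagram group (\<lambda>G H h. h \<in> hom G H) additive"
    using is_module_diagram comm_group.axioms(2)[OF comm]
    by (simp add: is_diagram_def module_hom_def hom_def)
qed

section \<open>Submodules and their quotients\<close>

lemma carrier_module_sub:
  "N \<in> carrier (module_sub R f) \<longleftrightarrow>
    (\<forall>a. submodule (N a) R (fst f a)) \<and> (\<forall>a b. a \<le> b \<longrightarrow> snd f a b ` N a \<subseteq> N b)"
  by (simp add: module_sub_def subdiagrams_def)

lemma module_sub_le: "N \<sqsubseteq>\<^bsub>module_sub R f\<^esub> M \<longleftrightarrow> N \<le> M"
  by (simp add: module_sub_def subdiagrams_def)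

lemma module_sub_additive:
  "N \<in> carrier (module_sub R f) \<Longrightarrow> N \<in> carrier (group_sub additive)"
  unfolding carrier_module_sub additive.carrier_group_sub
  by (auto simp: subgroup_additive_group intro: submodule.axioms(1))

lemma module_sub_smult:
  "\<lbrakk>N \<in> carrier (module_sub R f); r \<in> carrier R; x \<in> N a\<rbrakk> \<Longrightarrow> r \<odot>\<^bsub>fst f a\<^esub> x \<in> N a"
  unfolding carrier_module_sub by (auto intro: submodule.smult_closed)

text \<open>Fractions of modules have the same cosets and the same maps as those of the additive
  groups. Bijectivity and naturality therefore carry over, and only linearity has to be
  added.\<close>

lemma module_frac_additive:
  "carrier (fst (module_frac f N M) a) = carrier (fst (group_frac additive N M) a)"
  "snd (module_frac f N M) = snd (group_frac additive N M)"
  "module_inc f N = group_inc additive N"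
  by (simp_all add: module_frac_def module_quot_def group_frac_def module_inc_def group_inc_def
      l_coset_additive_group set_mult_additive_group fun_eq_iff)

lemma carrier_module_frac:
  "carrier (fst (module_frac f N M) a) = (\<lambda>x. x <+\<^bsub>fst f a\<^esub> N a) ` M a"
  by (simp add: module_frac_def module_quot_def)

lemma coset_add:
  assumes "N \<in> carrier (module_sub R f)" "x \<in> carrier (fst f a)" "y \<in> carrier (fst f a)"
  shows "(x <+\<^bsub>fst f a\<^esub> N a) \<oplus>\<^bsub>fst (module_frac f N M) a\<^esub> (y <+\<^bsub>fst f a\<^esub> N a)
    = (x \<oplus>\<^bsub>fst f a\<^esub> y) <+\<^bsub>fst f a\<^esub> N a"
proof -
  let ?G = "additive_group (fst f a)"
  interpret comm_group ?G by (rule comm)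
  have n: "N a \<lhd> ?G"
    using subgroup_imp_normal additive.group_sub_subgroup[OF module_sub_additive[OF assms(1)], of a]
    by simp
  have c: "z <#\<^bsub>?G\<^esub> N a = N a #>\<^bsub>?G\<^esub> z" if "z \<in> carrier (fst f a)" for z
    using normal.coset_eq[OF n] that by simp
  have xy: "x \<otimes>\<^bsub>?G\<^esub> y \<in> carrier ?G" by (rule m_closed) (use assms in simp_all)
  have "(x <#\<^bsub>?G\<^esub> N a) <#>\<^bsub>?G\<^esub> (y <#\<^bsub>?G\<^esub> N a) = (x \<otimes>\<^bsub>?G\<^esub> y) <#\<^bsub>?G\<^esub> N a"
    using normal.rcos_sum[OF n, of x y] assms(2,3) xy by (simp add: c)
  then show ?thesis
    by (simp add: module_frac_def module_quot_def l_coset_additive_group set_mult_additive_group)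
qed

text \<open>Multiplication by \<open>r\<close> is an additive endomorphism that maps
  \<open>N a\<close> into itself, hence another \<open>coset_map\<close>.\<close>

lemma coset_smult:
  assumes N: "N \<in> carrier (module_sub R f)" and r: "r \<in> carrier R" and x: "x \<in> carrier (fst f a)"
  shows "r \<odot>\<^bsub>fst (module_frac f N M) a\<^esub> (x <+\<^bsub>fst f a\<^esub> N a) = (r \<odot>\<^bsub>fst f a\<^esub> x) <+\<^bsub>fst f a\<^esub> N a"
proof -
  let ?G = "additive_group (fst f a)"
  have "coset_map ?G ?G (\<lambda>x. r \<odot>\<^bsub>fst f a\<^esub> x) (N a) (N a)"
  proof (intro coset_map.intro coset_map_axioms.intro)
    show "group ?G" "group ?G" using comm by (simp_all add: comm_group_def)
    show "(\<lambda>x. r \<odot>\<^bsub>fst f a\<^esub> x) \<in> hom ?G ?G"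
      using unital_action.smult_closed[OF action r] unital_action.smult_r_distr[OF action r]
      by (simp add: hom_def)
    show "subgroup (N a) ?G" "subgroup (N a) ?G"
      using additive.group_sub_subgroup[OF module_sub_additive[OF N], of a] by simp_all
    show "(\<lambda>x. r \<odot>\<^bsub>fst f a\<^esub> x) ` N a \<subseteq> N a"
      by (rule image_subsetI) (rule module_sub_smult[OF N r])
  qed
  from coset_map.coset_map_eq[OF this, of x] x show ?thesis
    by (simp add: module_frac_def module_quot_def l_coset_additive_group set_mult_additive_group)
qed

lemma module_sub_subset: "N \<in> carrier (module_sub R f) \<Longrightarrow> N a \<subseteq> carrier (fst f a)"
  using additive.group_sub_subset[OF module_sub_additive, of N a] by simp

lemma module_sub_add:
  "\<lbrakk>N \<in> carrier (module_sub R f); x \<in> N a; y \<in> N a\<rbrakk> \<Longrightarrow> x \<oplus>\<^bsub>fst f a\<^esub> y \<in> N a"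
  using subgroup.m_closed[OF additive.group_sub_subgroup[OF module_sub_additive, of N a]] by simp

lemma module_frac_closed:
  assumes N: "N \<in> carrier (module_sub R f)" and M: "M \<in> carrier (module_sub R f)"
    and C: "C \<in> carrier (fst (module_frac f N M) a)"
  shows "D \<in> carrier (fst (module_frac f N M) a) \<Longrightarrow>
      C \<oplus>\<^bsub>fst (module_frac f N M) a\<^esub> D \<in> carrier (fst (module_frac f N M) a)"
    and "r \<in> carrier R \<Longrightarrow> r \<odot>\<^bsub>fst (module_frac f N M) a\<^esub> C \<in> carrier (fst (module_frac f N M) a)"
proof -
  obtain x where x: "x \<in> M a" "C = x <+\<^bsub>fst f a\<^esub> N a" using C unfolding carrier_module_frac by blast
  have xc: "x \<in> carrier (fst f a)" by (rule subsetD[OF module_sub_subset[OF M] x(1)])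
  show "r \<odot>\<^bsub>fst (module_frac f N M) a\<^esub> C \<in> carrier (fst (module_frac f N M) a)" if r: "r \<in> carrier R"
    unfolding x(2) coset_smult[OF N r xc] carrier_module_frac
    by (rule imageI) (rule module_sub_smult[OF M r x(1)])
  assume "D \<in> carrier (fst (module_frac f N M) a)"
  then obtain y where y: "y \<in> M a" "D = y <+\<^bsub>fst f a\<^esub> N a" unfolding carrier_module_frac by blast
  have yc: "y \<in> carrier (fst f a)" by (rule subsetD[OF module_sub_subset[OF M] y(1)])
  show "C \<oplus>\<^bsub>fst (module_frac f N M) a\<^esub> D \<in> carrier (fst (module_frac f N M) a)"
    unfolding x(2) y(2) coset_add[OF N xc yc] carrier_module_frac
    by (rule imageI) (rule module_sub_add[OF M x(1) y(1)])
qed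

lemma module_inc_diagram_iso:
  assumes N: "N \<in> carrier (module_sub R f)" "N' \<in> carrier (module_sub R f)" "N' \<le> N"
    and M: "M \<in> carrier (module_sub R f)" "M' \<in> carrier (module_sub R f)" "M' \<le> M"
    and inc: "diagram_iso pointed_iso (group_frac additive N' M') (group_frac additive N M)
      (group_inc additive N)"
  shows "diagram_iso (module_iso R) (module_frac f N' M') (module_frac f N M) (module_inc f N)"
  unfolding diagram_iso_def
proof (intro conjI allI impI ballI)
  fix a b C assume "(a::'i) \<le> b" "C \<in> carrier (fst (module_frac f N' M') a)"
  then show "module_inc f N b (snd (module_frac f N' M') a b C)
      = snd (module_frac f N M) a b (module_inc f N a C)"
    using inc unfolding diagram_iso_def module_frac_additive by simp
next
  fix a
  let ?P = "fst (module_frac f N' M') a" and ?Q = "fst (module_frac f N M) a"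
  have bij: "bij_betw (module_inc f N a) (carrier ?P) (carrier ?Q)"
    using inc unfolding diagram_iso_def module_frac_additive by (simp add: pointed_iso_def)
  have N'N: "N' a \<subseteq> N a" using N(3) by (simp add: le_fun_def)
  have inc_coset: "module_inc f N a (x <+\<^bsub>fst f a\<^esub> N' a) = x <+\<^bsub>fst f a\<^esub> N a"
    if "x \<in> carrier (fst f a)" for x
    using additive.inc_coset[where a = a, OF module_sub_additive[OF N(1)] module_sub_additive[OF N(2)] N'N] that
    by (simp add: module_frac_additive l_coset_additive_group)
  have coset: "\<exists>x\<in>carrier (fst f a). C = x <+\<^bsub>fst f a\<^esub> N' a" if "C \<in> carrier ?P" for C
    using that module_sub_subset[OF M(2), of a] unfolding carrier_module_frac by blast
  have "module_hom R ?P ?Q (module_inc f N a)"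
    unfolding module_hom_def
  proof (intro conjI ballI homI)
    fix C assume "C \<in> carrier (add_monoid ?P)"
    then have C: "C \<in> carrier ?P" by simp
    then obtain x where x: "x \<in> carrier (fst f a)" "C = x <+\<^bsub>fst f a\<^esub> N' a" using coset by blast
    have "module_inc f N a C \<in> carrier ?Q" using bij_betwE[OF bij] C by blast
    then show "module_inc f N a C \<in> carrier (add_monoid ?Q)" by simp
    fix D assume "D \<in> carrier (add_monoid ?P)"
    then obtain y where y: "y \<in> carrier (fst f a)" "D = y <+\<^bsub>fst f a\<^esub> N' a" using coset by auto
    have "x \<oplus>\<^bsub>fst f a\<^esub> y \<in> carrier (fst f a)"
      by (rule abelian_monoid.a_closed[OF abelian_group.axioms(1)[OF abelian] x(1) y(1)])
    then have "module_inc f N a (C \<oplus>\<^bsub>?P\<^esub> D) = module_inc f N a C \<oplus>\<^bsub>?Q\<^esub> module_inc f N a D"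
      unfolding x(2) y(2) coset_add[OF N(2) x(1) y(1)] inc_coset[OF x(1)] inc_coset[OF y(1)]
        coset_add[OF N(1) x(1) y(1)] by (rule inc_coset)
    then show "module_inc f N a (C \<otimes>\<^bsub>add_monoid ?P\<^esub> D)
        = module_inc f N a C \<otimes>\<^bsub>add_monoid ?Q\<^esub> module_inc f N a D" by simp
  next
    fix r C assume r: "r \<in> carrier R" and "C \<in> carrier ?P"
    then obtain x where x: "x \<in> carrier (fst f a)" "C = x <+\<^bsub>fst f a\<^esub> N' a" using coset by blast
    show "module_inc f N a (r \<odot>\<^bsub>?P\<^esub> C) = r \<odot>\<^bsub>?Q\<^esub> module_inc f N a C"
      unfolding x(2) coset_smult[OF N(2) r x(1)] inc_coset[OF x(1)] coset_smult[OF N(1) r x(1)]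
      by (rule inc_coset[OF unital_action.smult_closed[OF action r x(1)]])
  qed
  then show "module_iso R ?P ?Q (module_inc f N a)" using bij by (simp add: module_iso_def)
qed

lemma module_inc_self_diagram_iso:
  assumes "N \<in> carrier (module_sub R f)" "M \<in> carrier (module_sub R f)"
  shows "diagram_iso (module_iso R) (module_frac f N M) (module_frac f N M) (module_inc f N)"
  by (rule module_inc_diagram_iso[OF assms(1,1) order_refl assms(2,2) order_refl
        additive.inc_self_diagram_iso[OF module_sub_additive module_sub_additive, OF assms]])

lemma module_canonical_iso:
  assumes N: "N \<in> carrier (module_sub R f)" "N' \<in> carrier (module_sub R f)" "N' \<le> N"
    and M: "M \<in> carrier (module_sub R f)" "M' \<in> carrier (module_sub R f)" "M' \<le> M"
    and inc: "diagram_iso (module_iso R) (module_frac f N' M') (module_frac f N M) (module_inc f N)"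
  shows "\<exists>\<eta>. canonical_iso (module_sub R f) (module_frac f) (module_iso R) (module_inc f) N M N' M' \<eta>"
proof -
  note add = module_sub_additive
  have iso: "module_iso R (fst (module_frac f N' M') a) (fst (module_frac f N M) a) (module_inc f N a)" for a
    using inc unfolding diagram_iso_def by simp
  then have bij: "bij_betw (module_inc f N a) (carrier (fst (module_frac f N' M') a))
      (carrier (fst (module_frac f N M) a))" for a
    unfolding module_iso_def by simp
  have inv: "module_iso R (fst (module_frac f N M) a) (fst (module_frac f N' M') a)
      (inv_into (carrier (fst (module_frac f N' M') a)) (module_inc f N a))" for a
    by (rule module_iso_inv[OF iso module_frac_closed[OF N(2) M(2)]])
  have self: "module_inc f N a C = C"
    if "N \<in> carrier (module_sub R f)" "M \<in> carrier (module_sub R f)" "C \<in> carrier (fst (module_frac f N M) a)"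
    for N M a C
    using additive.inc_self[OF add add, OF that(1,2)] that(3) unfolding module_frac_additive .
  have struct: "snd (module_frac f N' M') a b C \<in> carrier (fst (module_frac f N' M') b)"
    if "a \<le> b" "C \<in> carrier (fst (module_frac f N' M') a)" for a b C
    using additive.map_coset_closed[OF add[OF N(2)] add[OF M(2)] that(1)] that(2)
    unfolding module_frac_additive .
  from canonical_isoI[where Frac = "module_frac f" and Inc = "module_inc f" and Iso = "module_iso R"
      and N = N and N' = N' and M = M and M' = M', OF N[unfolded module_sub_def] M[unfolded module_sub_def]
      inc bij inv module_inc_self_diagram_iso[OF N(2) M(2)] self[OF N(2) M(2)]
      module_inc_self_diagram_iso[OF N(1) M(1)] self[OF N(1) M(1)] struct]
  show ?thesis unfolding module_sub_def by blast
qed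

text \<open>Sums of two submodules are already submodules, so a binary join consists of sums with
  just two terms. This takes the place of \<open>group_cdi_product\<close>.\<close>

lemma module_sub_sup:
  assumes X: "X \<in> carrier (module_sub R f)" and Y: "Y \<in> carrier (module_sub R f)"
  shows "\<Squnion>\<^bsub>module_sub R f\<^esub> {X, Y} = (\<lambda>a. X a <+>\<^bsub>fst f a\<^esub> Y a)"
proof (rule sup_eqI)
  let ?S = "\<lambda>a. X a <+>\<^bsub>fst f a\<^esub> Y a"
  have S: "?S a = {x \<oplus>\<^bsub>fst f a\<^esub> y | x y. x \<in> X a \<and> y \<in> Y a}" for a
    by (auto simp: set_add_def set_mult_def)
  have zero: "\<zero>\<^bsub>fst f a\<^esub> \<in> N a" if "N \<in> carrier (module_sub R f)" for N a
    using subgroup.one_closed[OF additive.group_sub_subgroup[OF module_sub_additive[OF that], of a]] by simp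
  show "least (module_sub R f) ?S (Upper (module_sub R f) {X, Y})"
  proof (rule least_UpperI)
    have "X a \<subseteq> ?S a" "Y a \<subseteq> ?S a" for a
    proof -
      interpret abelian_group "fst f a" by (rule abelian)
      show "X a \<subseteq> ?S a"
      proof
        fix x assume x: "x \<in> X a"
        then have "x = x \<oplus>\<^bsub>fst f a\<^esub> \<zero>\<^bsub>fst f a\<^esub>" using module_sub_subset[OF X, of a] by auto
        then show "x \<in> ?S a" unfolding S using x zero[OF Y] by blast
      qed
      show "Y a \<subseteq> ?S a"
      proof
        fix y assume y: "y \<in> Y a"
        then have "y = \<zero>\<^bsub>fst f a\<^esub> \<oplus>\<^bsub>fst f a\<^esub> y" using module_sub_subset[OF Y, of a] by auto
        then show "y \<in> ?S a" unfolding S using y zero[OF X] by blast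
      qed
    qed
    then show "Z \<sqsubseteq>\<^bsub>module_sub R f\<^esub> ?S" if "Z \<in> {X, Y}" for Z
      using that by (auto simp: module_sub_le le_fun_def)
    show "?S \<sqsubseteq>\<^bsub>module_sub R f\<^esub> Z" if "Z \<in> Upper (module_sub R f) {X, Y}" for Z
    proof -
      have Z: "Z \<in> carrier (module_sub R f)" and "X \<le> Z" "Y \<le> Z"
        using that X Y by (auto simp: Upper_def module_sub_le)
      then have "X a \<subseteq> Z a" "Y a \<subseteq> Z a" for a by (simp_all add: le_fun_def)
      then have "?S a \<subseteq> Z a" for a
        unfolding S using module_sub_add[OF Z] by blast
      then show ?thesis by (simp add: module_sub_le le_fun_def)
    qed
    show "?S \<in> carrier (module_sub R f)"
      unfolding carrier_module_sub
    proof (intro conjI allI impI)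
      fix a
      have "subgroup (?S a) (additive_group (fst f a))"
        using comm_group.mult_subgroups[OF comm]
          additive.group_sub_subgroup[OF module_sub_additive[OF X], of a]
          additive.group_sub_subgroup[OF module_sub_additive[OF Y], of a]
        by (simp add: set_mult_additive_group)
      moreover have "r \<odot>\<^bsub>fst f a\<^esub> z \<in> ?S a" if r: "r \<in> carrier R" and z: "z \<in> ?S a" for r z
      proof -
        obtain x y where xy: "x \<in> X a" "y \<in> Y a" "z = x \<oplus>\<^bsub>fst f a\<^esub> y" using z unfolding S by blast
        have "r \<odot>\<^bsub>fst f a\<^esub> z = r \<odot>\<^bsub>fst f a\<^esub> x \<oplus>\<^bsub>fst f a\<^esub> r \<odot>\<^bsub>fst f a\<^esub> y"
          unfolding xy(3)
          by (rule unital_action.smult_r_distr[OF action r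
                subsetD[OF module_sub_subset[OF X] xy(1)] subsetD[OF module_sub_subset[OF Y] xy(2)]])
        then show ?thesis
          unfolding S using module_sub_smult[OF X r xy(1)] module_sub_smult[OF Y r xy(2)] by blast
      qed
      ultimately show "submodule (?S a) R (fst f a)"
        by (simp add: submodule_def submodule_axioms_def subgroup_additive_group)
    next
      fix a b assume ab: "(a::'i) \<le> b"
      show "snd f a b ` ?S a \<subseteq> ?S b"
      proof
        fix z assume "z \<in> snd f a b ` ?S a"
        then obtain x y where xy: "x \<in> X a" "y \<in> Y a" "z = snd f a b (x \<oplus>\<^bsub>fst f a\<^esub> y)"
          unfolding S by blast
        have "z = snd f a b x \<oplus>\<^bsub>fst f b\<^esub> snd f a b y"
          using map_module_hom[OF ab] subsetD[OF module_sub_subset[OF X] xy(1)]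
            subsetD[OF module_sub_subset[OF Y] xy(2)] xy(3)
          by (simp add: module_hom_def hom_def)
        moreover have "snd f a b x \<in> X b" "snd f a b y \<in> Y b"
          using X Y ab xy(1,2) unfolding carrier_module_sub by blast+
        ultimately show "z \<in> ?S b" unfolding S by blast
      qed
    qed
  qed (use X Y in simp)
qed (simp add: module_sub_le)

lemma module_sub_inf:
  assumes X: "X \<in> carrier (module_sub R f)" and Y: "Y \<in> carrier (module_sub R f)"
  shows "\<Sqinter>\<^bsub>module_sub R f\<^esub> {X, Y} = (\<lambda>a. X a \<inter> Y a)"
proof (rule inf_eqI)
  show "greatest (module_sub R f) (\<lambda>a. X a \<inter> Y a) (Lower (module_sub R f) {X, Y})"
  proof (rule greatest_LowerI)
    show "(\<lambda>a. X a \<inter> Y a) \<in> carrier (module_sub R f)"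
      unfolding carrier_module_sub
    proof (intro conjI allI impI)
      fix a
      have "subgroup (X a \<inter> Y a) (additive_group (fst f a))"
        using group.subgroups_Inter_pair[OF comm_group.axioms(2)[OF comm]]
          additive.group_sub_subgroup[OF module_sub_additive[OF X], of a]
          additive.group_sub_subgroup[OF module_sub_additive[OF Y], of a] by simp
      then show "submodule (X a \<inter> Y a) R (fst f a)"
        using module_sub_smult[OF X] module_sub_smult[OF Y]
        by (simp add: submodule_def submodule_axioms_def subgroup_additive_group)
    next
      fix a b assume "(a::'i) \<le> b"
      then have "snd f a b ` X a \<subseteq> X b" "snd f a b ` Y a \<subseteq> Y b"
        using X Y unfolding carrier_module_sub by simp_all
      then show "snd f a b ` (X a \<inter> Y a) \<subseteq> X b \<inter> Y b" by blast
    qed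
  qed (use X Y in \<open>auto simp: module_sub_le Lower_def le_fun_def\<close>)
qed (simp add: module_sub_le)

text \<open>Preservation of the join and the meet of \<open>down intervals J\<close> and
  \<open>sdown lam J\<close> is literally the product and the intersection condition of
  \<open>inc_diagram_iso\<close> for the additive groups.\<close>

lemma module_factor_inc_iso:
  assumes "module_saecular_cdi R f \<Omega>" and lin: "linearization intervals lam" and J: "J \<in> carrier intervals"
  shows "diagram_iso (module_iso R)
    (module_frac f (\<Omega> (sdown intervals J)) (\<Omega> (down intervals J)))
    (module_frac f (\<Omega> (sdown lam J)) (\<Omega> (down lam J))) (module_inc f (\<Omega> (sdown lam J)))"
    (is ?inc)
    and "\<exists>\<eta>. canonical_iso (module_sub R f) (module_frac f) (module_iso R) (module_inc f)
      (\<Omega> (sdown lam J)) (\<Omega> (down lam J)) (\<Omega> (sdown intervals J)) (\<Omega> (down intervals J)) \<eta>"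
proof -
  have cdi: "cdi_hom (module_sub R f) (module_frac f) module_zero (module_iso R) \<Omega>"
    using assms(1) by (simp add: module_saecular_cdi_def)
  note L = linearization_down[OF lin J]
  note dD = downset_down[OF J] and dS = downset_sdown[OF J]
  note closed = cdi_hom_closed[OF cdi L(2)] cdi_hom_closed[OF cdi dS]
    cdi_hom_closed[OF cdi L(1)] cdi_hom_closed[OF cdi dD]
  have ds: "downset intervals D" if "D \<in> {down intervals J, sdown lam J}" for D
    using that dD L(2) by blast
  have "\<Union>{down intervals J, sdown lam J} = down lam J" using L(7) by simp
  then have sum: "\<Omega> (down lam J) = (\<lambda>a. \<Omega> (down intervals J) a <+>\<^bsub>fst f a\<^esub> \<Omega> (sdown lam J) a)"
    using cdi_hom_Union[where F = "{down intervals J, sdown lam J}", OF cdi ds] by (simp add: module_sub_sup[OF closed(4,1)])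
  have "carrier intervals \<inter> \<Inter>{down intervals J, sdown lam J} = sdown intervals J"
    using L(8) dD by (auto simp: downset_def)
  then have Int: "\<Omega> (sdown intervals J) = (\<lambda>a. \<Omega> (down intervals J) a \<inter> \<Omega> (sdown lam J) a)"
    using cdi_hom_Inter[where F = "{down intervals J, sdown lam J}", OF cdi ds] by (simp add: module_sub_inf[OF closed(4,1)])
  have N: "\<Omega> (sdown intervals J) \<le> \<Omega> (sdown lam J)"
    unfolding Int by (simp add: le_fun_def)
  have M: "\<Omega> (down intervals J) \<le> \<Omega> (down lam J)"
  proof (rule le_funI, rule subsetI)
    fix a x assume x: "x \<in> \<Omega> (down intervals J) a"
    interpret abelian_group "fst f a" by (rule abelian)
    have "\<zero>\<^bsub>fst f a\<^esub> \<in> \<Omega> (sdown lam J) a"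
      using subgroup.one_closed[OF additive.group_sub_subgroup[OF module_sub_additive[OF closed(1)], of a]]
      by simp
    moreover have "x = x \<oplus>\<^bsub>fst f a\<^esub> \<zero>\<^bsub>fst f a\<^esub>"
      using subsetD[OF module_sub_subset[OF closed(4)] x] by simp
    ultimately show "x \<in> \<Omega> (down lam J) a"
      unfolding sum set_add_def set_mult_def using x by auto
  qed
  note add = module_sub_additive
  show inc: ?inc
  proof (rule module_inc_diagram_iso[OF closed(1,2) N closed(3,4) M])
    show "diagram_iso pointed_iso
      (group_frac additive (\<Omega> (sdown intervals J)) (\<Omega> (down intervals J)))
      (group_frac additive (\<Omega> (sdown lam J)) (\<Omega> (down lam J)))
      (group_inc additive (\<Omega> (sdown lam J)))"
      by (rule additive.inc_diagram_iso[OF add[OF closed(1)] add[OF closed(2)] N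
            add[OF closed(3)] add[OF closed(4)] M])
        (simp_all add: Int sum set_mult_additive_group)
  qed
  show "\<exists>\<eta>. canonical_iso (module_sub R f) (module_frac f) (module_iso R) (module_inc f)
      (\<Omega> (sdown lam J)) (\<Omega> (down lam J)) (\<Omega> (sdown intervals J)) (\<Omega> (down intervals J)) \<eta>"
    by (rule module_canonical_iso[OF closed(1,2) N closed(3,4) M inc])
qed

end

section \<open>Modules and groups together\<close>

lemma is_diagram_weaken:
  assumes "is_diagram Ob Hom f" "\<And>X. Ob X \<Longrightarrow> Ob' X"
  shows "is_diagram Ob' Hom f"
  using assms by (simp add: is_diagram_def)

theorem theorem7:
  fixes R :: "('r, 's) ring_scheme"
    and f :: "('i::wellorder, ('r, 'g) module, 'g) diagram"
    and g :: "('i, 'h monoid, 'h) diagram"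
    and \<Omega> :: "'i set set \<Rightarrow> 'i \<Rightarrow> 'g set"
    and \<Psi> :: "'i set set \<Rightarrow> 'i \<Rightarrow> 'h set"
    and lam lam' :: "'i set gorder"
    and J :: "'i set"
  assumes "linearization intervals lam"
    and "linearization intervals lam'"
    and "J \<in> carrier intervals"
  shows
   "((is_diagram (left_module R) (module_hom R) f \<or> is_diagram (right_module R) (module_hom R) f)
       \<and> module_saecular_cdi R f \<Omega> \<longrightarrow>
       (\<exists>\<eta>. canonical_iso (module_sub R f) (module_frac f) (module_iso R) (module_inc f)
          (subsaecular_series \<Omega> lam (sdown lam J)) (subsaecular_series \<Omega> lam (down lam J))
          (\<Omega> (sdown intervals J)) (\<Omega> (down intervals J)) \<eta>) \<and>
       (\<exists>\<theta>. diagram_iso (module_iso R)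
          (module_frac f
            (subsaecular_series \<Omega> lam (sdown lam J)) (subsaecular_series \<Omega> lam (down lam J)))
          (module_frac f
            (subsaecular_series \<Omega> lam' (sdown lam' J)) (subsaecular_series \<Omega> lam' (down lam' J)))
          \<theta>))
    \<and> (is_diagram group (\<lambda>G H h. h \<in> hom G H) g \<and> group_saecular_cdi g \<Psi> \<longrightarrow>
       (\<exists>\<eta>. canonical_iso (group_sub g) (group_frac g) pointed_iso (group_inc g)
          (subsaecular_series \<Psi> lam (sdown lam J)) (subsaecular_series \<Psi> lam (down lam J))
          (\<Psi> (sdown intervals J)) (\<Psi> (down intervals J)) \<eta>) \<and>
       (\<exists>\<theta>. diagram_iso pointed_iso
          (group_frac g
            (subsaecular_series \<Psi> lam (sdown lam J)) (subsaecular_series \<Psi> lam (down lam J)))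
          (group_frac g
            (subsaecular_series \<Psi> lam' (sdown lam' J)) (subsaecular_series \<Psi> lam' (down lam' J)))
          \<theta>))"
proof (intro conjI impI)
  note lin = assms(1,2) and J = assms(3)
  {
    assume "(is_diagram (left_module R) (module_hom R) f \<or> is_diagram (right_module R) (module_hom R) f)
      \<and> module_saecular_cdi R f \<Omega>"
    then have \<Omega>: "module_saecular_cdi R f \<Omega>"
      and "is_diagram (left_module R) (module_hom R) f \<or> is_diagram (right_module R) (module_hom R) f"
      by simp_all
    then have "is_diagram (unital_action R) (module_hom R) f"
      using is_diagram_weaken[of _ "module_hom R" f "unital_action R"]
        left_module.axioms(1) right_module.axioms(1) by metis
    then interpret module_diagram R f by unfold_locales
    note factor = module_factor_inc_iso[OF \<Omega> lin(1) J] module_factor_inc_iso[OF \<Omega> lin(2) J]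
    show "\<exists>\<eta>. canonical_iso (module_sub R f) (module_frac f) (module_iso R) (module_inc f)
        (subsaecular_series \<Omega> lam (sdown lam J)) (subsaecular_series \<Omega> lam (down lam J))
        (\<Omega> (sdown intervals J)) (\<Omega> (down intervals J)) \<eta>"
      unfolding subsaecular_series_eq[OF lin(1) J] by (rule factor(2))
    \<comment> \<open>For independence of the linearization, the factor of \<open>lam\<close> is
      mapped to the interval factor by the canonical isomorphism and from there, by inclusion, into
      the factor of \<open>lam'\<close>.\<close>
    obtain \<eta> where \<eta>: "diagram_iso (module_iso R) (module_frac f (\<Omega> (sdown lam J)) (\<Omega> (down lam J)))
        (module_frac f (\<Omega> (sdown intervals J)) (\<Omega> (down intervals J))) \<eta>"
      using canonical_iso_diagram_iso[where Frac = "module_frac f" and Iso = "module_iso R", OF factor(2)]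
      by (elim exE)
    show "\<exists>\<theta>. diagram_iso (module_iso R)
        (module_frac f (subsaecular_series \<Omega> lam (sdown lam J)) (subsaecular_series \<Omega> lam (down lam J)))
        (module_frac f (subsaecular_series \<Omega> lam' (sdown lam' J)) (subsaecular_series \<Omega> lam' (down lam' J)))
        \<theta>"
      unfolding subsaecular_series_eq[OF lin(1) J] subsaecular_series_eq[OF lin(2) J]
      by (rule exI, rule diagram_iso_comp[OF \<eta> factor(3)])
        (erule (1) module_iso_closed module_iso_comp)+
  }
  {
    assume "is_diagram group (\<lambda>G H h. h \<in> hom G H) g \<and> group_saecular_cdi g \<Psi>"
    then have \<Psi>: "group_saecular_cdi g \<Psi>" and "is_diagram group (\<lambda>G H h. h \<in> hom G H) g" by simp_all
    then interpret group_diagram g by unfold_locales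
    note factor = factor_inc_iso[OF \<Psi> lin(1) J] factor_inc_iso[OF \<Psi> lin(2) J]
    show "\<exists>\<eta>. canonical_iso (group_sub g) (group_frac g) pointed_iso (group_inc g)
        (subsaecular_series \<Psi> lam (sdown lam J)) (subsaecular_series \<Psi> lam (down lam J))
        (\<Psi> (sdown intervals J)) (\<Psi> (down intervals J)) \<eta>"
      unfolding subsaecular_series_eq[OF lin(1) J] by (rule factor(2))
    obtain \<eta> where \<eta>: "diagram_iso pointed_iso (group_frac g (\<Psi> (sdown lam J)) (\<Psi> (down lam J)))
        (group_frac g (\<Psi> (sdown intervals J)) (\<Psi> (down intervals J))) \<eta>"
      using canonical_iso_diagram_iso[where Frac = "group_frac g" and Iso = "pointed_iso", OF factor(2)]
      by (elim exE)
    show "\<exists>\<theta>. diagram_iso pointed_iso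
        (group_frac g (subsaecular_series \<Psi> lam (sdown lam J)) (subsaecular_series \<Psi> lam (down lam J)))
        (group_frac g (subsaecular_series \<Psi> lam' (sdown lam' J)) (subsaecular_series \<Psi> lam' (down lam' J)))
        \<theta>"
      unfolding subsaecular_series_eq[OF lin(1) J] subsaecular_series_eq[OF lin(2) J]
      by (rule exI, rule diagram_iso_comp[OF \<eta> factor(3)])
        (erule (1) pointed_iso_closed pointed_iso_comp)+
  }
qed

end
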